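(* Let $m\ge 2$ and $r\in\{1,2,\ldots,m-1\}$ be integers. Then $$ \begin{aligned} \gamma_1\!\left(\frac rm\right)=\;&\gamma_1-\gamma\ln 2m-\ln^2 2-\ln 2\cdot\ln \pi m-\frac12\ln^2 m-\frac{\pi}{2}(\gamma+\ln 2\pi m)\cot\frac{\pi r}{m}\\ &-\frac{(-1)^r}{4}\left[1-(-1)^{m+1}\right](3\ln 2+2\ln\pi)\ln 2\\ &-\pi\ln\pi\cdot\csc\frac{\pi r}{m}\cdot\sin\!\left(\frac{\pi r}{m}\left\lfloor\frac{m+1}{2}\right\rfloor\right)\cdot\sin\!\left(\frac{\pi r}{m}\left\lfloor\frac{m-1}{2}\right\rfloor\right)\\ &+2(\gamma+\ln 2\pi m)\sum_{l=1}^{\lfloor (m-1)/2\rfloor}\cos\frac{2\pi rl}{m}\cdot\ln\sin\frac{\pi l}{m} +\pi\sum_{l=1}^{\lfloor (m-1)/2\rfloor}\sin\frac{2\pi rl}{m}\cdot\ln\sin\frac{\pi l}{m}\\ &+2\pi\sum_{l=1}^{\lfloor (m-1)/2\rfloor}\sin\frac{2\pi rl}{m}\cdot\ln\Gamma\!\left(\frac lm\right) +\sum_{l=1}^{\lfloor (m-1)/2\rfloor}\cos\frac{2\pi rl}{m}\cdot\left\{\zeta''\!\left(0,\frac lm\right)+\zeta''\!\left(0,1-\frac lm\right)\right\}. \end{aligned} $$ The following three alternative forms of this formula also hold for the same $r,m$: $$ \begin{aligned} \gamma_1\!\left(\frac rm\right)=\;&\gamma_1-\gamma\ln 2m+\sum_{l=1}^{m-1}\cos\frac{2\pi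 rl}{m}\cdot\zeta''\!\left(0,\frac lm\right)+\pi\sum_{l=1}^{m-1}\sin\frac{2\pi rl}{m}\cdot\ln\Gamma\!\left(\frac lm\right)-\ln^2 2\\ &-\frac{\pi}{2}(\gamma+\ln 2\pi m)\cot\frac{\pi r}{m}+(\gamma+\ln 2\pi m)\sum_{l=1}^{m-1}\cos\frac{2\pi rl}{m}\cdot\ln\sin\frac{\pi l}{m}-\ln 2\cdot\ln\pi m-\frac12\ln^2 m; \end{aligned} $$ $$ \begin{aligned} \gamma_1\!\left(\frac rm\right)=\;&\gamma_1+\gamma^2+\gamma\ln 2\pi m+\ln 2\pi\cdot\ln m+\frac12\ln^2 m+(\gamma+\ln 2\pi m)\,\Psi\!\left(\frac rm\right)\\ &+\pi\sum_{l=1}^{m-1}\sin\frac{2\pi rl}{m}\cdot\ln\Gamma\!\left(\frac lm\right)+\sum_{l=1}^{m-1}\cos\frac{2\pi rl}{m}\cdot\zeta''\!\left(0,\frac lm\right); \end{aligned} $$ $$ \begin{aligned} \gamma_1\!\left(\frac rm\right)=\;&\gamma_1-\gamma\ln 2m-\ln^2 2-\ln 2\cdot\ln\pi m-\frac12\ln^2 m +\pi\sum_{l=1}^{m-1}\sin\frac{2\pi rl}{m}\cdot\left\{\ln\Gamma\!\left(\frac lm\right)+\frac{l(\gamma+\ln 2\pi m)}{m}\right\}\\ &+\sum_{l=1}^{m-1}\cos\frac{2\pi rl}{m}\cdot\left\{\zeta''\!\left(0,\frac lm\right)+(\gamma+\ln 2\pi m)\ln\sin\frac{\pi l}{m}\right\}.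 \end{aligned} $$ Moreover, the values at other arguments are obtained from the recurrence $\gamma_1(v+1)=\gamma_1(v)-\dfrac{\ln v}{v}$, valid for all complex $v\notin\{0,-1,-2,\ldots\}$.
   Context: $\zeta(s)$ is the Riemann zeta function and $\zeta(s,v)$ the Hurwitz zeta function, $\zeta(s,v)=\sum_{n\ge0}(n+v)^{-s}$ for $\operatorname{Re}s>1$, $v\ne0,-1,-2,\ldots$ (principal branch of the logarithm), continued meromorphically in $s$ to $\mathbb C$ with a single simple pole at $s=1$ of residue $1$. The Stieltjes constants $\gamma_n$ and generalized Stieltjes constants $\gamma_n(v)$ are defined by the Laurent expansions at $s=1$: $\zeta(s)=\frac1{s-1}+\sum_{n\ge0}\frac{(-1)^n(s-1)^n}{n!}\gamma_n$ and $\zeta(s,v)=\frac1{s-1}+\sum_{n\ge0}\frac{(-1)^n(s-1)^n}{n!}\gamma_n(v)$; thus $\gamma_n=\gamma_n(1)$. $\gamma=\gamma_0$ is Euler's constant, $\Gamma$ the Gamma function, $\Psi=\Gamma'/\Gamma$ the Digamma function. $\zeta''(0,v)$ denotes the second derivative of $\zeta(s,v)$ with respect to $s$ at $s=0$. $\ln 2\pi m$ means $\ln(2\pi m)$, and similarly $\ln 2m=\ln(2m)$, $\ln\pi m=\ln(\pi m)$; $\ln^k x=(\ln x)^k$. Empty sums are $0$. *)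

theory Defs
  imports "HOL-Complex_Analysis.Complex_Analysis"
begin

(* For every v at most one function satisfies the description, by the identity theorem on the
   connected set -{1}; it exists by analytic continuation. The value 0 at the pole s = 1 is only
   a convention that makes the function unique. For v in {0, -1, -2, ...} the singular term of
   the series is dropped, because 0 powr (-s) = 0. *)
definition hurwitz_zeta :: "complex \<Rightarrow> complex \<Rightarrow> complex" where
  "hurwitz_zeta s v =
     (THE f. f holomorphic_on -{1} \<and> f 1 = 0 \<and>
             (\<forall>z. Re z > 1 \<longrightarrow> (\<lambda>n. (of_nat n + v) powr (-z)) sums f z)) s"

definition riemann_zeta :: "complex \<Rightarrow> complex" where
  "riemann_zeta s = hurwitz_zeta s 1"

(* The coefficient of (s - 1) ^ n in the Laurent expansion at s = 1 is (-1) ^ n / n! times the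
   n-th Stieltjes constant; the value of the function at the point s = 1 itself plays no role. *)
definition gen_stieltjes :: "nat \<Rightarrow> complex \<Rightarrow> complex" where
  "gen_stieltjes n v =
     (-1) ^ n * fact n * fls_nth (laurent_expansion (\<lambda>s. hurwitz_zeta s v) 1) (int n)"

definition stieltjes :: "nat \<Rightarrow> complex" where
  "stieltjes n = (-1) ^ n * fact n * fls_nth (laurent_expansion riemann_zeta 1) (int n)"

definition hurwitz_zeta_deriv2_0 :: "complex \<Rightarrow> complex" where
  "hurwitz_zeta_deriv2_0 v = (deriv ^^ 2) (\<lambda>s. hurwitz_zeta s v) 0"

end

(*
  Idea. Write t/(1 - exp(-t)) as a Taylor polynomial plus remainder in the Mellin transform of
  exp(-v t)/(1 - exp(-t)); this continues zeta(s,v) and yields zeta(0,v) = 1/2 - v. The values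
  zeta'(0,v) = ln Gamma(v) - ln(2 pi)/2 and gamma_0(v) = -Psi(v) follow from their recurrences in v
  and their asymptotics as v tends to infinity.

  For 0 < a < 1 let phi(t) = 1/(exp(t - 2 pi i a) - 1). The Mellin transform of phi is Gamma(u) times
  the sum over n of exp(2 pi i a n) n^(-u), which for a = r/m is a combination of the zeta(u,l/m);
  on the strip -1 < Re u < 0 it is the integral of t^(u-1) (phi(t) - phi(0)). Expanding phi(t) - phi(0)
  in partial fractions and integrating term by term turns it into values zeta(1-u,a), zeta(1-u,1-a).
  Solving for zeta(1-u,a) gives Hurwitz' formula
    u zeta(1-u,r/m) = 2 Gamma(1+u) (2 pi m)^(-u) (SUM l=1..m. cos(pi u/2 - 2 pi r l/m) zeta(u,l/m)),
  whose Taylor coefficient of order 2 at u = 0 contains gamma_1(r/m) on the left and the zeta''(0,l/m)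
  on the right, and whose coefficient of order 1 is Gauss' formula for Psi(r/m). The unknown constant
  zeta''(0,1) - Gamma''(1)/2 is eliminated with the instance m = 2, where zeta(s,1/2) = (2^s - 1) zeta(s).
*)
theory Submission
  imports Defs "HOL-Real_Asymp.Real_Asymp"
begin

section \<open>Integrals depending holomorphically on a parameter\<close>

text \<open>The twisted series speaks about Re u > 1 and the partial fractions only about -1 < Re u
  < 0; the strip between them has to be bridged, and the cut-off kernel
  \<open>twisted_kernel_reg\<close> does this. Integrals with a parameter are computed for real
  parameters and extended by the identity theorem, so that no contour has to be shifted. The partial
  fractions themselves come from the reflection formula of the Digamma function.

  One value of a yields one equation in the two unknowns zeta(1-u,a) and zeta(1-u,1-a); the instance
  m - r in place of r is the second equation. Multiplication by u removes the pole of zeta(1-u,a) at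
  u = 0, so that all comparisons are made between power series, and it moves gamma_1 to order 2.

  The combination zeta''(0,1) + pi^2/8 - Gamma''(1)/2 is the same for all m and r. This is why a
  single instance in which everything else is known determines it.\<close>

lemma holomorphic_on_lebesgue_integral:
  fixes f :: "complex \<Rightarrow> 'a \<Rightarrow> complex"
  assumes "open U"
    and meas: "\<And>s. s \<in> U \<Longrightarrow> f s \<in> borel_measurable M"
    and hol: "\<And>t. t \<in> space M \<Longrightarrow> (\<lambda>s. f s t) holomorphic_on U"
    and dom: "\<And>s0. s0 \<in> U \<Longrightarrow> \<exists>e>0. \<exists>B. cball s0 e \<subseteq> U \<and> integrable M B \<and>
                (\<forall>s\<in>cball s0 e. \<forall>t\<in>space M. norm (f s t) \<le> B t)"
  shows "(\<lambda>s. \<integral>t. f s t \<partial>M) holomorphic_on U"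
proof -
  have "\<exists>D. ((\<lambda>s. \<integral>t. f s t \<partial>M) has_field_derivative D) (at s0)" if s0: "s0 \<in> U" for s0
  proof -
    obtain e B where e: "e > 0" and sub: "cball s0 e \<subseteq> U" and B: "integrable M B"
      and bd: "\<And>s t. s \<in> cball s0 e \<Longrightarrow> t \<in> space M \<Longrightarrow> norm (f s t) \<le> B t"
      using dom[OF s0] by blast
    have fint: "integrable M (f s)" if "s \<in> cball s0 e" for s
      by (rule Bochner_Integration.integrable_bound[OF B])
         (use meas sub bd that in \<open>auto intro!: AE_I2 order.trans[OF _ abs_ge_self]\<close>)
    \<comment> \<open>Cauchy's inequality on the disc of radius e/2 around s, which stays inside
      \<open>cball s0 e\<close>, turns the bound on f into one on its derivative. So dominating f
      alone makes dominated convergence applicable to the difference quotients.\<close>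
    have derbd: "norm (deriv (\<lambda>s. f s t) s) \<le> 2 * B t / e"
      if "s \<in> ball s0 (e/2)" "t \<in> space M" for s t
    proof -
      have sub': "cball s (e/2) \<subseteq> cball s0 e"
      proof
        fix x assume "x \<in> cball s (e/2)"
        moreover have "dist s0 x \<le> dist s0 s + dist s x" by (rule dist_triangle)
        ultimately show "x \<in> cball s0 e" using that by auto
      qed
      have h: "(\<lambda>s. f s t) holomorphic_on cball s (e/2)"
        by (rule holomorphic_on_subset[OF hol]) (use that sub sub' in auto)
      have "norm ((deriv ^^ 1) (\<lambda>s. f s t) s) \<le> fact 1 * B t / (e/2) ^ 1"
        by (rule Cauchy_inequality)
           (use e h that sub' bd in \<open>auto intro!: holomorphic_on_imp_continuous_on
              intro: holomorphic_on_subset[OF h] simp: dist_norm subset_iff\<close>)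
      thus ?thesis by (simp add: field_simps)
    qed
    have quot: "norm ((f s t - f s0 t) / (s - s0)) \<le> 2 * B t / e"
      if "s \<in> ball s0 (e/2)" "t \<in> space M" for s t
    proof (cases "s = s0")
      case False
      have "norm (f s t - f s0 t) \<le> 2 * B t / e * norm (s - s0)"
      proof (rule field_differentiable_bound[where S = "ball s0 (e/2)"])
        fix z assume z: "z \<in> ball s0 (e/2)"
        have "(\<lambda>s. f s t) holomorphic_on ball s0 (e/2)"
          by (rule holomorphic_on_subset[OF hol]) (use that sub e in \<open>auto simp: subset_iff\<close>)
        thus "((\<lambda>s. f s t) has_field_derivative deriv (\<lambda>s. f s t) z) (at z within ball s0 (e/2))"
          using z by (intro holomorphic_derivI) auto
        show "norm (deriv (\<lambda>s. f s t) z) \<le> 2 * B t / e" using derbd z that by blast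
      qed (use that e in auto)
      thus ?thesis using False by (simp add: norm_divide field_simps)
    next
      case True
      have "0 \<le> B t" using bd[of s0 t] that e norm_ge_zero[of "f s0 t"] by (meson centre_in_cball less_imp_le order_trans)
      thus ?thesis using True e by simp
    qed
    have "((\<lambda>s. ((\<integral>t. f s t \<partial>M) - (\<integral>t. f s0 t \<partial>M)) / (s - s0)) \<longlongrightarrow>
            (\<integral>t. deriv (\<lambda>s. f s t) s0 \<partial>M)) (at s0)"
      unfolding tendsto_at_iff_sequentially
    proof (intro allI impI)
      fix X assume X: "\<forall>i. X i \<in> UNIV - {s0}" "X \<longlonglongrightarrow> s0"
      have "eventually (\<lambda>i. X i \<in> ball s0 (e/2)) sequentially"
        using X(2) e by (intro topological_tendstoD) auto
      then obtain N where N: "\<And>n. n \<ge> N \<Longrightarrow> X n \<in> ball s0 (e/2)"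
        by (auto simp: eventually_sequentially)
      \<comment> \<open>The tail of X lies in the small ball from its first term on;
        \<open>LIMSEQ_offset\<close> passes back to X at the end.\<close>
      define Y where "Y = (\<lambda>n. X (n + N))"
      have Y: "Y n \<in> ball s0 (e/2)" "Y n \<noteq> s0" for n using N X by (auto simp: Y_def)
      have Yin: "Y n \<in> cball s0 e" for n using Y(1)[of n] e by auto
      have Ylim: "Y \<longlonglongrightarrow> s0" unfolding Y_def by (rule LIMSEQ_ignore_initial_segment[OF X(2)])
      have ptw: "(\<lambda>n. (f (Y n) t - f s0 t) / (Y n - s0)) \<longlonglongrightarrow> deriv (\<lambda>s. f s t) s0"
        if "t \<in> space M" for t
      proof -
        have "((\<lambda>s. f s t) has_field_derivative deriv (\<lambda>s. f s t) s0) (at s0)"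
          using holomorphic_derivI[OF hol[OF that] \<open>open U\<close> s0] .
        hence "((\<lambda>s. (f s t - f s0 t) / (s - s0)) \<longlongrightarrow> deriv (\<lambda>s. f s t) s0) (at s0)"
          by (simp add: has_field_derivative_iff)
        thus ?thesis using Y Ylim unfolding tendsto_at_iff_sequentially o_def by auto
      qed
      have m1: "(\<lambda>t. (f (Y n) t - f s0 t) / (Y n - s0)) \<in> borel_measurable M" for n
        by (intro borel_measurable_divide borel_measurable_diff meas borel_measurable_const)
           (use Yin sub s0 in auto)
      have "(\<lambda>n. \<integral>t. (f (Y n) t - f s0 t) / (Y n - s0) \<partial>M) \<longlonglongrightarrow> (\<integral>t. deriv (\<lambda>s. f s t) s0 \<partial>M)"
      proof (rule integral_dominated_convergence[where w = "\<lambda>t. 2 * B t / e"])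
        \<comment> \<open>The derivative is measurable in t as the pointwise limit of measurable
          quotients.\<close>
        show "(\<lambda>t. deriv (\<lambda>s. f s t) s0) \<in> borel_measurable M"
          by (rule borel_measurable_LIMSEQ_metric[OF m1 ptw])
        show "integrable M (\<lambda>t. 2 * B t / e)" using B by auto
        show "AE t in M. (\<lambda>n. (f (Y n) t - f s0 t) / (Y n - s0)) \<longlonglongrightarrow> deriv (\<lambda>s. f s t) s0"
          using ptw by auto
        show "AE t in M. norm ((f (Y n) t - f s0 t) / (Y n - s0)) \<le> 2 * B t / e" for n
          using quot[OF Y(1)] by auto
      qed (rule m1)
      also have "(\<lambda>n. \<integral>t. (f (Y n) t - f s0 t) / (Y n - s0) \<partial>M) =
                 (\<lambda>n. ((\<integral>t. f (Y n) t \<partial>M) - (\<integral>t. f s0 t \<partial>M)) / (Y n - s0))"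
        by (rule ext, subst integral_divide_zero, subst Bochner_Integration.integral_diff)
           (use fint Yin e in auto)
      finally have "(\<lambda>n. ((\<lambda>s. ((\<integral>t. f s t \<partial>M) - (\<integral>t. f s0 t \<partial>M)) / (s - s0)) \<circ> X) (n + N))
        \<longlonglongrightarrow> (\<integral>t. deriv (\<lambda>s. f s t) s0 \<partial>M)" by (simp add: Y_def)
      thus "((\<lambda>s. ((\<integral>t. f s t \<partial>M) - (\<integral>t. f s0 t \<partial>M)) / (s - s0)) \<circ> X)
        \<longlonglongrightarrow> (\<integral>t. deriv (\<lambda>s. f s t) s0 \<partial>M)" by (rule LIMSEQ_offset)
    qed
    thus ?thesis by (auto simp: has_field_derivative_iff)
  qed
  thus ?thesis using \<open>open U\<close>
    by (auto simp: holomorphic_on_open field_differentiable_def)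
qed

lemma holomorphic_on_set_lebesgue_integral:
  fixes f :: "complex \<Rightarrow> 'a \<Rightarrow> complex"
  assumes "open U"
    and meas: "\<And>s. s \<in> U \<Longrightarrow> set_borel_measurable M A (f s)"
    and hol: "\<And>t. t \<in> A \<Longrightarrow> (\<lambda>s. f s t) holomorphic_on U"
    and dom: "\<And>s0. s0 \<in> U \<Longrightarrow> \<exists>e>0. \<exists>B. cball s0 e \<subseteq> U \<and> set_integrable M A B \<and>
                (\<forall>s\<in>cball s0 e. \<forall>t\<in>A. norm (f s t) \<le> B t)"
  shows "(\<lambda>s. LINT t:A|M. f s t) holomorphic_on U"
  unfolding set_lebesgue_integral_def
proof (rule holomorphic_on_lebesgue_integral[OF \<open>open U\<close>])
  show "(\<lambda>t. indicator A t *\<^sub>R f s t) \<in> borel_measurable M" if "s \<in> U" for s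
    using meas[OF that] by (simp add: set_borel_measurable_def)
  show "(\<lambda>s. indicator A t *\<^sub>R f s t) holomorphic_on U" for t
    using hol[of t] by (cases "t \<in> A") auto
  fix s0 assume "s0 \<in> U"
  from dom[OF this] obtain e B where "e > 0" "cball s0 e \<subseteq> U" "set_integrable M A B"
    "\<forall>s\<in>cball s0 e. \<forall>t\<in>A. norm (f s t) \<le> B t" by blast
  thus "\<exists>e>0. \<exists>B. cball s0 e \<subseteq> U \<and> integrable M B \<and>
    (\<forall>s\<in>cball s0 e. \<forall>t\<in>space M. norm (indicator A t *\<^sub>R f s t) \<le> B t)"
    by (intro exI[of _ e] exI[of _ "\<lambda>t. indicator A t *\<^sub>R B t"] conjI)
       (auto simp: set_integrable_def indicator_def)
qed

section \<open>Gamma-type integrals and the Laplace transform of powers\<close>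

lemma set_borel_measurable_lborel_continuous_on:
  fixes f :: "real \<Rightarrow> complex"
  assumes "continuous_on A f" "A \<in> sets borel"
  shows "set_borel_measurable lborel A f"
  using borel_measurable_continuous_on_indicator[OF assms(2,1)]
  by (simp add: set_borel_measurable_def)

text \<open>\<open>absolutely_integrable_on\<close> refers to the completion of
  \<open>lborel\<close>; for Borel measurable integrands both notions agree. This gives access to
  the Gamma, Beta and power integrals that are known for the gauge integral.\<close>

lemma set_integrable_lborel_iff_absolutely_integrable_on:
  fixes f :: "real \<Rightarrow> 'b::euclidean_space"
  assumes "continuous_on A f" "A \<in> sets borel"
  shows "set_integrable lborel A f \<longleftrightarrow> f absolutely_integrable_on A"
  using borel_measurable_continuous_on_indicator[OF assms(2,1)]
  by (simp add: set_integrable_def integrable_completion)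

lemma set_integrable_Gamma_real:
  assumes "\<sigma> > 0" "a > (0::real)"
  shows "set_integrable lborel {0<..} (\<lambda>t. t powr (\<sigma> - 1) * exp (- a * t))"
proof -
  have "(\<lambda>t. complex_of_real t powr (\<sigma> - 1) / of_real (exp (a * t))) absolutely_integrable_on {0<..}"
    using absolutely_integrable_Gamma_integral[of "of_real \<sigma>" a] assms by simp
  hence "(\<lambda>t. norm (complex_of_real t powr (\<sigma> - 1) / of_real (exp (a * t)))) absolutely_integrable_on {0<..}"
    by (rule set_integrable_norm)
  also have "?this \<longleftrightarrow> (\<lambda>t. t powr (\<sigma> - 1) * exp (- a * t)) absolutely_integrable_on {0<..}"
    by (rule set_integrable_cong) (auto simp: norm_mult norm_inverse norm_powr_real_powr exp_minus divide_inverse)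
  finally show ?thesis
    by (subst set_integrable_lborel_iff_absolutely_integrable_on) (auto intro!: continuous_intros)
qed

lemma set_integrable_lborel_boundI:
  fixes f :: "real \<Rightarrow> complex"
  assumes "continuous_on A f" "A \<in> sets borel" "set_integrable lborel A B"
    "\<And>t. t \<in> A \<Longrightarrow> norm (f t) \<le> B t"
  shows "set_integrable lborel A f"
proof (rule set_integrable_bound[OF assms(3) set_borel_measurable_lborel_continuous_on])
  show "AE x in lborel. x \<in> A \<longrightarrow> norm (f x) \<le> norm (B x)"
    using assms(4) by (auto intro!: AE_I2 order.trans[OF _ abs_ge_self])
qed (use assms in auto)

lemma norm_Laplace_kernel:
  assumes "t > 0"
  shows "norm (of_real t powr (s - 1) * exp (- p * of_real t)) = t powr (Re s - 1) * exp (- Re p * t)"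
  using assms by (simp add: norm_mult norm_powr_real_powr)

lemma set_integrable_Laplace:
  assumes "Re s > 0" "Re p > 0"
  shows "set_integrable lborel {0<..} (\<lambda>t. of_real t powr (s - 1) * exp (- p * of_real t))"
  by (rule set_integrable_lborel_boundI[OF _ _ set_integrable_Gamma_real[OF assms]])
     (use norm_Laplace_kernel[of _ s p] in \<open>auto intro!: continuous_intros\<close>)

lemma holomorphic_on_Laplace:
  assumes "Re s > 0"
  shows "(\<lambda>p. LINT t:{0<..}|lborel. of_real t powr (s - 1) * exp (- p * of_real t)) holomorphic_on {p. Re p > 0}"
proof (rule holomorphic_on_set_lebesgue_integral)
  fix p0 :: complex assume p0: "p0 \<in> {p. Re p > 0}"
  \<comment> \<open>On the disc of radius Re p0 / 2 the real part is at least Re p0 / 2, so one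
    exponential dominates all parameters of the disc.\<close>
  have *: "Re p0 / 2 \<le> Re p" if "p \<in> cball p0 (Re p0 / 2)" for p
    using abs_Re_le_cmod[of "p0 - p"] that by (auto simp: dist_norm)
  have **: "t powr (Re s - 1) * exp (- Re p * t) \<le> t powr (Re s - 1) * exp (- (Re p0 / 2) * t)" 
    if "p \<in> cball p0 (Re p0 / 2)" "t > 0" for t p
    using *[OF that(1)] that(2) by (intro mult_left_mono) auto
  show "\<exists>e>0. \<exists>B. cball p0 e \<subseteq> {p. Re p > 0} \<and> set_integrable lborel {0<..} B \<and>
     (\<forall>p\<in>cball p0 e. \<forall>t\<in>{0<..}. norm (of_real t powr (s - 1) * exp (- p * of_real t)) \<le> B t)"
  proof (intro exI[of _ "Re p0 / 2"] exI[of _ "\<lambda>t. t powr (Re s - 1) * exp (- (Re p0 / 2) * t)"] conjI ballI)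
    fix p and t :: real assume "p \<in> cball p0 (Re p0 / 2)" "t \<in> {0<..}"
    thus "norm (of_real t powr (s - 1) * exp (- p * complex_of_real t)) \<le>  t powr (Re s - 1) * exp (- (Re p0 / 2) * t)"
      using **[of p t] norm_Laplace_kernel[of t s p] by simp
  next
    show "cball p0 (Re p0 / 2) \<subseteq> {p. 0 < Re p}" using * p0 by fastforce
    show "set_integrable lborel {0<..} (\<lambda>t. t powr (Re s - 1) * exp (- (Re p0 / 2) * t))"
      by (rule set_integrable_Gamma_real) (use p0 assms in auto)
  qed (use p0 in auto)
qed (auto intro!: open_halfspace_Re_gt set_borel_measurable_lborel_continuous_on continuous_intros holomorphic_intros)

text \<open>The substitution of x * t for t in the Gamma integral.\<close>

lemma Laplace_real:
  assumes "Re s > 0" "x > 0"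
  shows "(LINT t:{0<..}|lborel. of_real t powr (s - 1) * exp (- of_real x * of_real t)) = Gamma s * of_real x powr (-s)"
proof -
  define f where "f = (\<lambda>t::real. complex_of_real t powr (s - 1) * exp (- complex_of_real t))"
  have "(LINT t:{0<..}|lborel. f t) = integral {0<..} f"
    unfolding f_def by (rule set_borel_integral_eq_integral)
      (use set_integrable_Laplace[of s 1] assms in \<open>auto\<close>)
  also have "\<dots> = Gamma s"
    using Gamma_integral_complex'[OF assms(1)] unfolding f_def
    by (intro integral_unique) (auto simp: exp_minus divide_inverse exp_of_real)
  finally have 1: "(LINT t:{0<..}|lborel. f t) = Gamma s" .
  have "Gamma s = x *\<^sub>R (LBINT t. indicator {0<..} (0 + x * t) *\<^sub>R f (0 + x * t))"
    using lborel_integral_real_affine[of x "\<lambda>t. indicator {0<..} t *\<^sub>R f t" 0] assms 1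
    by (simp add: set_lebesgue_integral_def)
  also have "(LBINT t. indicator {0<..} (0 + x * t) *\<^sub>R f (0 + x * t)) =
    (LBINT t. of_real x powr (s - 1) * (indicator {0<..} t *\<^sub>R (of_real t powr (s - 1) * exp (- of_real x * of_real t))))"
    by (rule Bochner_Integration.integral_cong) 
       (use assms in \<open>auto simp: indicator_def f_def zero_less_mult_iff powr_times_real\<close>)
  also have "\<dots> = of_real x powr (s - 1) * (LINT t:{0<..}|lborel. of_real t powr (s - 1) * exp (- of_real x * of_real t))"
    by (subst integral_mult_right_zero) (simp add: set_lebesgue_integral_def)
  finally show ?thesis using assms
    by (simp add: scaleR_conv_of_real powr_minus powr_diff field_simps)
qed

text \<open>The form of the identity theorem by which formulas proved for real parameters are
  extended. The midpoint of the segment serves as the limit point.\<close>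

lemma holomorphic_eq_of_eq_on_real_segment:
  assumes hol: "f holomorphic_on S" "g holomorphic_on S" and S: "open S" "connected S"
    and ab: "a < b" and sub: "complex_of_real ` {a<..<b} \<subseteq> S"
    and eq: "\<And>x. a < x \<Longrightarrow> x < b \<Longrightarrow> f (of_real x) = g (of_real x)" and z: "z \<in> S"
  shows "f z = g z"
proof -
  define c where "c = complex_of_real ((a + b) / 2)"
  have "c islimpt complex_of_real ` {a<..<b}"
    unfolding islimpt_approachable
  proof (intro allI impI)
    fix e :: real assume "e > 0"
    \<comment> \<open>Small enough for midpoint + d to stay both in the segment and within distance
      e of the midpoint.\<close>
    define d where "d = min e (b - a) / 4"
    have d: "d > 0" "d < e" "d < (b - a) / 2" using \<open>e > 0\<close> ab by (auto simp: d_def)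
    have "dist (of_real ((a + b) / 2 + d)) c = d"
      using d unfolding c_def dist_of_real by (simp add: dist_norm)
    moreover have "(a + b) / 2 + d \<in> {a<..<b}" using d ab by (auto simp: field_simps)
    ultimately show "\<exists>x'\<in>complex_of_real ` {a<..<b}. x' \<noteq> c \<and> dist x' c < e"
      using d by (intro bexI[of _ "of_real ((a + b) / 2 + d)"] imageI) auto
  qed
  moreover have "c \<in> complex_of_real ` {a<..<b}"
    unfolding c_def using ab by (intro imageI) auto
  hence "c \<in> S" using sub by blast
  ultimately have "f z - g z = 0"
    by (intro analytic_continuation[of "\<lambda>z. f z - g z" S "complex_of_real ` {a<..<b}" c z])
       (use assms in \<open>auto intro!: holomorphic_intros\<close>)
  thus ?thesis by simp
qed

text \<open>Both sides are holomorphic on the right half plane and agree on the positive real axis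
  by the substitution of \<open>Laplace_real\<close>.\<close>

theorem Laplace_powr:
  assumes "Re s > 0" "Re p > 0"
  shows "(LINT t:{0<..}|lborel. of_real t powr (s - 1) * exp (- p * of_real t)) = Gamma s * p powr (-s)"
proof (rule holomorphic_eq_of_eq_on_real_segment[where S = "{p. Re p > 0}" and a = 0 and b = 1 and
    f = "\<lambda>p. LINT t:{0<..}|lborel. of_real t powr (s - 1) * exp (- p * of_real t)" and
    g = "\<lambda>p. Gamma s * p powr (-s)"])
  show "connected {p. Re p > 0}" by (intro convex_connected convex_halfspace_Re_gt)
  show "(\<lambda>p. LINT t:{0<..}|lborel. of_real t powr (s - 1) * exp (- p * of_real t)) holomorphic_on {p. Re p > 0}"
    by (rule holomorphic_on_Laplace[OF assms(1)])
  show "(LINT t:{0<..}|lborel. of_real t powr (s - 1) * exp (- of_real x * of_real t)) = Gamma s * of_real x powr (-s)"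
    if "0 < x" for x by (rule Laplace_real[OF assms(1) that])
qed (use assms in \<open>auto intro!: holomorphic_intros open_halfspace_Re_gt simp: complex_nonpos_Reals_iff\<close>)

section \<open>Mellin transforms\<close>

lemma set_borel_measurable_mult:
  fixes f g :: "'a \<Rightarrow> complex"
  assumes "set_borel_measurable M A f" "set_borel_measurable M A g"
  shows "set_borel_measurable M A (\<lambda>t. f t * g t)"
proof -
  have "(\<lambda>t. (indicator A t *\<^sub>R f t) * (indicator A t *\<^sub>R g t)) \<in> borel_measurable M"
    using assms unfolding set_borel_measurable_def by (rule borel_measurable_times)
  also have "(\<lambda>t. (indicator A t *\<^sub>R f t) * (indicator A t *\<^sub>R g t)) = (\<lambda>t. indicator A t *\<^sub>R (f t * g t))"
    by (auto simp: indicator_def)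
  finally show ?thesis by (simp add: set_borel_measurable_def)
qed

lemma set_borel_measurable_Mellin_kernel:
  assumes "set_borel_measurable lborel {0<..} g"
  shows "set_borel_measurable lborel {0<..} (\<lambda>t::real. complex_of_real t powr s * g t)"
  by (rule set_borel_measurable_mult[OF set_borel_measurable_lborel_continuous_on assms])
     (auto intro!: continuous_intros)

lemma norm_Mellin_kernel_le:
  assumes "t > 0" "norm (g t :: complex) \<le> C * t powr k * exp (- x * t)"
  shows "norm (complex_of_real t powr (s - 1) * g t) \<le> C * (t powr (Re s + k - 1) * exp (- x * t))"
proof -
  have "norm (complex_of_real t powr (s - 1) * g t) \<le> t powr (Re s - 1) * (C * t powr k * exp (- x * t))"
    using assms by (simp add: norm_mult norm_powr_real_powr mult_left_mono)
  also have "\<dots> = C * (t powr (Re s + k - 1) * exp (- x * t))"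
    using assms by (simp add: powr_add powr_diff field_simps)
  finally show ?thesis .
qed

lemma set_integrable_Mellin:
  assumes "set_borel_measurable lborel {0<..} g" "x > 0"
    and bd: "\<And>t. t > 0 \<Longrightarrow> norm (g t) \<le> C * t powr k * exp (- x * t)" and s: "Re s > - k"
  shows "set_integrable lborel {0<..} (\<lambda>t::real. complex_of_real t powr (s - 1) * g t)"
proof (rule set_integrable_bound)
  show "set_integrable lborel {0<..} (\<lambda>t. C * (t powr (Re s + k - 1) * exp (- x * t)))"
    using set_integrable_Gamma_real[of "Re s + k" x] assms by (intro set_integrable_mult_right) auto
  show "AE t in lborel. t \<in> {0<..} \<longrightarrow> norm (complex_of_real t powr (s - 1) * g t)
          \<le> norm (C * (t powr (Re s + k - 1) * exp (- x * t)))"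
    using norm_Mellin_kernel_le[where g = g, OF _ bd] by (auto intro!: AE_I2 order.trans[OF _ abs_ge_self])
qed (intro set_borel_measurable_Mellin_kernel assms)

text \<open>Each order of vanishing of g at 0 moves the line of convergence one unit to the left. It
  is applied with k = K to the remainder of the Todd expansion and with k = 1 to the cut-off
  kernel.\<close>

lemma holomorphic_on_Mellin:
  assumes g: "set_borel_measurable lborel {0<..} g" and x: "x > 0"
    and bd: "\<And>t. t > 0 \<Longrightarrow> norm (g t) \<le> C * t powr k * exp (- x * t)"
  shows "(\<lambda>s. LINT t:{0<..}|lborel. complex_of_real t powr (s - 1) * g t) holomorphic_on {s. Re s > - k}"
proof (rule holomorphic_on_set_lebesgue_integral)
  fix s0 :: complex assume s0: "s0 \<in> {s. Re s > - k}"
  have C: "C \<ge> 0"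
    using order.trans[OF norm_ge_zero bd[of 1]] by (simp add: zero_le_mult_iff)
  define e where "e = (Re s0 + k) / 2"
  \<comment> \<open>Over the disc, t to a variable exponent is largest at the left end of the
    exponent range for t <= 1 and at the right end for t >= 1; the sum of both covers all t.\<close>
  define B where "B = (\<lambda>t. C * (t powr (Re s0 - e + k - 1) * exp (- x * t)) + C * (t powr (Re s0 + e + k - 1) * exp (- x * t)))"
  have e: "e > 0" using s0 by (simp add: e_def)
  have Re: "Re s0 - e \<le> Re s" "Re s \<le> Re s0 + e" if "s \<in> cball s0 e" for s
    using abs_Re_le_cmod[of "s0 - s"] that by (auto simp: dist_norm)
  show "\<exists>e>0. \<exists>B. cball s0 e \<subseteq> {s. Re s > - k} \<and> set_integrable lborel {0<..} B \<and>
     (\<forall>s\<in>cball s0 e. \<forall>t\<in>{0<..}. norm (complex_of_real t powr (s - 1) * g t) \<le> B t)"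
  proof (intro exI[of _ e] exI[of _ B] conjI ballI e)
    show "cball s0 e \<subseteq> {s. Re s > - k}" using Re(1) s0 by (force simp: e_def field_simps)
    show "set_integrable lborel {0<..} B" unfolding B_def
      using set_integrable_Gamma_real[of "Re s0 - e + k" x] set_integrable_Gamma_real[of "Re s0 + e + k" x] x s0
      by (intro set_integral_add set_integrable_mult_right) (auto simp: e_def field_simps)
    fix s and t :: real assume s: "s \<in> cball s0 e" and t: "t \<in> {0<..}"
    have "norm (complex_of_real t powr (s - 1) * g t) \<le> C * (t powr (Re s + k - 1) * exp (- x * t))"
      by (rule norm_Mellin_kernel_le) (use t bd in auto)
    moreover have "t powr (Re s + k - 1) \<le> t powr (Re s0 - e + k - 1) + t powr (Re s0 + e + k - 1)"
    proof (cases "t \<le> 1")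
      case True
      hence "t powr (Re s + k - 1) \<le> t powr (Re s0 - e + k - 1)"
        using t Re[OF s] by (intro powr_mono') auto
      thus ?thesis by (simp add: add_increasing2)
    next
      case False
      hence "t powr (Re s + k - 1) \<le> t powr (Re s0 + e + k - 1)"
        using t Re[OF s] by (intro powr_mono) auto
      thus ?thesis by (simp add: add_increasing)
    qed
    hence "C * (t powr (Re s + k - 1) * exp (- x * t)) \<le> C * ((t powr (Re s0 - e + k - 1) + t powr (Re s0 + e + k - 1)) * exp (- x * t))"
      by (intro mult_left_mono mult_right_mono C) auto
    ultimately show "norm (complex_of_real t powr (s - 1) * g t) \<le> B t"
      by (simp add: B_def ring_distribs)
  qed
qed (auto intro!: open_halfspace_Re_gt set_borel_measurable_Mellin_kernel[OF g] holomorphic_intros)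

section \<open>The Hurwitz series as a Mellin transform\<close>

lemma inverse_one_minus_exp_le:
  assumes "t > (0::real)"
  shows "1 / (1 - exp (- t)) \<le> 1 + 1 / t"
proof -
  have "1 + t \<le> exp t" by (rule exp_ge_add_one_self)
  hence "exp (- t) \<le> 1 / (1 + t)" using assms by (simp add: exp_minus field_simps)
  hence "1 - exp (- t) \<ge> t / (1 + t)" using assms by (simp add: field_simps)
  hence "1 / (1 - exp (- t)) \<le> 1 / (t / (1 + t))" using assms by (intro divide_left_mono) (auto intro!: mult_pos_pos divide_pos_pos)
  thus ?thesis using assms by (simp add: field_simps)
qed

text \<open>The weight 1 / (1 - exp (- m * t)) behaves like 1 / (m * t) near 0. This costs one power
  of t and explains the hypothesis Re s > 1.\<close>

lemma set_integrable_exp_lattice: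
  assumes s: "Re s > 1" and p: "Re p > 0" and m: "m > (0::real)"
  shows "set_integrable lborel {0<..} (\<lambda>t. of_real t powr (s - 1) * (exp (- p * of_real t) * of_real (1 / (1 - exp (- m * t)))))"
proof (rule set_integrable_lborel_boundI)
  show "set_integrable lborel {0<..} (\<lambda>t. t powr (Re s - 1) * exp (- Re p * t) + 1 / m * (t powr (Re s - 1 - 1) * exp (- Re p * t)))"
    using set_integrable_Gamma_real[of "Re s" "Re p"] set_integrable_Gamma_real[of "Re s - 1" "Re p"] s p
    by (intro set_integral_add set_integrable_mult_right) auto
  fix t :: real assume "t \<in> {0<..}"
  hence t: "t > 0" by simp
  have w: "0 \<le> 1 / (1 - exp (- m * t))" "1 / (1 - exp (- m * t)) \<le> 1 + 1 / (m * t)"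
    using inverse_one_minus_exp_le[of "m * t"] m t by auto
  have "norm (of_real t powr (s - 1) * (exp (- p * of_real t) * of_real (1 / (1 - exp (- m * t))))) =
     t powr (Re s - 1) * exp (- Re p * t) * (1 / (1 - exp (- m * t)))"
    using w(1) t by (simp add: norm_mult norm_powr_real_powr norm_divide del: of_real_diff of_real_divide) 
  also have "\<dots> \<le> t powr (Re s - 1) * exp (- Re p * t) * (1 + 1 / (m * t))"
    by (intro mult_left_mono w) auto
  also have "\<dots> = t powr (Re s - 1) * exp (- Re p * t) + 1 / m * (t powr (Re s - 1 - 1) * exp (- Re p * t))"
    using t m by (simp add: powr_diff field_simps power2_eq_square)
  finally show "norm (of_real t powr (s - 1) * (exp (- p * of_real t) * of_real (1 / (1 - exp (- m * t))))) \<le>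
    t powr (Re s - 1) * exp (- Re p * t) + 1 / m * (t powr (Re s - 1 - 1) * exp (- Re p * t))" .
qed (use m in \<open>auto intro!: continuous_intros\<close>)

text \<open>The weight is the geometric series in exp (- m * t), integrated term by term. Its
  partial sums are the full integrand times 1 - exp (- m * t) ^ N, a factor between 0 and 1, so the
  integrand itself dominates them. The step m = 1 gives the Hurwitz series; larger m later gives
  single residue classes modulo m.\<close>

lemma exp_lattice_sum_sums_Mellin:
  assumes s: "Re s > 1" and p: "Re p > 0" and m: "m > (0::real)"
  shows "(\<lambda>n. Gamma s * (p + of_real m * of_nat n) powr (-s)) sums
     (LINT t:{0<..}|lborel. of_real t powr (s - 1) * (exp (- p * of_real t) * of_real (1 / (1 - exp (- m * t)))))"
proof -
  define w where "w = (\<lambda>t. 1 / (1 - exp (- m * t)))"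
  define h where "h = (\<lambda>t::real. of_real t powr (s - 1) * (exp (- p * of_real t) * of_real (w t)))"
  define S where "S = (\<lambda>N. \<lambda>t::real. of_real t powr (s - 1) * (exp (- p * of_real t) * of_real (w t * (1 - exp (- m * t) ^ N))))"
  have h: "set_integrable lborel {0<..} (\<lambda>t. norm (h t))"
    unfolding h_def w_def by (rule set_integrable_norm[OF set_integrable_exp_lattice[OF s p m]])
  have Sh: "norm (S N t) \<le> norm (h t)" if "t > 0" for N t
  proof -
    have "S N t = h t * of_real (1 - exp (- m * t) ^ N)" by (simp add: S_def h_def)
    hence "norm (S N t) = norm (h t) * \<bar>1 - exp (- m * t) ^ N\<bar>" by (simp only: norm_mult norm_of_real)
    moreover have "exp (- m * t) ^ N \<le> 1" using m that by (intro power_le_one) auto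
    hence "\<bar>1 - exp (- m * t) ^ N\<bar> \<le> 1" by simp
    ultimately show ?thesis by (simp add: mult_left_le)
  qed
  have cont: "continuous_on {0<..} h" "continuous_on {0<..} (S N)" for N
    unfolding h_def S_def w_def using m by (auto intro!: continuous_intros)
  have lim: "(\<lambda>N. LINT t:{0<..}|lborel. S N t) \<longlonglongrightarrow> (LINT t:{0<..}|lborel. h t)"
    unfolding set_lebesgue_integral_def
  proof (rule integral_dominated_convergence[where w = "\<lambda>t. indicator {0<..} t *\<^sub>R norm (h t)"])
    show "integrable lborel (\<lambda>t. indicator {0<..} t *\<^sub>R norm (h t))" using h by (simp add: set_integrable_def)
    show "AE t in lborel. (\<lambda>N. indicator {0<..} t *\<^sub>R S N t) \<longlonglongrightarrow> indicator {0<..} t *\<^sub>R h t"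
    proof (rule AE_I2)
      fix t :: real
      show "(\<lambda>N. indicator {0<..} t *\<^sub>R S N t) \<longlonglongrightarrow> indicator {0<..} t *\<^sub>R h t"
      proof (cases "t > 0")
        case True
        have "(\<lambda>N. exp (- m * t) ^ N) \<longlonglongrightarrow> 0"
          using True m by (intro LIMSEQ_realpow_zero) auto
        hence "(\<lambda>N. S N t) \<longlonglongrightarrow> of_real t powr (s - 1) * (exp (- p * of_real t) * of_real (w t * (1 - 0)))"
          unfolding S_def by (intro tendsto_mult tendsto_of_real tendsto_diff tendsto_const)
        thus ?thesis using True by (simp add: h_def)
      qed auto
    qed
    show "AE t in lborel. norm (indicator {0<..} t *\<^sub>R S N t) \<le> indicator {0<..} t *\<^sub>R norm (h t)" for N
      using Sh by (intro AE_I2) (auto simp: indicator_def)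
  qed (use set_borel_measurable_lborel_continuous_on[OF cont(1)] set_borel_measurable_lborel_continuous_on[OF cont(2)]
       in \<open>auto simp: set_borel_measurable_def\<close>)
  have "(LINT t:{0<..}|lborel. S N t) = (\<Sum>n<N. Gamma s * (p + of_real m * of_nat n) powr (-s))" for N
  proof -
    have q: "Re (p + of_real m * of_nat n) > 0" for n using p m by (simp add: add_pos_nonneg)
    have "(\<Sum>n<N. Gamma s * (p + of_real m * of_nat n) powr (-s)) =
      (\<Sum>n<N. LINT t:{0<..}|lborel. of_real t powr (s - 1) * exp (- (p + of_real m * of_nat n) * of_real t))"
      using s by (intro sum.cong refl Laplace_powr[symmetric] q) auto
    also have "\<dots> = (LINT t:{0<..}|lborel. (\<Sum>n<N. of_real t powr (s - 1) * exp (- (p + of_real m * of_nat n) * of_real t)))"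
      using s unfolding set_lebesgue_integral_def scaleR_sum_right
      by (intro Bochner_Integration.integral_sum[symmetric])
         (use set_integrable_Laplace[OF _ q, of s] in \<open>auto simp: set_integrable_def\<close>)
    also have "\<dots> = (LINT t:{0<..}|lborel. S N t)"
    proof (rule set_lebesgue_integral_cong)
      show "\<forall>t. t \<in> {0<..} \<longrightarrow> (\<Sum>n<N. of_real t powr (s - 1) * exp (- (p + of_real m * of_nat n) * of_real t)) = S N t"
      proof (intro allI impI)
        fix t :: real assume t: "t \<in> {0<..}"
        have "(\<Sum>n<N. of_real t powr (s - 1) * exp (- (p + of_real m * of_nat n) * of_real t)) =
          of_real t powr (s - 1) * (exp (- p * of_real t) * of_real (\<Sum>n<N. exp (- m * t) ^ n))"
          by (simp add: sum_distrib_left exp_add exp_minus exp_diff ring_distribs exp_of_nat_mult [symmetric] exp_of_real [symmetric] field_simps power_divide)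
        also have "(\<Sum>n<N. exp (- m * t) ^ n) = w t * (1 - exp (- m * t) ^ N)"
          using t m by (subst sum_gp_strict) (auto simp: w_def)
        finally show "(\<Sum>n<N. of_real t powr (s - 1) * exp (- (p + of_real m * of_nat n) * of_real t)) = S N t"
          by (simp add: S_def)
      qed
    qed auto
    finally show ?thesis ..
  qed
  thus ?thesis using lim by (simp add: sums_def h_def w_def)
qed

section \<open>The Todd function and its Taylor remainder\<close>

definition todd :: "complex \<Rightarrow> complex" where
  "todd z = (if z = 0 then 1 else z / (1 - exp (- z)))"

text \<open>These are the numbers B_n / n! with the Bernoulli numbers in the convention B_1 =
  +1/2.\<close>

definition todd_coeff :: "nat \<Rightarrow> complex" where
  "todd_coeff n = (deriv ^^ n) todd 0 / fact n"

text \<open>The zeros of 1 - exp(-z) are the integer multiples of 2 pi i. The radius 6 lies below 2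
  pi, which follows from pi > 3.\<close>

lemma holomorphic_on_todd: "todd holomorphic_on ball 0 6"
proof -
  \<comment> \<open>The difference quotient of - exp(-z) at 0, that is (1 - exp(-z)) / z with its
    singularity removed; \<open>todd\<close> is the reciprocal.\<close>
  define E where "E = (\<lambda>z::complex. if z = 0 then deriv (\<lambda>z. - exp (- z)) 0 else (- exp (- z) - - exp (- 0)) / (z - 0))"
  have d: "deriv (\<lambda>z::complex. - exp (- z)) 0 = 1"
    by (rule DERIV_imp_deriv) (auto intro!: derivative_eq_intros)
  have "E holomorphic_on UNIV" unfolding E_def
    by (rule pole_lemma_open) (auto intro!: holomorphic_intros)
  hence hol: "E holomorphic_on ball 0 6" by (rule holomorphic_on_subset) auto
  have nz: "E z \<noteq> 0" if "z \<in> ball 0 6" for z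
  proof
    assume "E z = 0"
    hence z: "z \<noteq> 0" "exp (- z) = 1" by (auto simp: E_def d split: if_splits)
    from z(2) obtain n :: int where n: "Re z = 0" "- Im z = of_int (2 * n) * pi"
      by (auto simp: exp_eq_1)
    have "n \<noteq> 0" using z n by (auto simp: complex_eq_iff)
    hence "2 * pi * 1 \<le> 2 * pi * \<bar>real_of_int n\<bar>" by (intro mult_left_mono) auto
    also have "\<dots> = \<bar>- Im z\<bar>" unfolding n(2) by (simp add: abs_mult)
    also have "\<dots> = \<bar>Im z\<bar>" by simp
    also have "\<dots> < 6" using abs_Im_le_cmod[of z] that by simp
    finally show False using pi_gt3 by simp
  qed
  have "(\<lambda>z. 1 / E z) holomorphic_on ball 0 6" by (intro holomorphic_intros hol nz)
  also have "(\<lambda>z. 1 / E z) = todd" by (auto simp: E_def d todd_def)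
  finally show ?thesis .
qed

lemma todd_coeff_0 [simp]: "todd_coeff 0 = 1"
  by (simp add: todd_coeff_def todd_def)

lemma todd_of_real: "t \<noteq> 0 \<Longrightarrow> todd (of_real t) = of_real (t / (1 - exp (- t)))"
  by (simp add: todd_def exp_of_real [symmetric])

text \<open>For t <= 1 the remainder is the tail of the power series. For t >= 1 the function grows
  at most like 2 * t and every monomial of the Taylor polynomial is below t ^ Suc K, so one power
  bound holds on the whole half line.\<close>

lemma todd_remainder_bound:
  "\<exists>C. \<forall>t>0. norm (todd (of_real t) - (\<Sum>j\<le>K. todd_coeff j * of_real t ^ j)) \<le> C * t ^ Suc K"
proof -
  have ps: "(\<lambda>n. todd_coeff n * z ^ n) sums todd z" if "norm z < 6" for z
    using holomorphic_power_series[OF holomorphic_on_todd, of z] that by (simp add: todd_coeff_def)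
  \<comment> \<open>Convergence at 2, which is inside the disc of radius 6, gives absolute
    convergence at 1.\<close>
  have "summable (\<lambda>n. norm (todd_coeff n * 1 ^ n))"
    by (rule powser_insidea[of _ 2]) (use ps[of 2] in \<open>auto simp: sums_iff\<close>)
  hence sm: "summable (\<lambda>n. norm (todd_coeff n))" by simp
  define C1 where "C1 = (\<Sum>n. norm (todd_coeff (n + Suc K)))"
  have sm': "summable (\<lambda>n. norm (todd_coeff (n + Suc K)))"
    using sm by (subst summable_iff_shift)
  define C2 where "C2 = 2 + (\<Sum>j\<le>K. norm (todd_coeff j))"
  have small: "norm (todd (of_real t) - (\<Sum>j\<le>K. todd_coeff j * of_real t ^ j)) \<le> C1 * t ^ Suc K"
    if "0 < t" "t \<le> 1" for t
  proof -
    have 1: "(\<lambda>n. todd_coeff (n + Suc K) * of_real t ^ (n + Suc K)) sums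
      (todd (of_real t) - (\<Sum>j<Suc K. todd_coeff j * of_real t ^ j))"
      by (rule sums_split_initial_segment) (use ps that in auto)
    have le: "norm (todd_coeff (n + Suc K) * of_real t ^ (n + Suc K)) \<le> norm (todd_coeff (n + Suc K)) * t ^ Suc K" for n
    proof -
      have "t ^ (n + Suc K) \<le> t ^ Suc K" using that by (intro power_decreasing) auto
      thus ?thesis using that by (simp add: norm_mult norm_power mult_left_mono)
    qed
    have "norm (\<Sum>n. todd_coeff (n + Suc K) * of_real t ^ (n + Suc K)) \<le> (\<Sum>n. norm (todd_coeff (n + Suc K)) * t ^ Suc K)"
      by (rule norm_suminf_le[OF le summable_mult2[OF sm']])
    also have "\<dots> = C1 * t ^ Suc K" unfolding C1_def using sm' by (rule suminf_mult2[symmetric])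
    finally show ?thesis using sums_unique[OF 1] by (simp add: lessThan_Suc_atMost)
  qed
  have large: "norm (todd (of_real t) - (\<Sum>j\<le>K. todd_coeff j * of_real t ^ j)) \<le> C2 * t ^ Suc K"
    if "t \<ge> 1" for t
  proof -
    have "norm (todd (of_real t)) = t * (1 / (1 - exp (- t)))" using that
      by (subst todd_of_real) (auto simp del: of_real_divide)
    also have "\<dots> \<le> t * (1 + 1 / t)" using that by (intro mult_left_mono inverse_one_minus_exp_le) auto
    also have "\<dots> \<le> 2 * t ^ 1" using that by (simp add: field_simps)
    also have "\<dots> \<le> 2 * t ^ Suc K" using that by (intro mult_left_mono power_increasing) auto
    finally have 1: "norm (todd (of_real t)) \<le> 2 * t ^ Suc K" .
    have "norm (\<Sum>j\<le>K. todd_coeff j * of_real t ^ j) \<le> (\<Sum>j\<le>K. norm (todd_coeff j) * t ^ Suc K)"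
    proof (rule order.trans[OF norm_sum], rule sum_mono)
      fix j assume "j \<in> {..K}"
      hence "t ^ j \<le> t ^ Suc K" using that by (intro power_increasing) auto
      thus "norm (todd_coeff j * of_real t ^ j) \<le> norm (todd_coeff j) * t ^ Suc K" using that
        by (simp add: norm_mult norm_power mult_left_mono)
    qed
    with 1 show ?thesis using norm_triangle_ineq4[of "todd (of_real t)" "\<Sum>j\<le>K. todd_coeff j * of_real t ^ j"]
      by (simp add: C2_def sum_distrib_right ring_distribs)
  qed
  have "norm (todd (of_real t) - (\<Sum>j\<le>K. todd_coeff j * of_real t ^ j)) \<le> max C1 C2 * t ^ Suc K" if "t > 0" for t
  proof (cases "t \<le> 1")
    case True
    have "C1 * t ^ Suc K \<le> max C1 C2 * t ^ Suc K" using that by (intro mult_right_mono) auto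
    with small[OF that True] show ?thesis by linarith
  next
    case False
    have "C2 * t ^ Suc K \<le> max C1 C2 * t ^ Suc K" using that by (intro mult_right_mono) auto
    with large[of t] False show ?thesis by linarith
  qed
  thus ?thesis by blast
qed

text \<open>The remainder bound with K = 1 identifies the coefficient with the limit of (todd t - 1)
  / t for real t tending to 0 from the right, which is an elementary limit.\<close>

lemma todd_coeff_1: "todd_coeff (Suc 0) = 1 / 2"
proof -
  obtain C where C: "\<And>t::real. t > 0 \<Longrightarrow> norm (todd (of_real t) - (\<Sum>j\<le>1. todd_coeff j * of_real t ^ j)) \<le> C * t ^ Suc 1"
    using todd_remainder_bound[of 1] by blast
  define f where "f = (\<lambda>t::real. (t / (1 - exp (- t)) - 1) / t)"
  have "((\<lambda>t. complex_of_real (f t) - todd_coeff 1) \<longlongrightarrow> 0) (at_right 0)"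
  proof (rule Lim_null_comparison)
    show "\<forall>\<^sub>F t in at_right 0. norm (complex_of_real (f t) - todd_coeff 1) \<le> C * t"
    proof (rule eventually_at_rightI[of _ 1])
      fix t :: real assume t: "t \<in> {0<..<1}"
      have "norm (complex_of_real (f t) - todd_coeff 1) = norm (todd (of_real t) - 1 - todd_coeff 1 * of_real t) / t"
      proof -
        have "complex_of_real (f t) - todd_coeff 1 = (todd (of_real t) - 1 - todd_coeff 1 * of_real t) / of_real t"
          using t by (simp add: f_def todd_of_real field_simps)
        thus ?thesis using t by (simp add: norm_divide)
      qed
      also have "\<dots> \<le> C * t" using C[of t] t by (simp add: field_simps power2_eq_square)
      finally show "norm (complex_of_real (f t) - todd_coeff 1) \<le> C * t" .
    qed auto
    show "((\<lambda>t. C * t) \<longlongrightarrow> 0) (at_right 0)" by (auto intro!: tendsto_eq_intros)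
  qed
  hence "((\<lambda>t. complex_of_real (f t)) \<longlongrightarrow> todd_coeff 1) (at_right 0)" by (simp add: LIM_zero_iff)
  moreover have "((\<lambda>t. complex_of_real (f t)) \<longlongrightarrow> of_real (1/2)) (at_right 0)"
    unfolding f_def by (intro tendsto_of_real) real_asymp
  ultimately show ?thesis using tendsto_unique[OF trivial_limit_at_right_real] by fastforce
qed

section \<open>Analytic continuation of the Hurwitz zeta function\<close>

text \<open>Since 1 / (1 - exp(-t)) equals todd t / t, this is what remains of that kernel after its
  pole and the next K Taylor terms; it is of order t ^ K at 0.\<close>

definition todd_rest :: "nat \<Rightarrow> real \<Rightarrow> complex" where
  "todd_rest K t = (todd (of_real t) - (\<Sum>j\<le>K. todd_coeff j * of_real t ^ j)) / of_real t"

definition todd_Laplace :: "nat \<Rightarrow> complex \<Rightarrow> complex \<Rightarrow> complex" where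
  "todd_Laplace K v s =
     (LINT t:{0<..}|lborel. of_real t powr (s - 1) * (exp (- v * of_real t) * todd_rest K t))"

lemma continuous_on_todd_rest: "continuous_on {0<..} (todd_rest K)"
proof -
  have "continuous_on {0<..} (\<lambda>t. (of_real (t / (1 - exp (- t))) - (\<Sum>j\<le>K. todd_coeff j * of_real t ^ j)) / of_real t)"
    by (auto intro!: continuous_intros)
  thus ?thesis
    by (rule continuous_on_eq) (auto simp: todd_rest_def todd_of_real simp del: of_real_divide of_real_diff)
qed

lemma todd_rest_bound: "\<exists>C. \<forall>t>0. norm (todd_rest K t) \<le> C * t powr real K"
proof -
  obtain C where C: "\<And>t::real. t > 0 \<Longrightarrow> norm (todd (of_real t) - (\<Sum>j\<le>K. todd_coeff j * of_real t ^ j)) \<le> C * t ^ Suc K"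
    using todd_remainder_bound by blast
  have "norm (todd_rest K t) \<le> C * t powr real K" if "t > 0" for t
    using C[OF that] that by (simp add: todd_rest_def norm_divide powr_realpow field_simps)
  thus ?thesis by blast
qed

lemma exp_todd_rest_measurable: "set_borel_measurable lborel {0<..} (\<lambda>t. exp (- v * of_real t) * todd_rest K t)"
  by (intro set_borel_measurable_lborel_continuous_on continuous_intros continuous_on_todd_rest) auto

lemma exp_todd_rest_bound:
  obtains C where "C \<ge> 0"
    "\<And>v t. t > 0 \<Longrightarrow> norm (exp (- v * of_real t) * todd_rest K t) \<le> C * t powr real K * exp (- Re v * t)"
proof -
  obtain C where C: "\<And>t. t > 0 \<Longrightarrow> norm (todd_rest K t) \<le> C * t powr real K"
    using todd_rest_bound by blast
  show ?thesis
  proof (rule that)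
    show "C \<ge> 0" using order.trans[OF norm_ge_zero C[of 1]] by simp
    show "norm (exp (- v * of_real t) * todd_rest K t) \<le> C * t powr real K * exp (- Re v * t)" if "t > 0" for v t
      using mult_left_mono[OF C[OF that], of "exp (- Re v * t)"] by (simp add: norm_mult mult_ac)
  qed
qed

lemma holomorphic_on_todd_Laplace:
  assumes "Re v > 0"
  shows "todd_Laplace K v holomorphic_on {s. Re s > - real K}"
proof -
  obtain C where C: "C \<ge> 0" and
    "\<And>v t. t > 0 \<Longrightarrow> norm (exp (- v * of_real t) * todd_rest K t) \<le> C * t powr real K * exp (- Re v * t)"
    using exp_todd_rest_bound by blast
  hence "(\<lambda>s. LINT t:{0<..}|lborel. of_real t powr (s - 1) * (exp (- v * of_real t) * todd_rest K t))
    holomorphic_on {s. Re s > - real K}" using exp_todd_rest_measurable assms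
    by (intro holomorphic_on_Mellin[where x = "Re v"]) auto
  also have "(\<lambda>s. LINT t:{0<..}|lborel. of_real t powr (s - 1) * (exp (- v * of_real t) * todd_rest K t)) = todd_Laplace K v"
    by (simp add: todd_Laplace_def fun_eq_iff)
  finally show ?thesis .
qed

lemma nonpos_Ints_Re_nonpos:
  assumes "z \<in> \<int>\<^sub>\<le>\<^sub>0"
  shows "Re z \<le> 0"
proof -
  obtain n where "z = of_int n" "n \<le> 0" using assms by (rule nonpos_Ints_cases)
  thus ?thesis by simp
qed

text \<open>Turns the Gamma quotients that arise from termwise Laplace transforms into rational
  functions of s. These make sense beyond Re s > 1; the case j = 0 carries the pole at 1.\<close>

lemma rGamma_mult_Gamma_plus_of_nat:
  assumes "Re s > 1"
  shows "rGamma s * Gamma (s + of_nat j - 1) = (if j = 0 then 1 / (s - 1) else pochhammer s (j - 1))"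
proof -
  have s: "s \<notin> \<int>\<^sub>\<le>\<^sub>0" "s - 1 \<notin> \<int>\<^sub>\<le>\<^sub>0"
    using assms nonpos_Ints_Re_nonpos[of s] nonpos_Ints_Re_nonpos[of "s - 1"] by auto
  show ?thesis
  proof (cases j)
    case 0
    have "s \<noteq> 1" using assms by auto
    have "Gamma (s - 1 + 1) = (s - 1) * Gamma (s - 1)" using s by (intro Gamma_plus1) auto
    hence "Gamma s = (s - 1) * Gamma (s - 1)" by simp
    moreover have "Gamma (s - 1) \<noteq> 0" "Gamma s \<noteq> 0" using s by (simp_all add: Gamma_eq_zero_iff)
    ultimately show ?thesis using 0 \<open>s \<noteq> 1\<close> by (simp add: rGamma_inverse_Gamma field_simps)
  next
    case (Suc i)
    have "pochhammer s i = Gamma (s + of_nat i) / Gamma s" using s by (intro pochhammer_Gamma) auto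
    thus ?thesis using Suc by (simp add: rGamma_inverse_Gamma field_simps)
  qed
qed

text \<open>The Todd expansion integrated term by term: t to the power j - 1 contributes Gamma (s +
  j - 1) times v powr (1 - s - j). Apart from the pole at 1, the right-hand side is meaningful for
  Re s > - K, so this formula is the continuation.\<close>

lemma hurwitz_sums_todd:
  assumes s: "Re s > 1" and v: "Re v > 0"
  shows "(\<lambda>n. (of_nat n + v) powr (-s)) sums
     (v powr (1 - s) / (s - 1) + (\<Sum>j=1..K. todd_coeff j * pochhammer s (j - 1) * v powr (1 - s - of_nat j))
       + rGamma s * todd_Laplace K v s)"
proof -
  have sG: "Gamma s \<noteq> 0" using s by (auto simp: Gamma_eq_zero_iff dest!: nonpos_Ints_Re_nonpos)
  obtain C where C: "C \<ge> 0" and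
    Cb: "\<And>v t. t > 0 \<Longrightarrow> norm (exp (- v * of_real t) * todd_rest K t) \<le> C * t powr real K * exp (- Re v * t)"
    using exp_todd_rest_bound by blast
  have i1: "set_integrable lborel {0<..} (\<lambda>t::real. of_real t powr (s - 1) * (exp (- v * of_real t) * todd_rest K t))"
    using Cb v s by (intro set_integrable_Mellin[OF exp_todd_rest_measurable]) auto
  have i2: "set_integrable lborel {0<..} (\<lambda>t::real. of_real t powr (s + of_nat j - 1 - 1) * exp (- v * of_real t))" for j
    using s v by (intro set_integrable_Laplace) auto
  have i3: "set_integrable lborel {0<..} (\<lambda>t. \<Sum>j\<le>K. todd_coeff j * (of_real t powr (s + of_nat j - 1 - 1) * exp (- v * of_real t)))"
    unfolding set_integrable_def scaleR_sum_right
    by (intro Bochner_Integration.integrable_sum set_integrable_mult_right[OF i2, unfolded set_integrable_def])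
  have "(LINT t:{0<..}|lborel. of_real t powr (s - 1) * (exp (- v * of_real t) * of_real (1 / (1 - exp (- 1 * t))))) =
     (LINT t:{0<..}|lborel. (\<Sum>j\<le>K. todd_coeff j * (of_real t powr (s + of_nat j - 1 - 1) * exp (- v * of_real t)))
        + of_real t powr (s - 1) * (exp (- v * of_real t) * todd_rest K t))"
  proof (rule set_lebesgue_integral_cong, simp, intro allI impI)
    fix t :: real assume t: "t \<in> {0<..}"
    have "todd (of_real t) / of_real t = of_real (1 / (1 - exp (- 1 * t)))"
      using t by (simp add: todd_of_real)
    hence e: "complex_of_real (1 / (1 - exp (- 1 * t))) = (\<Sum>j\<le>K. todd_coeff j * of_real t ^ j) / of_real t + todd_rest K t"
      by (simp add: todd_rest_def diff_divide_distrib)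
    have p: "of_real t powr (s + of_nat j - 1 - 1) = of_real t powr (s - 1) * (of_real t ^ j / of_real t)" for j
    proof -
      have "of_real t powr (s + of_nat j - 1 - 1) = of_real t powr (s - 1 + of_nat j - 1)" by (simp add: algebra_simps)
      also have "\<dots> = of_real t powr (s - 1) * (of_real t ^ j / of_real t)"
        using t by (simp add: powr_add powr_diff powr_nat' power2_eq_square)
      finally show ?thesis .
    qed
    show "of_real t powr (s - 1) * (exp (- v * of_real t) * of_real (1 / (1 - exp (- 1 * t)))) =
       (\<Sum>j\<le>K. todd_coeff j * (of_real t powr (s + of_nat j - 1 - 1) * exp (- v * of_real t)))
        + of_real t powr (s - 1) * (exp (- v * of_real t) * todd_rest K t)"
      unfolding e p by (simp add: sum_distrib_left sum_distrib_right sum_divide_distrib ring_distribs mult_ac)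
  qed
  also have "\<dots> = (LINT t:{0<..}|lborel. (\<Sum>j\<le>K. todd_coeff j * (of_real t powr (s + of_nat j - 1 - 1) * exp (- v * of_real t))))
      + todd_Laplace K v s"
    unfolding todd_Laplace_def
    by (rule set_integral_add(2)[OF i3 i1])
  also have "(LINT t:{0<..}|lborel. (\<Sum>j\<le>K. todd_coeff j * (of_real t powr (s + of_nat j - 1 - 1) * exp (- v * of_real t)))) =
     (\<Sum>j\<le>K. LINT t:{0<..}|lborel. todd_coeff j * (of_real t powr (s + of_nat j - 1 - 1) * exp (- v * of_real t)))"
    unfolding set_lebesgue_integral_def scaleR_sum_right
    by (intro Bochner_Integration.integral_sum set_integrable_mult_right[OF i2, unfolded set_integrable_def])
  also have "\<dots> = (\<Sum>j\<le>K. todd_coeff j * (Gamma (s + of_nat j - 1) * v powr (- (s + of_nat j - 1))))"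
    using s v by (subst set_integral_mult_right, subst Laplace_powr) auto
  finally have eq: "rGamma s * (LINT t:{0<..}|lborel. of_real t powr (s - 1) * (exp (- v * of_real t) * of_real (1 / (1 - exp (- 1 * t))))) =
     (\<Sum>j\<le>K. todd_coeff j * (rGamma s * Gamma (s + of_nat j - 1)) * v powr (- (s + of_nat j - 1))) + rGamma s * todd_Laplace K v s"
    by (simp add: ring_distribs sum_distrib_left mult_ac)
  have "(\<lambda>n. rGamma s * (Gamma s * (v + of_real 1 * of_nat n) powr (-s))) sums
     (rGamma s * (LINT t:{0<..}|lborel. of_real t powr (s - 1) * (exp (- v * of_real t) * of_real (1 / (1 - exp (- 1 * t))))))"
    by (intro sums_mult exp_lattice_sum_sums_Mellin) (use s v in auto)
  also have "(\<lambda>n. rGamma s * (Gamma s * (v + of_real 1 * of_nat n) powr (-s))) = (\<lambda>n. (of_nat n + v) powr (-s))"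
    using sG by (simp add: rGamma_inverse_Gamma field_simps)
  also note eq
  also have "(\<Sum>j\<le>K. todd_coeff j * (rGamma s * Gamma (s + of_nat j - 1)) * v powr (- (s + of_nat j - 1))) =
     v powr (1 - s) / (s - 1) + (\<Sum>j=1..K. todd_coeff j * pochhammer s (j - 1) * v powr (1 - s - of_nat j))"
    unfolding rGamma_mult_Gamma_plus_of_nat[OF s] atMost_atLeast0
    by (subst sum.atLeast_Suc_atMost) (auto intro!: sum.cong simp: algebra_simps)
  finally show ?thesis .
qed

lemma DERIV_powr_const_base:
  fixes v :: complex
  assumes "v \<noteq> 0" "(f has_field_derivative D) (at s)"
  shows "((\<lambda>s. v powr f s) has_field_derivative Ln v * v powr f s * D) (at s)"
  by (rule DERIV_chain2[OF has_field_derivative_powr_right[OF assms(1)] assms(2)])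

text \<open>The term v powr (1 - s) / (s - 1) without its polar part 1 / (s - 1). The value - Ln v
  at 1 is the derivative that fills the removable singularity.\<close>

definition powr_quotient :: "complex \<Rightarrow> complex \<Rightarrow> complex" where
  "powr_quotient v s = (if s = 1 then - Ln v else (v powr (1 - s) - 1) / (s - 1))"

lemma holomorphic_on_powr_quotient:
  assumes "v \<noteq> 0"
  shows "powr_quotient v holomorphic_on UNIV"
proof -
  have d: "deriv (\<lambda>s. v powr (1 - s)) 1 = - Ln v"
  proof -
    have "((\<lambda>s::complex. 1 - s) has_field_derivative - 1) (at 1)" by (auto intro!: derivative_eq_intros)
    from DERIV_powr_const_base[OF assms this] assms show ?thesis by (intro DERIV_imp_deriv) simp
  qed
  have "(\<lambda>s. if s = 1 then deriv (\<lambda>s. v powr (1 - s)) 1 else (v powr (1 - s) - v powr (1 - 1)) / (s - 1)) holomorphic_on UNIV"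
    by (rule pole_lemma_open) (auto intro!: holomorphic_intros)
  moreover have "v powr (1 - 1) = 1" using assms by simp
  ultimately show ?thesis unfolding d powr_quotient_def[abs_def] by (simp only:)
qed

text \<open>The formula of order K only reaches Re s > - K. The formulas of two orders agree on Re s
  > 1, hence on the smaller of their half planes, and can be glued.\<close>

lemma exists_entire_of_half_planes:
  assumes "\<And>K::nat. \<exists>R. R holomorphic_on {s. Re s > - real K} \<and> (\<forall>s. Re s > 1 \<longrightarrow> R s = \<phi> s)"
  shows "\<exists>R. R holomorphic_on UNIV \<and> (\<forall>s. Re s > 1 \<longrightarrow> R s = \<phi> s)"
proof -
  obtain R where hol: "\<And>K::nat. R K holomorphic_on {s. Re s > - real K}"
    and eq: "\<And>K s. Re s > 1 \<Longrightarrow> R K s = \<phi> s" using assms by metis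
  have coh: "R K s = R L s" if "K \<le> L" "Re s > - real K" for K L s
  proof (rule analytic_continuation_open[of "{s. Re s > 1}" "{s. Re s > - real K}" "R K" "R L"])
    show "{s. Re s > 1} \<noteq> {}" by (auto intro!: exI[of _ 2])
    show "connected {s. - real K < Re s}" by (intro convex_connected convex_halfspace_Re_gt)
    show "R L holomorphic_on {s. - real K < Re s}" by (rule holomorphic_on_subset[OF hol]) (use that in auto)
  qed (use that eq hol in \<open>auto simp: open_halfspace_Re_gt\<close>)
  \<comment> \<open>This order exceeds |Re s|, so that s lies in the half plane where the chosen
    function is holomorphic.\<close>
  define F where "F s = R (nat \<lceil>\<bar>Re s\<bar>\<rceil> + 1) s" for s
  have F: "F s = R K s" if "Re s > - real K" for s K
  proof (cases "K \<le> nat \<lceil>\<bar>Re s\<bar>\<rceil> + 1")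
    case True thus ?thesis using coh[OF True that] by (simp add: F_def)
  next
    case False
    hence "nat \<lceil>\<bar>Re s\<bar>\<rceil> + 1 \<le> K" by simp
    from coh[OF this, of s] show ?thesis unfolding F_def by linarith
  qed
  have "F holomorphic_on UNIV"
    unfolding holomorphic_on_def
  proof
    fix s :: complex
    define K where "K = nat \<lceil>\<bar>Re s\<bar>\<rceil> + 1"
    have "Re s > - real K" unfolding K_def by linarith
    hence "(R K has_field_derivative deriv (R K) s) (at s)"
      using hol[of K] open_halfspace_Re_gt[of "- real K"] by (intro holomorphic_derivI) auto
    moreover have "eventually (\<lambda>z. F z = R K z) (nhds s)"
      using eventually_nhds_in_open[OF open_halfspace_Re_gt[of "- real K"], of s] \<open>Re s > - real K\<close>
      by (auto elim!: eventually_mono intro: F)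
    ultimately have "(F has_field_derivative deriv (R K) s) (at s)"
      using DERIV_cong_ev[OF refl _ refl] by blast
    thus "F field_differentiable at s within UNIV"
      unfolding field_differentiable_def by blast
  qed
  moreover have "F s = \<phi> s" if "Re s > 1" for s using F[of 0 s] eq[of s 0] that by simp
  ultimately show ?thesis by blast
qed

definition hurwitz_reg_todd :: "nat \<Rightarrow> complex \<Rightarrow> complex \<Rightarrow> complex" where
  "hurwitz_reg_todd K v s = powr_quotient v s +
     (\<Sum>j=1..K. todd_coeff j * pochhammer s (j - 1) * v powr (1 - s - of_nat j)) + rGamma s * todd_Laplace K v s"

lemma holomorphic_on_pochhammer [holomorphic_intros]:
  assumes "f holomorphic_on A"
  shows "(\<lambda>s. pochhammer (f s) n) holomorphic_on A"
  using assms by (simp add: pochhammer_prod) (intro holomorphic_intros)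

lemma holomorphic_on_hurwitz_reg_todd:
  assumes "Re v > 0"
  shows "hurwitz_reg_todd K v holomorphic_on {s. Re s > - real K}"
proof -
  have "v \<noteq> 0" using assms by auto
  thus ?thesis unfolding hurwitz_reg_todd_def[abs_def]
    by (intro holomorphic_intros holomorphic_on_todd_Laplace assms
        holomorphic_on_subset[OF holomorphic_on_powr_quotient]) auto
qed

lemma hurwitz_sums_reg_todd:
  assumes "Re s > 1" "Re v > 0"
  shows "(\<lambda>n. (of_nat n + v) powr (-s)) sums (1 / (s - 1) + hurwitz_reg_todd K v s)"
proof -
  have "s \<noteq> 1" using assms by auto
  have "(v powr (1 - s) - 1) / (s - 1) = v powr (1 - s) / (s - 1) - 1 / (s - 1)"
    by (simp add: diff_divide_distrib)
  hence "1 / (s - 1) + hurwitz_reg_todd K v s = v powr (1 - s) / (s - 1) +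
    (\<Sum>j=1..K. todd_coeff j * pochhammer s (j - 1) * v powr (1 - s - of_nat j)) + rGamma s * todd_Laplace K v s"
    using \<open>s \<noteq> 1\<close> by (simp add: hurwitz_reg_todd_def powr_quotient_def)
  thus ?thesis using hurwitz_sums_todd[OF assms, of K] by simp
qed

text \<open>The Mellin transform needs \<open>Re v > 0\<close>; other \<open>v\<close> are reached by splitting off finitely many terms.\<close>

lemma exists_hurwitz_reg:
  assumes v: "v \<notin> \<int>\<^sub>\<le>\<^sub>0"
  shows "\<exists>R. R holomorphic_on UNIV \<and>
    (\<forall>z. Re z > 1 \<longrightarrow> (\<lambda>n. (of_nat n + v) powr (-z)) sums (1 / (z - 1) + R z))"
proof -
  define N where "N = nat \<lceil>\<bar>Re v\<bar>\<rceil> + 1"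
  have N: "Re (v + of_nat N) > 0" unfolding N_def by simp linarith
  have 1: "\<exists>R. R holomorphic_on UNIV \<and> (\<forall>s. Re s > 1 \<longrightarrow> R s = hurwitz_reg_todd 0 (v + of_nat N) s)"
  proof (rule exists_entire_of_half_planes)
    fix K :: nat
    have "hurwitz_reg_todd K (v + of_nat N) s = hurwitz_reg_todd 0 (v + of_nat N) s" if "Re s > 1" for s
      using sums_unique2[OF hurwitz_sums_reg_todd[OF that N, of K] hurwitz_sums_reg_todd[OF that N, of 0]] by simp
    thus "\<exists>R. R holomorphic_on {s. Re s > - real K} \<and> (\<forall>s. Re s > 1 \<longrightarrow> R s = hurwitz_reg_todd 0 (v + of_nat N) s)"
      using holomorphic_on_hurwitz_reg_todd[OF N, of K] by blast
  qed
  then obtain R where R: "R holomorphic_on UNIV"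
    "\<And>s. Re s > 1 \<Longrightarrow> R s = hurwitz_reg_todd 0 (v + of_nat N) s" by blast
  define R' where "R' = (\<lambda>s. R s + (\<Sum>n<N. (of_nat n + v) powr (-s)))"
  have "R' holomorphic_on UNIV" unfolding R'_def by (intro holomorphic_intros R(1))
  moreover have "(\<lambda>n. (of_nat n + v) powr (-z)) sums (1 / (z - 1) + R' z)" if "Re z > 1" for z
  proof -
    have "(\<lambda>n. (of_nat n + (v + of_nat N)) powr (-z)) sums (1 / (z - 1) + R z)"
      using hurwitz_sums_reg_todd[OF that N, of 0] R(2)[OF that] by simp
    hence "(\<lambda>n. (of_nat (n + N) + v) powr (-z)) sums (1 / (z - 1) + R z)" by (simp add: add_ac)
    thus ?thesis by (subst (asm) sums_iff_shift) (simp add: R'_def algebra_simps)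
  qed
  ultimately show ?thesis by blast
qed

section \<open>Identification of the continuation and its Laurent coefficients at 1\<close>

lemma connected_Compl_singleton: "connected (- {a :: complex})"
  using connected_punctured_universe[of a] by (simp add: Compl_eq_Diff_UNIV)

text \<open>Two candidates agree for Re s > 1 because a series has only one sum, then on the
  connected punctured plane, and at 1 by the common value 0.\<close>

lemma hurwitz_zeta_eqI:
  assumes hol: "f holomorphic_on -{1}" and f1: "f 1 = 0"
    and sums: "\<And>z. Re z > 1 \<Longrightarrow> (\<lambda>n. (of_nat n + v) powr (-z)) sums f z"
  shows "hurwitz_zeta s v = f s"
proof -
  have "(THE f. f holomorphic_on -{1} \<and> f 1 = 0 \<and>
             (\<forall>z. Re z > 1 \<longrightarrow> (\<lambda>n. (of_nat n + v) powr (-z)) sums f z)) = f"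
  proof (rule the_equality)
    show "f holomorphic_on -{1} \<and> f 1 = 0 \<and>
             (\<forall>z. Re z > 1 \<longrightarrow> (\<lambda>n. (of_nat n + v) powr (-z)) sums f z)" using assms by blast
    fix g assume g: "g holomorphic_on -{1} \<and> g 1 = 0 \<and>
             (\<forall>z. Re z > 1 \<longrightarrow> (\<lambda>n. (of_nat n + v) powr (-z)) sums g z)"
    show "g = f"
    proof
      fix z show "g z = f z"
      proof (cases "z = 1")
        case False
        show ?thesis
        proof (rule analytic_continuation_open[of "{s. Re s > 1}" "-{1}" g f])
          show "{s. Re s > 1} \<noteq> {}" by (auto intro!: exI[of _ 2])
          show "g w = f w" if "w \<in> {s. 1 < Re s}" for w using g sums sums_unique2 that by blast
        qed (use False g hol in \<open>auto simp: open_halfspace_Re_gt connected_Compl_singleton\<close>)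
      qed (use g f1 in auto)
    qed
  qed
  thus ?thesis by (simp add: hurwitz_zeta_def)
qed

text \<open>The entire part of zeta(s,v), with the pole 1 / (s - 1) removed. Its Taylor coefficients
  at 1 are the numbers (-1)^n gamma_n(v) / n!, and it is free of the conventional value that
  \<open>hurwitz_zeta\<close> has at the pole.\<close>

definition hurwitz_reg :: "complex \<Rightarrow> complex \<Rightarrow> complex" where
  "hurwitz_reg v = (SOME R. R holomorphic_on UNIV \<and>
    (\<forall>z. Re z > 1 \<longrightarrow> (\<lambda>n. (of_nat n + v) powr (-z)) sums (1 / (z - 1) + R z)))"

context
  fixes v :: complex
  assumes v: "v \<notin> \<int>\<^sub>\<le>\<^sub>0"
begin

lemma holomorphic_on_hurwitz_reg: "hurwitz_reg v holomorphic_on A"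
  and hurwitz_reg_sums: "Re z > 1 \<Longrightarrow> (\<lambda>n. (of_nat n + v) powr (-z)) sums (1 / (z - 1) + hurwitz_reg v z)"
  using someI_ex[OF exists_hurwitz_reg[OF v]] unfolding hurwitz_reg_def[symmetric]
  by (auto intro: holomorphic_on_subset)

lemma hurwitz_zeta_conv_reg: "hurwitz_zeta s v = (if s = 1 then 0 else 1 / (s - 1) + hurwitz_reg v s)"
proof (rule hurwitz_zeta_eqI)
  have "(\<lambda>s. 1 / (s - 1) + hurwitz_reg v s) holomorphic_on -{1}"
    by (intro holomorphic_intros holomorphic_on_hurwitz_reg) auto
  thus "(\<lambda>s. if s = 1 then 0 else 1 / (s - 1) + hurwitz_reg v s) holomorphic_on -{1}"
    by (rule holomorphic_transform) auto
qed (use hurwitz_reg_sums in auto)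

lemma hurwitz_zeta_sums:
  assumes "Re s > 1"
  shows "(\<lambda>n. (of_nat n + v) powr (-s)) sums hurwitz_zeta s v"
  using hurwitz_reg_sums[OF assms] assms by (auto simp: hurwitz_zeta_conv_reg)

lemma holomorphic_on_hurwitz_zeta: "1 \<notin> A \<Longrightarrow> (\<lambda>s. hurwitz_zeta s v) holomorphic_on A"
  by (rule holomorphic_transform[of "\<lambda>s. 1 / (s - 1) + hurwitz_reg v s"])
     (auto intro!: holomorphic_intros holomorphic_on_hurwitz_reg simp: hurwitz_zeta_conv_reg)

text \<open>The half plane is a parameter because the Todd formula of fixed order represents the
  entire part only on a half plane.\<close>

lemma hurwitz_reg_eqI:
  assumes "R holomorphic_on {s. Re s > a}" "a \<le> 1"
    and "\<And>z. Re z > 1 \<Longrightarrow> (\<lambda>n. (of_nat n + v) powr (-z)) sums (1 / (z - 1) + R z)" "Re s > a"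
  shows "hurwitz_reg v s = R s"
proof (rule analytic_continuation_open[of "{s. Re s > 1}" "{s. Re s > a}" "hurwitz_reg v" R])
  show "{s. Re s > 1} \<noteq> {}" by (auto intro!: exI[of _ 2])
  show "connected {s. a < Re s}" by (intro convex_connected convex_halfspace_Re_gt)
  show "hurwitz_reg v w = R w" if "w \<in> {s. 1 < Re s}" for w
    using sums_unique2[OF hurwitz_reg_sums assms(3)] that by auto
qed (use assms holomorphic_on_hurwitz_reg in \<open>auto simp: open_halfspace_Re_gt\<close>)

text \<open>The pole only affects the coefficient of index -1, so all coefficients of index n >= 0
  are Taylor coefficients of the entire part; the factorial cancels.\<close>

lemma gen_stieltjes_eq_deriv: "gen_stieltjes n v = (-1) ^ n * (deriv ^^ n) (hurwitz_reg v) 1"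
proof -
  have "(\<lambda>x. hurwitz_reg v (1 + x)) has_fps_expansion fps_expansion (hurwitz_reg v) 1"
    by (rule analytic_at_imp_has_fps_expansion)
       (use holomorphic_on_hurwitz_reg[of UNIV] in \<open>auto simp: analytic_on_open analytic_on_def intro!: exI[of _ 1] intro: holomorphic_on_subset\<close>)
  hence "(\<lambda>x. inverse x + hurwitz_reg v (1 + x)) has_laurent_expansion
     inverse fls_X + fps_to_fls (fps_expansion (hurwitz_reg v) 1)"
    by (intro laurent_expansion_intros has_laurent_expansion_fps)
  hence "(\<lambda>x. hurwitz_zeta (1 + x) v) has_laurent_expansion
     inverse fls_X + fps_to_fls (fps_expansion (hurwitz_reg v) 1)"
    \<comment> \<open>A Laurent expansion only sees a punctured neighbourhood, so the value 0 of
      \<open>hurwitz_zeta\<close> at the pole does no harm.\<close>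
    by (rule has_laurent_expansion_cong[THEN iffD1, rotated 2])
       (auto simp: eventually_at_filter hurwitz_zeta_conv_reg field_simps intro!: always_eventually)
  from laurent_expansion_eqI[OF this] show ?thesis
    by (simp add: gen_stieltjes_def fps_expansion_def fls_inverse_X)
qed

end

lemma stieltjes_eq_gen_stieltjes: "stieltjes n = gen_stieltjes n 1"
  unfolding stieltjes_def gen_stieltjes_def riemann_zeta_def[abs_def] ..

text \<open>The series for v + 1 is the series for v without its first term, and the polar parts of
  both are equal.\<close>

lemma hurwitz_reg_plus_1:
  assumes v: "v \<notin> \<int>\<^sub>\<le>\<^sub>0"
  shows "hurwitz_reg (v + 1) s = hurwitz_reg v s - v powr (-s)"
proof -
  have v1: "v + 1 \<notin> \<int>\<^sub>\<le>\<^sub>0" using v plus_one_in_nonpos_Ints_imp by blast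
  have "hurwitz_reg (v + 1) s = (\<lambda>s. hurwitz_reg v s - v powr (-s)) s"
  \<comment> \<open>This bound puts the given s into the half plane and keeps it at most 1, so that
    Re z > 1 is contained in the half plane as well.\<close>
  proof (rule hurwitz_reg_eqI[OF v1, where a = "min 1 (Re s) - 1"])
    fix z :: complex assume z: "Re z > 1"
    have "(\<lambda>n. (of_nat (Suc n) + v) powr (-z)) sums (1 / (z - 1) + hurwitz_reg v z - (of_nat 0 + v) powr (-z))"
      using hurwitz_reg_sums[OF v z] by (subst sums_Suc_iff) auto
    thus "(\<lambda>n. (of_nat n + (v + 1)) powr (-z)) sums (1 / (z - 1) + (hurwitz_reg v z - v powr (-z)))"
      by (simp add: algebra_simps)
  qed (auto intro!: holomorphic_intros holomorphic_on_hurwitz_reg v)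
  thus ?thesis by simp
qed

text \<open>Differentiation of the shift relation at s = 1: the derivative of v powr (- s) there is
  - ln v / v, and gamma_1 is minus the derivative of the entire part.\<close>

theorem gen_stieltjes_1_plus_1:
  assumes v: "v \<notin> \<int>\<^sub>\<le>\<^sub>0"
  shows "gen_stieltjes 1 (v + 1) = gen_stieltjes 1 v - ln v / v"
proof -
  have v0: "v \<noteq> 0" and v1: "v + 1 \<notin> \<int>\<^sub>\<le>\<^sub>0" using v plus_one_in_nonpos_Ints_imp by auto
  have "(hurwitz_reg v has_field_derivative deriv (hurwitz_reg v) 1) (at 1)"
    by (rule holomorphic_derivI[OF holomorphic_on_hurwitz_reg[OF v, of UNIV]]) auto
  hence "((\<lambda>s. hurwitz_reg v s - v powr (-s)) has_field_derivative (deriv (hurwitz_reg v) 1 + ln v / v)) (at 1)"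
    using v0 by (auto intro!: derivative_eq_intros simp: powr_minus field_simps)
  hence "deriv (hurwitz_reg (v + 1)) 1 = deriv (hurwitz_reg v) 1 + ln v / v"
    unfolding hurwitz_reg_plus_1[OF v, symmetric] by (intro DERIV_imp_deriv)
  thus ?thesis by (simp add: gen_stieltjes_eq_deriv v v1)
qed

section \<open>Values at 0 and the constant term at 1\<close>

lemma Laplace_powr_of_real:
  assumes "a > 0" "x > (0::real)"
  shows "(LINT t:{0<..}|lborel. t powr (a - 1) * exp (- x * t)) = Gamma a * x powr (-a)"
proof -
  have "complex_of_real (LINT t:{0<..}|lborel. t powr (a - 1) * exp (- x * t)) =
     (LINT t:{0<..}|lborel. complex_of_real (t powr (a - 1) * exp (- x * t)))"
    by (rule set_integral_complex_of_real[symmetric])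
  also have "\<dots> = (LINT t:{0<..}|lborel. of_real t powr (of_real a - 1) * exp (- of_real x * of_real t))"
    by (rule set_lebesgue_integral_cong) (auto simp: powr_of_real[symmetric] exp_of_real[symmetric])
  also have "\<dots> = Gamma (of_real a) * of_real x powr (- of_real a)"
    using assms by (intro Laplace_real) auto
  also have "\<dots> = complex_of_real (Gamma a * x powr (-a))"
    using assms by (simp add: powr_of_real[symmetric] Gamma_complex_of_real)
  finally show ?thesis by (simp only: of_real_eq_iff)
qed

text \<open>An estimate as in Watson's lemma: vanishing of order K of the kernel at t = 0 becomes
  decay in x. This is the source of all asymptotics for large argument.\<close>

lemma todd_Laplace_bound:
  assumes "Re s + real K > 0"
  shows "\<exists>C. \<forall>x>0. norm (todd_Laplace K (of_real x) s) \<le> C * x powr (- (Re s + real K))"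
proof -
  obtain C where C: "C \<ge> 0" and
    Cb: "\<And>v t. t > 0 \<Longrightarrow> norm (exp (- v * of_real t) * todd_rest K t) \<le> C * t powr real K * exp (- Re v * t)"
    using exp_todd_rest_bound by blast
  have "norm (todd_Laplace K (of_real x) s) \<le> C * Gamma (Re s + K) * x powr (- (Re s + real K))" if x: "x > 0" for x
  proof -
    have i: "set_integrable lborel {0<..} (\<lambda>t. C * (t powr (Re s + real K - 1) * exp (- x * t)))"
      using set_integrable_Gamma_real[of "Re s + real K" x] assms x by auto
    have "norm (todd_Laplace K (of_real x) s) \<le> (LINT t:{0<..}|lborel. C * (t powr (Re s + real K - 1) * exp (- x * t)))"
      unfolding todd_Laplace_def set_lebesgue_integral_def
    proof (rule Bochner_Integration.integral_norm_bound_integral)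
      have "set_integrable lborel {0<..} (\<lambda>t::real. of_real t powr (s - 1) * (exp (- of_real x * of_real t) * todd_rest K t))"
        using Cb[of _ "of_real x"] x assms by (intro set_integrable_Mellin[OF exp_todd_rest_measurable]) auto
      thus "integrable lborel (\<lambda>t. indicator {0<..} t *\<^sub>R (of_real t powr (s - 1) * (exp (- of_real x * of_real t) * todd_rest K t)))"
        by (simp only: set_integrable_def)
      show "integrable lborel (\<lambda>t. indicat_real {0<..} t *\<^sub>R (C * (t powr (Re s + real K - 1) * exp (- x * t))))"
        using i by (simp only: set_integrable_def)
      fix t :: real
      show "norm (indicat_real {0<..} t *\<^sub>R (complex_of_real t powr (s - 1) * (exp (- complex_of_real x * complex_of_real t) * todd_rest K t)))
         \<le> indicat_real {0<..} t *\<^sub>R (C * (t powr (Re s + real K - 1) * exp (- x * t)))"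
        using norm_Mellin_kernel_le[where g = "\<lambda>t. exp (- complex_of_real x * complex_of_real t) * todd_rest K t", OF _ Cb, of t]
        by (auto simp: indicator_def)
    qed
    also have "\<dots> = C * (Gamma (Re s + K) * x powr (- (Re s + real K)))"
      using assms x by (subst set_integral_mult_right, subst Laplace_powr_of_real) auto
    finally show ?thesis by simp
  qed
  thus ?thesis by blast
qed

lemma Re_pos_not_nonpos_Ints: "Re v > 0 \<Longrightarrow> v \<notin> \<int>\<^sub>\<le>\<^sub>0"
  using nonpos_Ints_Re_nonpos[of v] by auto

lemma hurwitz_reg_eq_todd:
  assumes "Re v > 0" "Re s > - real K"
  shows "hurwitz_reg v s = hurwitz_reg_todd K v s"
  by (rule hurwitz_reg_eqI[OF Re_pos_not_nonpos_Ints holomorphic_on_hurwitz_reg_todd])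
     (use assms hurwitz_sums_reg_todd in auto)

lemma hurwitz_reg_1_todd:
  assumes "Re v > 0"
  shows "hurwitz_reg v 1 = - Ln v + 1 / (2 * v) + todd_Laplace 1 v 1"
  using assms by (subst hurwitz_reg_eq_todd[where K = 1])
    (auto simp: hurwitz_reg_todd_def powr_quotient_def todd_coeff_1 powr_minus field_simps)

text \<open>Order K = 1 is the smallest one whose half plane contains a neighbourhood of s =
  0.\<close>

lemma hurwitz_zeta_todd_1:
  assumes "Re v > 0" "Re s > -1" "s \<noteq> 1"
  shows "hurwitz_zeta s v = v powr (1 - s) / (s - 1) + v powr (-s) / 2 + rGamma s * todd_Laplace 1 v s"
proof -
  have "hurwitz_zeta s v = 1 / (s - 1) + hurwitz_reg_todd 1 v s"
    using assms by (simp add: hurwitz_zeta_conv_reg[OF Re_pos_not_nonpos_Ints] hurwitz_reg_eq_todd[where K = 1])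
  also have "\<dots> = v powr (1 - s) / (s - 1) + v powr (-s) / 2 + rGamma s * todd_Laplace 1 v s"
    using assms by (simp add: hurwitz_reg_todd_def powr_quotient_def todd_coeff_1 diff_divide_distrib)
  finally show ?thesis .
qed

text \<open>The reciprocal Gamma function vanishes at 0 and removes the integral, so that only the
  two elementary terms remain.\<close>

lemma hurwitz_zeta_0:
  assumes "Re v > 0"
  shows "hurwitz_zeta 0 v = 1 / 2 - v"
  using assms by (subst hurwitz_zeta_todd_1) auto

lemma hurwitz_reg_plus_of_nat:
  assumes "Re v > 0"
  shows "hurwitz_reg (v + of_nat n) s = hurwitz_reg v s - (\<Sum>k<n. (v + of_nat k) powr (-s))"
proof (induction n)
  case (Suc n)
  have "Re (v + of_nat n) > 0" using assms by simp
  from hurwitz_reg_plus_1[OF Re_pos_not_nonpos_Ints[OF this], of s] Suc show ?case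
    by (simp add: algebra_simps)
qed auto

lemma todd_Laplace_tendsto_0:
  assumes "Re s + real K > 0" "filterlim f at_top F"
  shows "((\<lambda>n. todd_Laplace K (of_real (f n)) s) \<longlongrightarrow> 0) F"
proof -
  obtain C where C: "\<And>x. x > 0 \<Longrightarrow> norm (todd_Laplace K (of_real x) s) \<le> C * x powr (- (Re s + real K))"
    using todd_Laplace_bound[OF assms(1)] by blast
  show ?thesis
  proof (rule Lim_null_comparison)
    show "\<forall>\<^sub>F n in F. norm (todd_Laplace K (of_real (f n)) s) \<le> C * f n powr (- (Re s + real K))"
      using eventually_compose_filterlim[OF eventually_gt_at_top[of 0] assms(2)]
      by eventually_elim (use C in auto)
    have "((\<lambda>n. f n powr (- (Re s + real K))) \<longlongrightarrow> 0) F"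
      using tendsto_neg_powr[of "- (Re s + real K)" f F] assms by simp
    thus "((\<lambda>n. C * f n powr (- (Re s + real K))) \<longlongrightarrow> 0) F" by (rule tendsto_mult_right_zero)
  qed
qed

text \<open>This is gamma_0(x) = - Psi(x). After n shifts the value at x is the value at x + n plus
  a partial harmonic sum. The former is - ln (x + n) + o(1), so the limit n to infinity is the limit
  formula \<open>Digamma_LIMSEQ\<close>.\<close>

theorem hurwitz_reg_1_Digamma:
  assumes "x > 0"
  shows "hurwitz_reg (of_real x) 1 = - of_real (Digamma x)"
proof -
  define f where "f = (\<lambda>n::nat. x + real n)"
  have f: "filterlim f at_top sequentially" unfolding f_def by real_asymp
  have eq: "hurwitz_reg (of_real x) 1 = (todd_Laplace 1 (of_real (f n)) 1 + of_real (1 / (2 * f n) - ln (f n) + ln n))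
     - of_real (ln (real n) - (\<Sum>k<n. inverse (x + real k)))" for n
  proof -
    have "hurwitz_reg (of_real x + of_nat n) 1 = - Ln (of_real (f n)) + 1 / (2 * of_real (f n)) + todd_Laplace 1 (of_real (f n)) 1"
      using assms hurwitz_reg_1_todd[of "of_real x + of_nat n"] by (simp add: f_def)
    moreover have "(\<Sum>k<n. (of_real x + of_nat k) powr (-1)) = complex_of_real (\<Sum>k<n. inverse (x + real k))"
      by (simp add: powr_minus)
    moreover have "Ln (of_real (f n)) = of_real (ln (f n))" using assms by (intro Ln_of_real) (auto simp: f_def)
    moreover have "hurwitz_reg (of_real x) 1 = hurwitz_reg (of_real x + of_nat n) 1 + (\<Sum>k<n. (of_real x + of_nat k) powr (-1))"
      using hurwitz_reg_plus_of_nat[of "of_real x" n 1] assms by simp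
    ultimately show ?thesis by (simp only:) simp
  qed
  have "(\<lambda>n. (todd_Laplace 1 (of_real (f n)) 1 + of_real (1 / (2 * f n) - ln (f n) + ln n))
     - of_real (ln (real n) - (\<Sum>k<n. inverse (x + real k)))) \<longlonglongrightarrow> (0 + of_real 0) - of_real (Digamma x)"
  proof (intro tendsto_intros todd_Laplace_tendsto_0 f)
    show "(\<lambda>n. 1 / (2 * f n) - ln (f n) + ln (real n)) \<longlonglongrightarrow> 0" unfolding f_def by real_asymp
    show "(\<lambda>n. ln (real n) - (\<Sum>k<n. inverse (x + real k))) \<longlonglongrightarrow> Digamma x"
      using Digamma_LIMSEQ[of x] assms by simp
  qed auto
  hence "(\<lambda>n::nat. hurwitz_reg (of_real x) 1) \<longlonglongrightarrow> - of_real (Digamma x)" by (simp only: eq[symmetric]) simp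
  thus ?thesis by (simp add: LIMSEQ_const_iff)
qed

section \<open>The first derivative at s = 0\<close>

definition hurwitz_deriv_0 :: "complex \<Rightarrow> complex" where
  "hurwitz_deriv_0 v = deriv (\<lambda>s. hurwitz_zeta s v) 0"

lemma has_field_derivative_hurwitz_zeta_0:
  assumes "Re v > 0"
  shows "((\<lambda>s. hurwitz_zeta s v) has_field_derivative hurwitz_deriv_0 v) (at 0)"
  unfolding hurwitz_deriv_0_def
  by (rule holomorphic_derivI[OF holomorphic_on_hurwitz_zeta[OF Re_pos_not_nonpos_Ints[OF assms], of "-{1}"]]) auto

lemma hurwitz_deriv_0_plus_1:
  assumes "Re v > 0"
  shows "hurwitz_deriv_0 (v + 1) = hurwitz_deriv_0 v + Ln v"
proof -
  have v0: "v \<noteq> 0" using assms by auto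
  have d: "((\<lambda>s::complex. - s) has_field_derivative - 1) (at 0)" by (auto intro!: derivative_eq_intros)
  have "((\<lambda>s. hurwitz_zeta s v - v powr (-s)) has_field_derivative hurwitz_deriv_0 v - Ln v * v powr (-0) * (-1)) (at 0)"
    by (rule DERIV_diff[OF has_field_derivative_hurwitz_zeta_0[OF assms] DERIV_powr_const_base[OF v0 d]])
  also have "?this \<longleftrightarrow> ((\<lambda>s. hurwitz_zeta s (v + 1)) has_field_derivative hurwitz_deriv_0 v + Ln v) (at 0)"
  proof (rule DERIV_cong_ev)
    have "eventually (\<lambda>s. s \<in> -{1}) (nhds (0::complex))" by (rule eventually_nhds_in_open) auto
    thus "\<forall>\<^sub>F s in nhds 0. hurwitz_zeta s v - v powr (-s) = hurwitz_zeta s (v + 1)"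
      by eventually_elim (use assms in \<open>simp add: hurwitz_zeta_conv_reg Re_pos_not_nonpos_Ints hurwitz_reg_plus_1\<close>)
  qed (use v0 in auto)
  finally show ?thesis
    by (rule DERIV_unique[OF has_field_derivative_hurwitz_zeta_0, rotated]) (use assms in auto)
qed

text \<open>Since rGamma has a simple zero with derivative 1 at 0, the product rule leaves the value
  of the integral at 0 and drops its derivative. The result is Stirling's approximation with an
  integral remainder.\<close>

lemma hurwitz_deriv_0_todd:
  assumes "Re v > 0"
  shows "hurwitz_deriv_0 v = (v - 1 / 2) * Ln v - v + todd_Laplace 1 v 0"
proof -
  have v0: "v \<noteq> 0" using assms by auto
  have d: "((\<lambda>s::complex. - s) has_field_derivative - 1) (at 0)" "((\<lambda>s::complex. 1 - s) has_field_derivative - 1) (at 0)"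
    by (auto intro!: derivative_eq_intros)
  have dT: "(todd_Laplace 1 v has_field_derivative deriv (todd_Laplace 1 v) 0) (at 0)"
    by (rule holomorphic_derivI[OF holomorphic_on_todd_Laplace[OF assms]]) (auto simp: open_halfspace_Re_gt)
  \<comment> \<open>The derivative of rGamma at 0 is read off from rGamma s = s * rGamma (s +
    1).\<close>
  have "((\<lambda>s. s * rGamma (s + 1)) has_field_derivative 1) (at (0::complex))"
    by (auto intro!: derivative_eq_intros)
  hence dG: "(rGamma has_field_derivative 1) (at (0::complex))"
    by (simp add: rGamma_plus1)
  have d': "((\<lambda>s::complex. s - 1) has_field_derivative 1) (at 0)" by (auto intro!: derivative_eq_intros)
  have "((\<lambda>s. v powr (1 - s) / (s - 1)) has_field_derivative v * Ln v - v) (at 0)"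
    using DERIV_divide[OF DERIV_powr_const_base[OF v0 d(2)] d'] v0 by (simp add: mult.commute)
  moreover have "((\<lambda>s. v powr (-s) / 2) has_field_derivative - (Ln v / 2)) (at 0)"
    using DERIV_cdivide[OF DERIV_powr_const_base[OF v0 d(1)], of 2] v0 by simp
  moreover have "((\<lambda>s. rGamma s * todd_Laplace 1 v s) has_field_derivative todd_Laplace 1 v 0) (at 0)"
    using DERIV_mult'[OF dG dT] by simp
  ultimately have A: "((\<lambda>s. v powr (1 - s) / (s - 1) + v powr (-s) / 2 + rGamma s * todd_Laplace 1 v s) has_field_derivative
     (v * Ln v - v + - (Ln v / 2)) + todd_Laplace 1 v 0) (at 0)"
    by (intro DERIV_add)
  have B: "(v * Ln v - v + - (Ln v / 2)) + todd_Laplace 1 v 0 = (v - 1 / 2) * Ln v - v + todd_Laplace 1 v 0"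
    by (simp add: algebra_simps)
  have "((\<lambda>s. v powr (1 - s) / (s - 1) + v powr (-s) / 2 + rGamma s * todd_Laplace 1 v s) has_field_derivative
     (v - 1 / 2) * Ln v - v + todd_Laplace 1 v 0) (at 0)"
    using A unfolding B .
  also have "?this \<longleftrightarrow> ((\<lambda>s. hurwitz_zeta s v) has_field_derivative (v - 1 / 2) * Ln v - v + todd_Laplace 1 v 0) (at 0)"
  proof (rule DERIV_cong_ev)
    have "eventually (\<lambda>s. s \<in> ball 0 1) (nhds (0::complex))" by (rule eventually_nhds_in_open) auto
    thus "\<forall>\<^sub>F s in nhds 0. v powr (1 - s) / (s - 1) + v powr (-s) / 2 + rGamma s * todd_Laplace 1 v s = hurwitz_zeta s v"
    proof eventually_elim
      case (elim s)
      hence "Re s > -1" "s \<noteq> 1" using abs_Re_le_cmod[of s] by auto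
      thus ?case using assms by (simp add: hurwitz_zeta_todd_1)
    qed
  qed auto
  finally show ?thesis
    using DERIV_unique has_field_derivative_hurwitz_zeta_0[OF assms] by blast
qed

lemma hurwitz_deriv_0_plus_of_nat:
  assumes "x > 0"
  shows "hurwitz_deriv_0 (of_real (x + real n)) = hurwitz_deriv_0 (of_real x) + of_real (\<Sum>k<n. ln (x + real k))"
proof (induction n)
  case (Suc n)
  have "hurwitz_deriv_0 (of_real (x + real n) + 1) = hurwitz_deriv_0 (of_real (x + real n)) + of_real (ln (x + real n))"
    using assms by (subst hurwitz_deriv_0_plus_1) (auto simp del: of_real_add simp: Ln_of_real)
  with Suc show ?case by (simp add: add_ac)
qed auto

text \<open>zeta'(0,x) and ln Gamma x satisfy the same recurrence in x. After Suc n shifts at x and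
  at 1, the difference of both sides consists of Stirling terms and remainders that tend to 0. The
  additive constant zeta'(0,1) is determined separately.\<close>

lemma hurwitz_deriv_0_diff_ln_Gamma:
  assumes x: "x > 0"
  shows "hurwitz_deriv_0 (of_real x) = hurwitz_deriv_0 1 + of_real (ln_Gamma x)"
proof -
  define A where "A = (\<lambda>x::real. (x - 1 / 2) * ln x - x)"
  have A: "hurwitz_deriv_0 (of_real x) = of_real (A x) + todd_Laplace 1 (of_real x) 0" if "x > 0" for x
    using that by (simp add: hurwitz_deriv_0_todd A_def Ln_of_real)
  \<comment> \<open>The elementary terms that separate \<open>ln_Gamma_series\<close> from the
    difference of the two derivatives, apart from the two integral remainders.\<close>
  define r where "r = (\<lambda>n::nat. x * ln n - ln (n + 1) + A (1 + real (Suc n)) - A (x + real (Suc n)))"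
  have r: "r \<longlonglongrightarrow> 0" unfolding r_def A_def by real_asymp
  have eq: "of_real (ln_Gamma_series x n) = (of_real (r n) + todd_Laplace 1 (of_real (1 + real (Suc n))) 0
      - todd_Laplace 1 (of_real (x + real (Suc n))) 0) + (hurwitz_deriv_0 (of_real x) - hurwitz_deriv_0 1)"
    if n: "n > 0" for n
  proof -
    have s: "(\<Sum>k<Suc n. ln (y + real k)) = ln y + (\<Sum>k=1..n. ln (y + real k))" for y
    proof -
      have "(\<Sum>k<n. ln (y + real (Suc k))) = (\<Sum>k=1..n. ln (y + real k))"
        by (rule sum.reindex_bij_witness[of _ "\<lambda>k. k - 1" Suc]) auto
      thus ?thesis by (subst sum.lessThan_Suc_shift) simp
    qed
    have "(\<Sum>k=1..n. ln (x / real k + 1)) = (\<Sum>k=1..n. ln (x + real k)) - (\<Sum>k=1..n. ln (real k))"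
      using x unfolding sum_subtractf[symmetric]
    proof (intro sum.cong refl)
      fix k assume "k \<in> {1..n}"
      hence "x / real k + 1 = (x + real k) / real k" "real k > 0" by (auto simp: field_simps)
      thus "ln (x / real k + 1) = ln (x + real k) - ln (real k)" using x by (simp add: ln_div)
    qed
    hence "ln_Gamma_series x n = x * ln n - (\<Sum>k<Suc n. ln (x + real k)) + (\<Sum>k=1..n. ln (real k))"
      unfolding s by (simp add: ln_Gamma_series_def)
    also have "(\<Sum>k=1..n. ln (real k)) = (\<Sum>k<n. ln (1 + real k))"
      by (rule sum.reindex_bij_witness[of _ "\<lambda>k. k + 1" "\<lambda>k. k - 1"]) auto
    also have "\<dots> = (\<Sum>k<Suc n. ln (1 + real k)) - ln (real n + 1)" by (simp add: add_ac)
    finally have "complex_of_real (ln_Gamma_series x n) = of_real (x * ln n) - of_real (\<Sum>k<Suc n. ln (x + real k))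
       + of_real (\<Sum>k<Suc n. ln (1 + real k)) - of_real (ln (real n + 1))" by simp
    moreover have "of_real (\<Sum>k<Suc n. ln (x + real k)) = hurwitz_deriv_0 (of_real (x + real (Suc n))) - hurwitz_deriv_0 (of_real x)"
      using hurwitz_deriv_0_plus_of_nat[OF x, of "Suc n"] by simp
    moreover have "of_real (\<Sum>k<Suc n. ln (1 + real k)) = hurwitz_deriv_0 (of_real (1 + real (Suc n))) - hurwitz_deriv_0 1"
      using hurwitz_deriv_0_plus_of_nat[of 1 "Suc n"] by simp
    moreover have "hurwitz_deriv_0 (of_real (x + real (Suc n))) = of_real (A (x + real (Suc n))) + todd_Laplace 1 (of_real (x + real (Suc n))) 0"
      by (rule A) (use x in simp)
    moreover have "hurwitz_deriv_0 (of_real (1 + real (Suc n))) = of_real (A (1 + real (Suc n))) + todd_Laplace 1 (of_real (1 + real (Suc n))) 0"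
      by (rule A) simp
    moreover have "complex_of_real (r n) = of_real (x * ln n) - of_real (ln (real n + 1)) + of_real (A (1 + real (Suc n))) - of_real (A (x + real (Suc n)))"
      by (simp add: r_def)
    ultimately show ?thesis by (simp only:) (simp only: algebra_simps)
  qed
  have f: "filterlim (\<lambda>n. 1 + real (Suc n)) at_top sequentially" "filterlim (\<lambda>n. x + real (Suc n)) at_top sequentially"
    by real_asymp+
  have "(\<lambda>n. (of_real (r n) + todd_Laplace 1 (of_real (1 + real (Suc n))) 0
      - todd_Laplace 1 (of_real (x + real (Suc n))) 0) + (hurwitz_deriv_0 (of_real x) - hurwitz_deriv_0 1))
      \<longlonglongrightarrow> (of_real 0 + 0 - 0) + (hurwitz_deriv_0 (of_real x) - hurwitz_deriv_0 1)"
    by (intro tendsto_intros r todd_Laplace_tendsto_0[OF _ f(1)] todd_Laplace_tendsto_0[OF _ f(2)]) auto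
  also have "?this \<longleftrightarrow> (\<lambda>n. complex_of_real (ln_Gamma_series x n)) \<longlonglongrightarrow> (of_real 0 + 0 - 0) + (hurwitz_deriv_0 (of_real x) - hurwitz_deriv_0 1)"
    by (rule filterlim_cong[OF refl refl]) (use eventually_gt_at_top[of "0::nat"] in \<open>eventually_elim, simp only: eq\<close>)
  finally have "(\<lambda>n. complex_of_real (ln_Gamma_series x n)) \<longlonglongrightarrow> hurwitz_deriv_0 (of_real x) - hurwitz_deriv_0 1" by simp
  moreover have "(\<lambda>n. complex_of_real (ln_Gamma_series x n)) \<longlonglongrightarrow> of_real (ln_Gamma x)"
    using ln_Gamma_real_LIMSEQ[OF x] by (rule tendsto_of_real)
  ultimately show ?thesis using LIMSEQ_unique by (fastforce simp: algebra_simps)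
qed

text \<open>The series of ((n + 1) / 2) powr (- s) is 2 powr s times zeta(s). Grouped in pairs, its
  even indices give the terms k + 1/2 and its odd ones the terms k + 1.\<close>

lemma hurwitz_zeta_half:
  assumes "s \<noteq> 1"
  shows "hurwitz_zeta s (1 / 2) = (2 powr s - 1) * hurwitz_zeta s 1"
proof (rule analytic_continuation_open[of "{s. Re s > 1}" "-{1}"
    "\<lambda>s. hurwitz_zeta s (1 / 2)" "\<lambda>s. (2 powr s - 1) * hurwitz_zeta s 1"])
  have ok: "(1 / 2 :: complex) \<notin> \<int>\<^sub>\<le>\<^sub>0" "(1 :: complex) \<notin> \<int>\<^sub>\<le>\<^sub>0" by (auto intro!: Re_pos_not_nonpos_Ints)
  show "(\<lambda>s. hurwitz_zeta s (1 / 2)) holomorphic_on -{1}" "(\<lambda>s. (2 powr s - 1) * hurwitz_zeta s 1) holomorphic_on -{1}"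
    by (intro holomorphic_intros holomorphic_on_hurwitz_zeta ok; simp)+
  show "{s. Re s > 1} \<noteq> {}" by (auto intro!: exI[of _ 2])
  fix s assume "s \<in> {s. Re s > 1}"
  hence s: "Re s > 1" by simp
  have h: "((of_nat n + 1) / 2) powr (-s) = 2 powr s * (of_nat n + 1) powr (-s)" for n
  proof -
    have "((of_nat n + 1) / 2) powr (-s) = (complex_of_real (1/2) * of_real (real n + 1)) powr (-s)" by (simp add: field_simps)
    also have "\<dots> = complex_of_real (1/2) powr (-s) * of_real (real n + 1) powr (-s)"
      by (rule powr_times_real) auto
    also have "complex_of_real (1/2) powr (-s) = 2 powr s"
      by (simp add: powr_def Ln_of_real[of "1/2", simplified] Ln_of_real[of 2, simplified] ln_div)
    finally show ?thesis by simp
  qed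
  have "(\<lambda>n. 2 powr s * (of_nat n + 1) powr (-s)) sums (2 powr s * hurwitz_zeta s 1)"
    by (intro sums_mult hurwitz_zeta_sums ok s)
  hence "(\<lambda>n. ((of_nat n + 1) / 2) powr (-s)) sums (2 powr s * hurwitz_zeta s 1)" by (simp add: h)
  from sums_group[OF this, of 2] have "(\<lambda>n. (of_nat n + 1 / 2) powr (-s) + (of_nat n + 1) powr (-s)) sums (2 powr s * hurwitz_zeta s 1)"
    by (simp add: eval_nat_numeral add_divide_distrib algebra_simps)
  moreover have "(\<lambda>n. (of_nat n + 1 / 2) powr (-s) + (of_nat n + 1) powr (-s)) sums (hurwitz_zeta s (1 / 2) + hurwitz_zeta s 1)"
    by (intro sums_add hurwitz_zeta_sums ok s)
  ultimately have "2 powr s * hurwitz_zeta s 1 = hurwitz_zeta s (1 / 2) + hurwitz_zeta s 1" by (rule sums_unique2)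
  thus "hurwitz_zeta s (1 / 2) = (2 powr s - 1) * hurwitz_zeta s 1" by (simp add: algebra_simps)
qed (use assms in \<open>auto simp: open_halfspace_Re_gt connected_Compl_singleton\<close>)

text \<open>The factor 2 powr s - 1 vanishes at 0, so the relation at 1/2 yields zeta'(0,1/2) = - ln
  2 / 2 without knowledge of zeta'(0,1). Comparison with ln Gamma(1/2) = ln pi / 2 gives the
  constant.\<close>

lemma hurwitz_deriv_0_1: "hurwitz_deriv_0 1 = - of_real (ln (2 * pi)) / 2"
proof -
  have d: "((\<lambda>s::complex. s) has_field_derivative 1) (at 0)" by (rule DERIV_ident)
  have "((\<lambda>s. (2 powr s - 1) * hurwitz_zeta s 1) has_field_derivative
     (2 powr 0 - 1) * hurwitz_deriv_0 1 + Ln 2 * 2 powr 0 * 1 * hurwitz_zeta 0 1) (at 0)"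
    using DERIV_mult'[OF DERIV_diff[OF DERIV_powr_const_base[OF _ d, of 2] DERIV_const[of 1]] has_field_derivative_hurwitz_zeta_0[of 1]]
    by simp
  also have "?this \<longleftrightarrow> ((\<lambda>s. hurwitz_zeta s (1 / 2)) has_field_derivative - Ln 2 / 2) (at 0)"
  proof (rule DERIV_cong_ev)
    have "eventually (\<lambda>s. s \<in> -{1}) (nhds (0::complex))" by (rule eventually_nhds_in_open) auto
    thus "\<forall>\<^sub>F s in nhds 0. (2 powr s - 1) * hurwitz_zeta s 1 = hurwitz_zeta s (1 / 2)"
      by eventually_elim (simp add: hurwitz_zeta_half)
  qed (simp_all add: hurwitz_zeta_0)
  finally have "hurwitz_deriv_0 (1 / 2) = - Ln 2 / 2"
    using DERIV_unique has_field_derivative_hurwitz_zeta_0[of "1 / 2"] by auto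
  moreover have "ln_Gamma (1 / 2 :: real) = ln pi / 2"
    by (subst Gamma_real_pos_exp[symmetric, THEN arg_cong[where f = ln], simplified]) (auto simp: Gamma_one_half_real ln_sqrt)
  hence "complex_of_real (ln_Gamma (1 / 2)) = of_real (ln pi) / 2" by (simp only: of_real_divide of_real_numeral)
  moreover have "hurwitz_deriv_0 (1 / 2) = hurwitz_deriv_0 1 + of_real (ln_Gamma (1 / 2))"
    using hurwitz_deriv_0_diff_ln_Gamma[of "1 / 2"] by simp
  moreover have "Ln 2 = complex_of_real (ln 2)" using Ln_of_real[of 2] by simp
  ultimately have "hurwitz_deriv_0 1 + of_real (ln pi) / 2 = - of_real (ln 2) / 2" by simp
  hence "hurwitz_deriv_0 1 = - of_real (ln 2) / 2 - of_real (ln pi) / 2" by (simp only: eq_diff_eq)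
  thus ?thesis by (simp add: ln_mult add_divide_distrib)
qed

theorem hurwitz_deriv_0_eq_ln_Gamma:
  assumes "x > 0"
  shows "hurwitz_deriv_0 (of_real x) = of_real (ln_Gamma x - ln (2 * pi) / 2)"
  using assms by (simp add: hurwitz_deriv_0_diff_ln_Gamma hurwitz_deriv_0_1)

section \<open>Partial fractions and a beta integral\<close>

lemma sin_pi_mult_eq_0_imp_Ints:
  fixes z :: complex
  assumes "sin (of_real pi * z) = 0"
  shows "z \<in> \<int>"
proof -
  obtain n :: int where "of_real pi * z = of_real (n * pi)" using assms by (auto simp: sin_eq_0)
  hence "z = of_int n" by auto
  thus ?thesis by simp
qed

text \<open>Obtained by differentiating Gamma z * Gamma (1 - z) * sin (pi z), which is constantly pi
  near z because the complement of the integers is open. The series of the Digamma function then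
  yields partial fractions of the cotangent.\<close>

lemma Digamma_reflection:
  fixes z :: complex
  assumes "z \<notin> \<int>"
  shows "Digamma (1 - z) - Digamma z = of_real pi * cot (of_real pi * z)"
proof -
  have z: "z \<notin> \<int>\<^sub>\<le>\<^sub>0" "1 - z \<notin> \<int>\<^sub>\<le>\<^sub>0"
  proof -
    show "z \<notin> \<int>\<^sub>\<le>\<^sub>0" using assms by auto
    have "1 - z \<notin> \<int>" using assms by (metis Ints_1 Ints_diff diff_diff_eq2 add_diff_cancel_left' )
    thus "1 - z \<notin> \<int>\<^sub>\<le>\<^sub>0" by auto
  qed
  have s: "sin (of_real pi * z) \<noteq> 0" using assms sin_pi_mult_eq_0_imp_Ints by blast
  have d1: "((\<lambda>z. 1 - z) has_field_derivative - 1) (at z)" by (auto intro!: derivative_eq_intros)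
  have G1: "((\<lambda>z. Gamma (1 - z)) has_field_derivative Gamma (1 - z) * Digamma (1 - z) * (-1)) (at z)"
    by (rule DERIV_chain2[OF has_field_derivative_Gamma d1]) (use z in auto)
  have "((\<lambda>z. Gamma z * Gamma (1 - z) * sin (of_real pi * z)) has_field_derivative
     (Gamma z * (Gamma (1 - z) * Digamma (1 - z) * (-1)) + Gamma z * Digamma z * Gamma (1 - z)) * sin (of_real pi * z)
      + cos (of_real pi * z) * of_real pi * (Gamma z * Gamma (1 - z))) (at z)"
    by (rule DERIV_cong, rule DERIV_mult DERIV_mult'[OF has_field_derivative_Gamma G1] derivative_intros | use z in simp)+
  moreover have "eventually (\<lambda>z. Gamma z * Gamma (1 - z) * sin (of_real pi * z) = of_real pi) (nhds z)"
  proof -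
    have "open (- (\<int> :: complex set))" by (simp add: open_Compl)
    hence "eventually (\<lambda>z. z \<in> - (\<int> :: complex set)) (nhds z)" using assms by (intro eventually_nhds_in_open) auto
    thus ?thesis
    proof eventually_elim
      case (elim z)
      have "sin (of_real pi * z) \<noteq> 0" using elim sin_pi_mult_eq_0_imp_Ints by blast
      thus ?case by (simp add: Gamma_reflection_complex)
    qed
  qed
  ultimately have "((\<lambda>z. of_real pi) has_field_derivative
     (Gamma z * (Gamma (1 - z) * Digamma (1 - z) * (-1)) + Gamma z * Digamma z * Gamma (1 - z)) * sin (of_real pi * z)
      + cos (of_real pi * z) * of_real pi * (Gamma z * Gamma (1 - z))) (at z)"
    by (subst DERIV_cong_ev[OF refl _ refl]) (auto elim!: eventually_mono)
  hence "(Gamma z * (Gamma (1 - z) * Digamma (1 - z) * (-1)) + Gamma z * Digamma z * Gamma (1 - z)) * sin (of_real pi * z)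
      + cos (of_real pi * z) * of_real pi * (Gamma z * Gamma (1 - z)) = 0"
    by (rule DERIV_unique[OF _ DERIV_const])
  hence "Gamma z * Gamma (1 - z) * ((Digamma z - Digamma (1 - z)) * sin (of_real pi * z) + cos (of_real pi * z) * of_real pi) = 0"
    by (simp add: algebra_simps)
  moreover have "Gamma z \<noteq> 0" "Gamma (1 - z) \<noteq> 0" using z by (auto simp: Gamma_eq_zero_iff)
  ultimately have "(Digamma z - Digamma (1 - z)) * sin (of_real pi * z) + cos (of_real pi * z) * of_real pi = 0" by simp
  hence "(Digamma (1 - z) - Digamma z) * sin (of_real pi * z) = of_real pi * cos (of_real pi * z)" by (simp add: algebra_simps)
  thus ?thesis using s by (simp add: cot_def field_simps)
qed

lemma Beta_complementary_real:
  assumes "-1 < u" "u < (0::real)"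
  shows "Beta (u + 1) (-u) = - (pi / sin (pi * u))"
proof -
  have "complex_of_real (Gamma (-u) * Gamma (1 - (-u))) = of_real pi / sin (of_real pi * (- of_real u))"
    using Gamma_reflection_complex[of "- of_real u"] by (simp flip: Gamma_complex_of_real)
  also have "\<dots> = of_real (- (pi / sin (pi * u)))" by (simp add: sin_of_real[symmetric])
  finally have "Gamma (-u) * Gamma (1 - (-u)) = - (pi / sin (pi * u))" by (simp only: of_real_eq_iff)
  thus ?thesis by (simp add: Beta_def mult_ac add_ac)
qed

text \<open>The substitution t = c * y / (1 - y) maps the unit interval onto the half line and leads
  to the Beta integral with parameters u + 1 and - u. The minus sign is due to sin (pi * u) <
  0.\<close>

lemma powr_over_affine_real:
  assumes u: "-1 < u" "u < (0::real)" and c: "c > (0::real)"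
  shows "set_integrable lborel {0<..} (\<lambda>t. t powr u / (t + c))"
    and "(LINT t:{0<..}|lborel. t powr u / (t + c)) = - (c powr u * pi / sin (pi * u))"
proof -
  define f where "f = (\<lambda>t. t powr u / (t + c))"
  define g where "g = (\<lambda>y. c * y / (1 - y))"
  define h where "h = (\<lambda>y. c / (1 - y) ^ 2)"
  have eq: "\<bar>h y\<bar> *\<^sub>R f (g y) = c powr u * (y powr (u + 1 - 1) * (1 - y) powr (-u - 1))" if "y \<in> {0<..<1}" for y
  proof -
    have "f (g y) = c powr u * y powr u / (1 - y) powr u / (c / (1 - y))"
      using that c by (simp add: f_def g_def powr_mult powr_divide field_simps)
    hence "\<bar>h y\<bar> *\<^sub>R f (g y) = c / (1 - y) ^ 2 * (c powr u * y powr u / (1 - y) powr u / (c / (1 - y)))"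
      using that c by (simp add: h_def)
    also have "\<dots> = c powr u * (y powr u * (inverse ((1 - y) powr u) * inverse (1 - y)))"
      using that c by (simp add: divide_simps power2_eq_square)
    also have "inverse ((1 - y) powr u) * inverse (1 - y) = (1 - y) powr (-u - 1)"
      using that by (simp add: powr_diff powr_minus divide_inverse)
    finally show ?thesis by simp
  qed
  have img: "g ` {0<..<1} = {0<..}"
  proof (intro equalityI subsetI)
    fix x :: real assume "x \<in> {0<..}"
    moreover from this have "1 - x / (x + c) = c / (x + c)" using c by (simp add: field_simps)
    ultimately have "x = g (x / (x + c))" "x / (x + c) \<in> {0<..<1}" using c by (auto simp: g_def)
    thus "x \<in> g ` {0<..<1}" by blast
  qed (use c in \<open>auto simp: g_def\<close>)
  have hi: "((\<lambda>y. c powr u * (y powr (u + 1 - 1) * (1 - y) powr (-u - 1))) has_integral c powr u * Beta (u + 1) (-u)) {0<..<1}"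
    using has_integral_Beta_real[of "u + 1" "-u"] u by (intro has_integral_mult_right) (auto simp: has_integral_Icc_iff_Ioo)
  have "(\<lambda>y. c powr u * (y powr (u + 1 - 1) * (1 - y) powr (-u - 1))) absolutely_integrable_on {0<..<1}"
    by (rule nonnegative_absolutely_integrable_1) (use hi c in \<open>auto intro: has_integral_integrable\<close>)
  hence "(\<lambda>y. \<bar>h y\<bar> *\<^sub>R f (g y)) absolutely_integrable_on {0<..<1}"
    by (subst set_integrable_cong[OF refl refl eq]) auto
  moreover have "integral {0<..<1} (\<lambda>y. \<bar>h y\<bar> *\<^sub>R f (g y)) = c powr u * Beta (u + 1) (-u)"
    unfolding integral_unique[OF hi, symmetric] by (rule integral_cong) (rule eq)
  ultimately have "(\<lambda>y. \<bar>h y\<bar> *\<^sub>R f (g y)) absolutely_integrable_on {0<..<1} \<and> integral {0<..<1} (\<lambda>y. \<bar>h y\<bar> *\<^sub>R f (g y)) = c powr u * Beta (u + 1) (-u)"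
    by (rule conjI)
  also have "?this \<longleftrightarrow> f absolutely_integrable_on g ` {0<..<1} \<and> integral (g ` {0<..<1}) f = c powr u * Beta (u + 1) (-u)"
  proof (rule has_absolute_integral_change_of_variables_real)
    show "(g has_real_derivative h y) (at y within {0<..<1})" if "y \<in> {0<..<1}" for y
      unfolding g_def h_def using that by (auto intro!: derivative_eq_intros simp: field_simps power2_eq_square)
    show "inj_on g {0<..<1}" using c by (auto simp: inj_on_def g_def field_simps)
  qed auto
  finally have *: "f absolutely_integrable_on {0<..}" "integral {0<..} f = c powr u * Beta (u + 1) (-u)" unfolding img by auto
  show 1: "set_integrable lborel {0<..} f"
    using *(1) by (subst set_integrable_lborel_iff_absolutely_integrable_on) (use c in \<open>auto simp: f_def intro!: continuous_intros\<close>)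
  show "(LINT t:{0<..}|lborel. f t) = - (c powr u * pi / sin (pi * u))"
    using set_borel_integral_eq_integral(2)[OF 1] *(2) Beta_complementary_real[OF u] by simp
qed

text \<open>Locally uniform lower bound that provides the majorant for holomorphy in c. For small t
  the distance of c from the negative axis counts, for large t the growth of t.\<close>

lemma slit_plane_affine_bound:
  fixes c0 :: complex
  assumes "c0 \<notin> \<real>\<^sub>\<le>\<^sub>0"
  obtains e \<kappa> where "e > 0" "cball c0 e \<subseteq> - \<real>\<^sub>\<le>\<^sub>0" "\<kappa> > 0"
    "\<And>c t. c \<in> cball c0 e \<Longrightarrow> t \<ge> 0 \<Longrightarrow> norm (of_real t + c) \<ge> \<kappa> * (t + 1)"
proof -
  have "open (- (\<real>\<^sub>\<le>\<^sub>0 :: complex set))" by (simp add: open_Compl)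
  hence "\<forall>x\<in>- \<real>\<^sub>\<le>\<^sub>0. \<exists>e>0. cball x e \<subseteq> (- \<real>\<^sub>\<le>\<^sub>0 :: complex set)" by (simp only: open_contains_cball)
  from bspec[OF this, of c0] obtain d where d: "d > 0" "cball c0 d \<subseteq> - \<real>\<^sub>\<le>\<^sub>0" using assms by auto
  define R where "R = norm c0 + d"
  \<comment> \<open>With weights R + 1 and d/2, the bounds d/2 and t - R for the norm add up to
    (d/2) * (t + 1); the divisor is the sum of the weights.\<close>
  define \<kappa> where "\<kappa> = (d / 2) / (d / 2 + R + 1)"
  have R: "R \<ge> 0" using d by (simp add: R_def)
  show ?thesis
  proof (rule that)
    show "d / 2 > 0" "\<kappa> > 0" using d R by (auto simp: \<kappa>_def)
    show "cball c0 (d / 2) \<subseteq> - \<real>\<^sub>\<le>\<^sub>0"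
      by (rule order.trans[OF subset_cball d(2)]) (use d in auto)
    fix c and t :: real assume c: "c \<in> cball c0 (d / 2)" and t: "t \<ge> 0"
    have 1: "norm (of_real t + c) \<ge> d / 2"
    proof (rule ccontr)
      assume "\<not> ?thesis"
      hence "dist c (- of_real t) < d / 2" by (simp add: dist_norm add.commute)
      moreover have "dist c0 (- of_real t) \<le> dist c0 c + dist c (- of_real t)" by (rule dist_triangle)
      ultimately have "- of_real t \<in> cball c0 d" using c by auto
      thus False using d(2) t by (auto simp: complex_nonpos_Reals_iff)
    qed
    have "norm c \<le> norm c0 + norm (c - c0)" by (metis norm_triangle_sub add.commute)
    also have "\<dots> \<le> R" using c d by (simp add: R_def dist_norm norm_minus_commute)
    finally have "norm (of_real t + c) \<ge> t - R"
      using norm_diff_ineq[of "of_real t" c] t by simp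
    hence A: "d / 2 * (t - R) \<le> d / 2 * norm (of_real t + c)" using d by (intro mult_left_mono) auto
    have B: "(R + 1) * (d / 2) \<le> (R + 1) * norm (of_real t + c)" using 1 R by (intro mult_left_mono) auto
    have "(d / 2 + R + 1) * norm (of_real t + c) = d / 2 * norm (of_real t + c) + (R + 1) * norm (of_real t + c)"
      by (simp only: algebra_simps)
    with A B have "(d / 2 + R + 1) * norm (of_real t + c) \<ge> d / 2 * (t - R) + (R + 1) * (d / 2)" by linarith
    moreover have "d / 2 * (t - R) + (R + 1) * (d / 2) = d / 2 * (t + 1)" by (simp add: field_simps)
    ultimately have "d / 2 * (t + 1) \<le> (d / 2 + R + 1) * norm (of_real t + c)" by linarith
    moreover have "d / 2 + R + 1 > 0" using d R by simp
    ultimately have "d / 2 * (t + 1) / (d / 2 + R + 1) \<le> norm (of_real t + c)"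
      by (subst pos_divide_le_eq) (auto simp only: mult.commute)
    thus "norm (of_real t + c) \<ge> \<kappa> * (t + 1)"
      by (simp only: \<kappa>_def times_divide_eq_left)
  qed
qed

text \<open>Extends the real case by the identity theorem on the slit plane. The values of interest
  are purely imaginary c, because the poles of the kernel lie on the imaginary axis.\<close>

lemma powr_over_affine:
  fixes c :: complex
  assumes u: "-1 < u" "u < (0::real)" and c: "c \<notin> \<real>\<^sub>\<le>\<^sub>0"
  shows "(LINT t:{0<..}|lborel. of_real (t powr u) / (of_real t + c)) = - (c powr of_real u * of_real (pi / sin (pi * u)))"
proof (rule holomorphic_eq_of_eq_on_real_segment[where S = "- \<real>\<^sub>\<le>\<^sub>0" and a = 0 and b = 1 and
      f = "\<lambda>c. LINT t:{0<..}|lborel. of_real (t powr u) / (of_real t + c)" and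
      g = "\<lambda>c. - (c powr of_real u * of_real (pi / sin (pi * u)))"])
  have nz: "of_real t + c \<noteq> 0" if "c \<notin> \<real>\<^sub>\<le>\<^sub>0" "t > 0" for c :: complex and t :: real
  proof
    assume "of_real t + c = 0"
    hence "c = of_real (- t)" by (simp add: eq_neg_iff_add_eq_0 add.commute)
    thus False using that by (simp add: complex_nonpos_Reals_iff)
  qed
  show "(\<lambda>c. LINT t:{0<..}|lborel. of_real (t powr u) / (of_real t + c)) holomorphic_on - \<real>\<^sub>\<le>\<^sub>0"
  proof (rule holomorphic_on_set_lebesgue_integral)
    fix c0 :: complex assume "c0 \<in> - \<real>\<^sub>\<le>\<^sub>0"
    then obtain e \<kappa> where e: "e > 0" "cball c0 e \<subseteq> - \<real>\<^sub>\<le>\<^sub>0" "\<kappa> > 0"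
      "\<And>c t. c \<in> cball c0 e \<Longrightarrow> t \<ge> 0 \<Longrightarrow> norm (of_real t + c) \<ge> \<kappa> * (t + 1)"
      using slit_plane_affine_bound by (metis ComplD)
    show "\<exists>e>0. \<exists>B. cball c0 e \<subseteq> - \<real>\<^sub>\<le>\<^sub>0 \<and> set_integrable lborel {0<..} B \<and>
      (\<forall>c\<in>cball c0 e. \<forall>t\<in>{0<..}. norm (of_real (t powr u) / (of_real t + c)) \<le> B t)"
    proof (intro exI[of _ e] exI[of _ "\<lambda>t. 1 / \<kappa> * (t powr u / (t + 1))"] conjI ballI e)
      show "set_integrable lborel {0<..} (\<lambda>t. 1 / \<kappa> * (t powr u / (t + 1)))"
        by (intro set_integrable_mult_right powr_over_affine_real(1) u) auto
      fix c and t :: real assume "c \<in> cball c0 e" "t \<in> {0<..}"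
      hence "norm (of_real t + c) \<ge> \<kappa> * (t + 1)" "t > 0" using e(4)[of c t] by auto
      hence "t powr u / norm (of_real t + c) \<le> t powr u / (\<kappa> * (t + 1))"
        using e(3) by (intro divide_left_mono) (auto intro!: mult_pos_pos elim: less_le_trans[rotated])
      thus "norm (of_real (t powr u) / (of_real t + c)) \<le> 1 / \<kappa> * (t powr u / (t + 1))"
        by (simp add: norm_divide)
    qed
  qed (auto intro!: open_Compl set_borel_measurable_lborel_continuous_on continuous_intros holomorphic_intros simp: nz)
  show "(LINT t:{0<..}|lborel. of_real (t powr u) / (of_real t + of_real x)) =
     - (complex_of_real x powr of_real u * of_real (pi / sin (pi * u)))" if "0 < x" for x
  proof -
    have "(LINT t:{0<..}|lborel. of_real (t powr u) / (of_real t + of_real x)) =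
      (LINT t:{0<..}|lborel. complex_of_real (t powr u / (t + x)))"
      by (rule set_lebesgue_integral_cong) auto
    also have "\<dots> = of_real (LINT t:{0<..}|lborel. t powr u / (t + x))"
      by (rule set_integral_complex_of_real)
    also have "\<dots> = - (complex_of_real x powr of_real u * of_real (pi / sin (pi * u)))"
      using that by (subst powr_over_affine_real(2)[OF u that]) (simp add: powr_of_real)
    finally show ?thesis .
  qed
  show "connected (- \<real>\<^sub>\<le>\<^sub>0 :: complex set)"
  proof -
    have "(\<real>\<^sub>\<le>\<^sub>0 :: complex set) = complex_of_real ` {..0}"
      by (auto simp: nonpos_Reals_def)
    moreover have "connected (- (complex_of_real ` {..0}))"
      by (rule starlike_imp_connected[OF starlike_slotted_complex_plane_left])
    ultimately show ?thesis by (simp only:)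
  qed
qed (use c in \<open>auto intro!: holomorphic_intros open_Compl simp: complex_nonpos_Reals_iff\<close>)

text \<open>The poles are 2 pi i (a + k) for integers k. For 0 < a < 1 none of them is 0, so the
  kernel has a finite value at t = 0.\<close>

definition twisted_kernel :: "real \<Rightarrow> real \<Rightarrow> complex" where
  "twisted_kernel a t = 1 / (exp (of_real t - 2 * of_real pi * \<i> * of_real a) - 1)"

lemma Digamma_diff_sums:
  fixes z :: complex
  assumes "z \<noteq> 0" "w \<noteq> 0"
  shows "(\<lambda>k. inverse (w + of_nat k) - inverse (z + of_nat k)) sums (Digamma z - Digamma w)"
  using sums_diff[OF summable_sums[OF summable_Digamma[OF assms(1)]] summable_sums[OF summable_Digamma[OF assms(2)]]]
  by (simp add: Digamma_def)

lemma inverse_exp_minus_1_conv_cot: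
  fixes w :: complex
  assumes "sin (of_real pi * w) \<noteq> 0"
  shows "1 / (exp (- 2 * of_real pi * \<i> * w) - 1) = - 1 / 2 + \<i> / 2 * cot (of_real pi * w)"
proof -
  define E where "E = exp (\<i> * (of_real pi * w))"
  have E: "E \<noteq> 0" by (simp add: E_def)
  have s: "sin (of_real pi * w) = (E - 1 / E) / (2 * \<i>)" and c: "cos (of_real pi * w) = (E + 1 / E) / 2"
    unfolding sin_exp_eq cos_exp_eq E_def by (simp_all add: exp_minus field_simps)
  have e: "exp (- 2 * of_real pi * \<i> * w) = 1 / (E * E)"
    by (simp add: E_def exp_add[symmetric] exp_minus[symmetric] divide_inverse algebra_simps)
  have nz: "E * E - 1 \<noteq> 0" using assms E unfolding s by (auto simp: field_simps)
  hence nz': "1 - E * E \<noteq> 0" by auto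
  have "1 / (1 / (E * E) - 1) = E * E / (1 - E * E)" using E nz' by (simp add: field_simps)
  moreover have "cot (of_real pi * w) = \<i> * (E * E + 1) / (E * E - 1)"
    unfolding cot_def s c using E nz by (simp add: field_simps)
  moreover have "E * E / (1 - E * E) = - 1 / 2 + \<i> / 2 * (\<i> * (E * E + 1) / (E * E - 1))"
    using nz nz' by (simp add: divide_simps) (simp add: algebra_simps)
  ultimately show ?thesis unfolding e by simp
qed

text \<open>The kernel is an affine function of a cotangent, and pi times the cotangent is a
  difference of two Digamma values, each given by a one-sided series. The numbers c k and d k are
  the negatives of the poles above and below the real axis. Subtracting the value at 0 makes the
  terms of order k^(-2).\<close>

lemma twisted_kernel_partial_fractions:
  fixes a t :: real
  assumes a: "0 < a" "a < 1"
  defines "c \<equiv> (\<lambda>k::nat. - (2 * of_real pi * \<i> * of_real (a + real k)))"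
    and "d \<equiv> (\<lambda>k::nat. 2 * of_real pi * \<i> * of_real (1 - a + real k))"
  shows "(\<lambda>k. - of_real t / (c k * (of_real t + c k)) - of_real t / (d k * (of_real t + d k)))
           sums (twisted_kernel a t - twisted_kernel a 0)"
proof -
  \<comment> \<open>Chosen so that the exponent of the kernel becomes -2 pi i w.\<close>
  define w where "w = of_real a + \<i> * of_real t / (2 * of_real pi)"
  have notint: "z \<notin> \<int>" if "Re z = a" for z using that a by (auto elim!: Ints_cases)
  have Re: "Re w = a" "Re (of_real a) = a" by (auto simp: w_def)
  have s: "sin (of_real pi * z) \<noteq> 0" if "Re z = a" for z
    using notint[OF that] sin_pi_mult_eq_0_imp_Ints by blast
  have tk: "twisted_kernel a t = - 1 / 2 + \<i> / 2 * cot (of_real pi * w)"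
  proof -
    have "of_real t - 2 * of_real pi * \<i> * of_real a = - 2 * of_real pi * \<i> * w" by (simp add: w_def field_simps)
    thus ?thesis unfolding twisted_kernel_def using inverse_exp_minus_1_conv_cot[OF s[OF Re(1)]] by simp
  qed
  have tk0: "twisted_kernel a 0 = - 1 / 2 + \<i> / 2 * cot (of_real pi * of_real a)"
    unfolding twisted_kernel_def using inverse_exp_minus_1_conv_cot[OF s[OF Re(2)]] by simp
  have nz: "z \<noteq> 0" "1 - z \<noteq> 0" if "Re z = a" for z using that a by (auto simp: complex_eq_iff)
  define X where "X = (Digamma (1 - w) - Digamma (1 - of_real a)) - (Digamma w - Digamma (of_real a))"
  have "twisted_kernel a t - twisted_kernel a 0 =
     \<i> / (2 * of_real pi) * (of_real pi * cot (of_real pi * w) - of_real pi * cot (of_real pi * of_real a))"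
    unfolding tk tk0 by (simp add: field_simps)
  also have "of_real pi * cot (of_real pi * w) - of_real pi * cot (of_real pi * of_real a) = X"
    unfolding X_def Digamma_reflection[OF notint[OF Re(1)], symmetric] Digamma_reflection[OF notint[OF Re(2)], symmetric] by simp
  finally have eq: "twisted_kernel a t - twisted_kernel a 0 = \<i> / (2 * of_real pi) * X" .
  have "(\<lambda>k. \<i> / (2 * of_real pi) * ((inverse (1 - of_real a + of_nat k) - inverse (1 - w + of_nat k)) - (inverse (of_real a + of_nat k) - inverse (w + of_nat k))))
    sums (\<i> / (2 * of_real pi) * X)"
    unfolding X_def by (intro sums_mult sums_diff Digamma_diff_sums nz Re)
  also have "(\<lambda>k. \<i> / (2 * of_real pi) * ((inverse (1 - of_real a + of_nat k) - inverse (1 - w + of_nat k)) - (inverse (of_real a + of_nat k) - inverse (w + of_nat k)))) =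
    (\<lambda>k. - of_real t / (c k * (of_real t + c k)) - of_real t / (d k * (of_real t + d k)))"
  proof
    fix k :: nat
    have Re': "Re (of_real a + of_nat k) > 0" "Re (1 - of_real a + of_nat k) > 0" "Re (w + of_nat k) > 0" "Re (1 - w + of_nat k) > 0"
      using a by (simp_all add: w_def add_pos_nonneg)
    have nzs: "of_real a + of_nat k \<noteq> (0::complex)" "1 - of_real a + of_nat k \<noteq> (0::complex)" "w + of_nat k \<noteq> 0" "1 - w + of_nat k \<noteq> 0"
      using Re' by (metis less_irrefl zero_complex.simps(1))+
    have tw: "of_real t = 2 * of_real pi * \<i> * (of_real a - w)" by (simp add: w_def)
    have c: "c k = - (2 * of_real pi * \<i>) * (of_real a + of_nat k)" "of_real t + c k = - (2 * of_real pi * \<i>) * (w + of_nat k)"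
      unfolding c_def tw by (simp_all add: algebra_simps)
    have d: "d k = 2 * of_real pi * \<i> * (1 - of_real a + of_nat k)" "of_real t + d k = 2 * of_real pi * \<i> * (1 - w + of_nat k)"
      unfolding d_def tw by (simp_all add: algebra_simps)
    have aux: "- (C * (x - y)) / (- C * x * (- C * y)) = (inverse x - inverse y) / C"
      if "C \<noteq> 0" "x \<noteq> 0" "y \<noteq> 0" for C x y :: complex
      using that by (simp add: field_simps)
    have aux': "(C * (y - x)) / (C * x * (C * y)) = (inverse x - inverse y) / C"
      if "C \<noteq> 0" "x \<noteq> 0" "y \<noteq> 0" for C x y :: complex
      using that by (simp add: field_simps)
    have q: "\<i> / (2 * of_real pi) = - (1 / (2 * of_real pi * \<i>))" by (simp add: field_simps)
    have yx: "(1 - w + of_nat k) - (1 - of_real a + of_nat k) = of_real a - w" by simp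
    have 1: "- of_real t / (c k * (of_real t + c k)) = - (\<i> / (2 * of_real pi) * (inverse (of_real a + of_nat k) - inverse (w + of_nat k)))"
      unfolding c(2) unfolding c(1) unfolding tw q using aux[of "2 * of_real pi * \<i>" "of_real a + of_nat k" "w + of_nat k"] nzs by simp
    have 2: "of_real t / (d k * (of_real t + d k)) = - (\<i> / (2 * of_real pi) * (inverse (1 - of_real a + of_nat k) - inverse (1 - w + of_nat k)))"
      unfolding d(2) unfolding d(1) unfolding tw q
      using aux'[of "2 * of_real pi * \<i>" "1 - of_real a + of_nat k" "1 - w + of_nat k", unfolded yx] nzs
      by simp
    show "\<i> / (2 * of_real pi) * ((inverse (1 - of_real a + of_nat k) - inverse (1 - w + of_nat k)) - (inverse (of_real a + of_nat k) - inverse (w + of_nat k))) =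
      - of_real t / (c k * (of_real t + c k)) - of_real t / (d k * (of_real t + d k))"
      unfolding 1 2 by (simp add: algebra_simps)
  qed
  finally show ?thesis unfolding eq .
qed

section \<open>Mellin integral of the twisted kernel\<close>

lemma powr_shift_summable:
  assumes "x > 0" "e > (1::real)"
  shows "summable (\<lambda>k. (x + real k) powr (-e))"
proof -
  have "(\<lambda>k. (of_nat k + complex_of_real x) powr (- of_real e)) = (\<lambda>k. complex_of_real ((x + real k) powr (-e)))"
    using assms by (auto simp: powr_of_real[symmetric] add_ac)
  moreover have "summable (\<lambda>k. (of_nat k + complex_of_real x) powr (- of_real e))"
    using hurwitz_zeta_sums[of "of_real x" "of_real e"] assms by (auto simp: sums_iff Re_pos_not_nonpos_Ints)
  ultimately show ?thesis by (simp only: summable_complex_of_real)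
qed

lemma norm_real_plus_imaginary_ge:
  assumes "t > (0::real)"
  shows "norm (of_real t + \<i> * of_real y) \<ge> \<bar>y\<bar>" "norm (of_real t + \<i> * of_real y) \<ge> (t + \<bar>y\<bar>) / 2"
proof -
  show *: "norm (of_real t + \<i> * of_real y) \<ge> \<bar>y\<bar>"
    using abs_Im_le_cmod[of "of_real t + \<i> * of_real y"] by simp
  have "norm (of_real t + \<i> * of_real y) \<ge> t"
    using abs_Re_le_cmod[of "of_real t + \<i> * of_real y"] assms by simp
  with * show "norm (of_real t + \<i> * of_real y) \<ge> (t + \<bar>y\<bar>) / 2" by (simp add: field_simps)
qed

lemma imaginary_not_nonpos_Reals: "y \<noteq> 0 \<Longrightarrow> \<i> * of_real y \<notin> \<real>\<^sub>\<le>\<^sub>0"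
  by (simp add: complex_nonpos_Reals_iff)

text \<open>The Mellin integrand of a single partial fraction, belonging to the pole t = - i
  y.\<close>

definition pole_term :: "real \<Rightarrow> real \<Rightarrow> real \<Rightarrow> complex" where
  "pole_term u y t = of_real (t powr (u - 1)) * (- of_real t / (\<i> * of_real y * (of_real t + \<i> * of_real y)))"

text \<open>Besides the value of the integral, this supplies what the exchange of sum and integral
  consumes: an L1 bound of order |y| powr (u - 1) and a pointwise bound of order |y| powr (-2). Both
  are summable over the poles as u < 0.\<close>

lemma pole_term_integral:
  assumes u: "-1 < u" "u < (0::real)" and y: "y \<noteq> 0"
  shows "set_integrable lborel {0<..} (pole_term u y)"
    and "(LINT t:{0<..}|lborel. pole_term u y t) = (\<i> * of_real y) powr (of_real u - 1) * of_real (pi / sin (pi * u))"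
    and "(LINT t:{0<..}|lborel. norm (pole_term u y t)) \<le> 2 * - (pi / sin (pi * u)) * \<bar>y\<bar> powr (u - 1)"
    and "t > 0 \<Longrightarrow> norm (pole_term u y t) \<le> t powr u * \<bar>y\<bar> powr (-2)"
proof -
  have nz: "of_real t + \<i> * of_real y \<noteq> 0" if "t > 0" for t
    using that by (auto simp: complex_eq_iff)
  have eq: "pole_term u y t = - (1 / (\<i> * of_real y)) * (of_real (t powr u) / (of_real t + \<i> * of_real y))" if "t > 0" for t
  proof -
    have "complex_of_real (t powr (u - 1)) * of_real t = of_real (t powr u)"
      using that by (simp add: powr_diff)
    thus ?thesis unfolding pole_term_def using that nz[OF that] y by (simp add: field_simps)
  qed
  have norm_eq: "norm (pole_term u y t) = t powr u / (\<bar>y\<bar> * norm (of_real t + \<i> * of_real y))" if "t > 0" for t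
    unfolding eq[OF that] using that by (simp add: norm_mult norm_divide)
  have bound: "norm (pole_term u y t) \<le> 2 / \<bar>y\<bar> * (t powr u / (t + \<bar>y\<bar>))" if "t > 0" for t
  proof -
    have "t powr u / (\<bar>y\<bar> * norm (of_real t + \<i> * of_real y)) \<le> t powr u / (\<bar>y\<bar> * ((t + \<bar>y\<bar>) / 2))"
      using norm_real_plus_imaginary_ge[OF that, of y] that y nz[OF that]
      by (intro divide_left_mono mult_left_mono) (auto intro!: mult_pos_pos add_pos_pos)
    thus ?thesis using norm_eq[OF that] by (simp add: mult.commute)
  qed
  have i1: "set_integrable lborel {0<..} (\<lambda>t. 2 / \<bar>y\<bar> * (t powr u / (t + \<bar>y\<bar>)))"
    using y by (intro set_integrable_mult_right powr_over_affine_real(1) u) auto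
  show i2: "set_integrable lborel {0<..} (pole_term u y)"
  proof (rule set_integrable_lborel_boundI[OF _ _ i1 bound])
    have "continuous_on {0<..} (\<lambda>t. - (1 / (\<i> * of_real y)) * (of_real (t powr u) / (of_real t + \<i> * of_real y)))"
      using nz y by (auto intro!: continuous_intros)
    thus "continuous_on {0<..} (pole_term u y)"
      by (rule continuous_on_eq) (use eq in auto)
  qed auto
  have "(LINT t:{0<..}|lborel. pole_term u y t) =
    (LINT t:{0<..}|lborel. - (1 / (\<i> * of_real y)) * (of_real (t powr u) / (of_real t + \<i> * of_real y)))"
    by (rule set_lebesgue_integral_cong) (use eq in auto)
  also have "\<dots> = - (1 / (\<i> * of_real y)) * - ((\<i> * of_real y) powr of_real u * of_real (pi / sin (pi * u)))"
    by (subst set_integral_mult_right, subst powr_over_affine[OF u imaginary_not_nonpos_Reals[OF y]]) simp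
  also have "\<dots> = (\<i> * of_real y) powr (of_real u - 1) * of_real (pi / sin (pi * u))"
    using y by (simp add: powr_diff)
  finally show "(LINT t:{0<..}|lborel. pole_term u y t) = (\<i> * of_real y) powr (of_real u - 1) * of_real (pi / sin (pi * u))" .
  have "(LINT t:{0<..}|lborel. norm (pole_term u y t)) \<le> (LINT t:{0<..}|lborel. 2 / \<bar>y\<bar> * (t powr u / (t + \<bar>y\<bar>)))"
    by (rule set_integral_mono[OF set_integrable_norm[OF i2] i1]) (use bound in auto)
  also have "\<dots> = 2 / \<bar>y\<bar> * - (\<bar>y\<bar> powr u * pi / sin (pi * u))"
    using y by (subst set_integral_mult_right, subst powr_over_affine_real(2)[OF u]) auto
  also have "\<dots> = 2 * - (pi / sin (pi * u)) * \<bar>y\<bar> powr (u - 1)"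
    using y by (simp add: powr_diff mult_ac)
  finally show "(LINT t:{0<..}|lborel. norm (pole_term u y t)) \<le> 2 * - (pi / sin (pi * u)) * \<bar>y\<bar> powr (u - 1)" .
  show "norm (pole_term u y t) \<le> t powr u * \<bar>y\<bar> powr (-2)" if "t > 0" for t
  proof -
    have "t powr u / (\<bar>y\<bar> * norm (of_real t + \<i> * of_real y)) \<le> t powr u / (\<bar>y\<bar> * \<bar>y\<bar>)"
      using norm_real_plus_imaginary_ge[OF that, of y] that y nz[OF that]
      by (intro divide_left_mono mult_left_mono) (auto simp: zero_less_mult_iff)
    thus ?thesis using norm_eq[OF that] y by (simp add: powr_minus powr_realpow power2_eq_square divide_inverse)
  qed
qed

text \<open>Termwise integration by absolute convergence; the integrals of the norms are summable
  because 1 - u > 1.\<close>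

lemma pole_term_sum_integral:
  assumes u: "-1 < u" "u < (0::real)" and x: "x > 0" and y: "\<And>k. \<bar>y k\<bar> = 2 * pi * (x + real k)"
  shows "set_integrable lborel {0<..} (\<lambda>t. \<Sum>k. pole_term u (y k) t)"
    and "(\<lambda>k. LINT t:{0<..}|lborel. pole_term u (y k) t) sums (LINT t:{0<..}|lborel. (\<Sum>k. pole_term u (y k) t))"
    and "t > 0 \<Longrightarrow> summable (\<lambda>k. pole_term u (y k) t)"
proof -
  have y0: "y k \<noteq> 0" for k
  proof
    assume "y k = 0"
    hence "2 * pi * (x + real k) = 0" using y[of k] by simp
    thus False using x by simp
  qed
  have yp: "\<bar>y k\<bar> powr e = (2 * pi) powr e * (x + real k) powr e" for k e
    unfolding y using x by (simp add: powr_mult)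
  have sm: "summable (\<lambda>k. norm (pole_term u (y k) t))" if "t > 0" for t
  proof (rule summable_comparison_test')
    show "summable (\<lambda>k. t powr u * ((2 * pi) powr (-2) * (x + real k) powr (-2)))"
      using powr_shift_summable[OF x, of 2] by (intro summable_mult) auto
    show "norm (norm (pole_term u (y k) t)) \<le> t powr u * ((2 * pi) powr (-2) * (x + real k) powr (-2))" for k
      using pole_term_integral(4)[OF u y0 that, of k] unfolding yp by (simp only: real_norm_def abs_norm_cancel)
  qed
  show "summable (\<lambda>k. pole_term u (y k) t)" if "t > 0" for t
    using sm[OF that] by (rule summable_norm_cancel)
  define f where "f = (\<lambda>k t. indicator {0<..} t *\<^sub>R pole_term u (y k) t)"
  have 1: "integrable lborel (f k)" for k
    using pole_term_integral(1)[OF u y0] by (simp add: f_def set_integrable_def)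
  have 2: "AE t in lborel. summable (\<lambda>k. norm (f k t))"
    by (rule AE_I2) (use sm in \<open>auto simp: f_def indicator_def\<close>)
  have 3: "summable (\<lambda>k. LINT t|lborel. norm (f k t))"
  proof (rule summable_comparison_test')
    show "summable (\<lambda>k. 2 * - (pi / sin (pi * u)) * ((2 * pi) powr (u - 1) * (x + real k) powr (- (1 - u))))"
      using powr_shift_summable[OF x, of "1 - u"] u by (intro summable_mult) auto
    fix k
    have "(LINT t|lborel. norm (f k t)) = (LINT t:{0<..}|lborel. norm (pole_term u (y k) t))"
      unfolding set_lebesgue_integral_def f_def by (rule Bochner_Integration.integral_cong) (auto simp: indicator_def)
    also have "\<dots> \<le> 2 * - (pi / sin (pi * u)) * \<bar>y k\<bar> powr (u - 1)"
      by (rule pole_term_integral(3)[OF u y0])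
    finally show "norm (LINT t|lborel. norm (f k t)) \<le> 2 * - (pi / sin (pi * u)) * ((2 * pi) powr (u - 1) * (x + real k) powr (- (1 - u)))"
      unfolding yp by simp
  qed
  have eq: "(\<Sum>k. f k t) = indicator {0<..} t *\<^sub>R (\<Sum>k. pole_term u (y k) t)" for t
    by (auto simp: f_def indicator_def)
  show "set_integrable lborel {0<..} (\<lambda>t. \<Sum>k. pole_term u (y k) t)"
    using integrable_suminf[OF 1 2 3] unfolding eq set_integrable_def .
  show "(\<lambda>k. LINT t:{0<..}|lborel. pole_term u (y k) t) sums (LINT t:{0<..}|lborel. (\<Sum>k. pole_term u (y k) t))"
    using sums_integral[OF 1 2 3] unfolding eq set_lebesgue_integral_def by (simp add: f_def)
qed

lemma imaginary_powr:
  assumes "y > 0"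
  shows "(\<i> * of_real y) powr z = of_real y powr z * exp (\<i> * of_real pi * z / 2)"
    and "(\<i> * of_real (- y)) powr z = of_real y powr z * exp (- (\<i> * of_real pi * z / 2))"
proof -
  have "(of_real y * \<i>) powr z = of_real y powr z * \<i> powr z"
    by (rule powr_times_real_left) (use assms in auto)
  also have "\<i> powr z = exp (\<i> * of_real pi * z / 2)" by (simp add: powr_def mult_ac)
  finally show "(\<i> * of_real y) powr z = of_real y powr z * exp (\<i> * of_real pi * z / 2)" by (simp add: mult_ac)
  have "(of_real y * (- \<i>)) powr z = of_real y powr z * (- \<i>) powr z"
    by (rule powr_times_real_left) (use assms in auto)
  also have "(- \<i>) powr z = exp (- (\<i> * of_real pi * z / 2))" by (simp add: powr_def mult_ac)
  finally show "(\<i> * of_real (- y)) powr z = of_real y powr z * exp (- (\<i> * of_real pi * z / 2))" by (simp add: mult_ac)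
qed

lemma imaginary_lattice_powr_sums:
  assumes x: "x > 0" and u: "u < (0::real)"
  shows "(\<lambda>k. (\<i> * of_real (2 * pi * (x + real k))) powr (of_real u - 1)) sums
           (of_real (2 * pi) powr (of_real u - 1) * exp (\<i> * of_real pi * (of_real u - 1) / 2) * hurwitz_zeta (1 - of_real u) (of_real x))"
    and "(\<lambda>k. (\<i> * of_real (- (2 * pi * (x + real k)))) powr (of_real u - 1)) sums
           (of_real (2 * pi) powr (of_real u - 1) * exp (- (\<i> * of_real pi * (of_real u - 1) / 2)) * hurwitz_zeta (1 - of_real u) (of_real x))"
proof -
  have s: "(\<lambda>k. (of_nat k + complex_of_real x) powr (of_real u - 1)) sums hurwitz_zeta (1 - of_real u) (of_real x)"
    using hurwitz_zeta_sums[of "of_real x" "1 - of_real u"] assms by (auto simp: Re_pos_not_nonpos_Ints)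
  have eq: "complex_of_real (2 * pi * (x + real k)) powr z = of_real (2 * pi) powr z * (of_nat k + complex_of_real x) powr z" for k z
  proof -
    have "complex_of_real (2 * pi * (x + real k)) powr z = (of_real (2 * pi) * of_real (x + real k)) powr z" by simp
    also have "\<dots> = of_real (2 * pi) powr z * of_real (x + real k) powr z"
      by (rule powr_times_real_left) auto
    finally show ?thesis by (simp add: add_ac)
  qed
  have p: "2 * pi * (x + real k) > 0" for k using x by simp
  show "(\<lambda>k. (\<i> * of_real (2 * pi * (x + real k))) powr (of_real u - 1)) sums
           (of_real (2 * pi) powr (of_real u - 1) * exp (\<i> * of_real pi * (of_real u - 1) / 2) * hurwitz_zeta (1 - of_real u) (of_real x))"
    using sums_mult[OF s, of "of_real (2 * pi) powr (of_real u - 1) * exp (\<i> * of_real pi * (of_real u - 1) / 2)"]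
    unfolding imaginary_powr(1)[OF p] eq by (simp only: mult_ac)
  show "(\<lambda>k. (\<i> * of_real (- (2 * pi * (x + real k)))) powr (of_real u - 1)) sums
           (of_real (2 * pi) powr (of_real u - 1) * exp (- (\<i> * of_real pi * (of_real u - 1) / 2)) * hurwitz_zeta (1 - of_real u) (of_real x))"
    using sums_mult[OF s, of "of_real (2 * pi) powr (of_real u - 1) * exp (- (\<i> * of_real pi * (of_real u - 1) / 2))"]
    unfolding imaginary_powr(2)[OF p] eq by (simp only: mult_ac)
qed

text \<open>The poles 2 pi i (a + k) above the real axis contribute zeta(1-u,a), those below
  contribute zeta(1-u,1-a). The phases are the powers of - i and i.\<close>

theorem twisted_kernel_integral:
  assumes u: "-1 < u" "u < (0::real)" and a: "0 < a" "a < 1"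
  shows "set_integrable lborel {0<..} (\<lambda>t. of_real (t powr (u - 1)) * (twisted_kernel a t - twisted_kernel a 0))"
    and "(LINT t:{0<..}|lborel. of_real (t powr (u - 1)) * (twisted_kernel a t - twisted_kernel a 0)) =
      of_real (pi / sin (pi * u)) * of_real (2 * pi) powr (of_real u - 1) *
      (exp (- (\<i> * of_real pi * (of_real u - 1) / 2)) * hurwitz_zeta (1 - of_real u) (of_real a)
       + exp (\<i> * of_real pi * (of_real u - 1) / 2) * hurwitz_zeta (1 - of_real u) (of_real (1 - a)))"
proof -
  define c where "c = (\<lambda>k::nat. - (2 * pi * (a + real k)))"
  define d where "d = (\<lambda>k::nat. 2 * pi * (1 - a + real k))"
  have ya: "\<bar>c k\<bar> = 2 * pi * (a + real k)" "\<bar>d k\<bar> = 2 * pi * (1 - a + real k)" for k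
    using a by (auto simp: c_def d_def abs_mult)
  have a1: "1 - a > 0" using a by simp
  note C = pole_term_sum_integral[OF u a(1) ya(1)]
  note D = pole_term_sum_integral[OF u a1 ya(2)]
  have nz: "c k \<noteq> 0" "d k \<noteq> 0" for k
  proof -
    have "2 * pi * (a + real k) > 0" "2 * pi * (1 - a + real k) > 0" using a by auto
    thus "c k \<noteq> 0" "d k \<noteq> 0" by (auto simp: c_def d_def)
  qed
  have eq: "of_real (t powr (u - 1)) * (twisted_kernel a t - twisted_kernel a 0) =
     (\<Sum>k. pole_term u (c k) t) + (\<Sum>k. pole_term u (d k) t)" if "t \<in> {0<..}" for t
  proof -
    have t: "t > 0" using that by simp
    have "(\<lambda>k. of_real (t powr (u - 1)) * (- of_real t / (- (2 * of_real pi * \<i> * of_real (a + real k)) * (of_real t + - (2 * of_real pi * \<i> * of_real (a + real k))))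
        - of_real t / (2 * of_real pi * \<i> * of_real (1 - a + real k) * (of_real t + 2 * of_real pi * \<i> * of_real (1 - a + real k)))))
       sums (of_real (t powr (u - 1)) * (twisted_kernel a t - twisted_kernel a 0))"
      by (rule sums_mult[OF twisted_kernel_partial_fractions[OF a]])
    also have "(\<lambda>k. of_real (t powr (u - 1)) * (- of_real t / (- (2 * of_real pi * \<i> * of_real (a + real k)) * (of_real t + - (2 * of_real pi * \<i> * of_real (a + real k))))
        - of_real t / (2 * of_real pi * \<i> * of_real (1 - a + real k) * (of_real t + 2 * of_real pi * \<i> * of_real (1 - a + real k)))))
       = (\<lambda>k. pole_term u (c k) t + pole_term u (d k) t)"
    proof
      fix k
      have 1: "- (2 * of_real pi * \<i> * of_real (a + real k)) = \<i> * of_real (c k)"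
        "2 * of_real pi * \<i> * of_real (1 - a + real k) = \<i> * of_real (d k)" by (simp_all add: c_def d_def)
      show "of_real (t powr (u - 1)) * (- of_real t / (- (2 * of_real pi * \<i> * of_real (a + real k)) * (of_real t + - (2 * of_real pi * \<i> * of_real (a + real k))))
        - of_real t / (2 * of_real pi * \<i> * of_real (1 - a + real k) * (of_real t + 2 * of_real pi * \<i> * of_real (1 - a + real k))))
        = pole_term u (c k) t + pole_term u (d k) t"
        unfolding 1 pole_term_def by (simp only: diff_conv_add_uminus distrib_left minus_divide_left)
    qed
    finally have "(\<lambda>k. pole_term u (c k) t + pole_term u (d k) t) sums (of_real (t powr (u - 1)) * (twisted_kernel a t - twisted_kernel a 0))" .
    from sums_unique[OF this] suminf_add[OF C(3)[OF t] D(3)[OF t]] show ?thesis by simp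
  qed
  have "set_integrable lborel {0<..} (\<lambda>t. (\<Sum>k. pole_term u (c k) t) + (\<Sum>k. pole_term u (d k) t))"
    by (rule set_integral_add(1)[OF C(1) D(1)])
  thus "set_integrable lborel {0<..} (\<lambda>t. of_real (t powr (u - 1)) * (twisted_kernel a t - twisted_kernel a 0))"
    by (subst set_integrable_cong[OF refl refl eq])
  have "(\<lambda>k. (\<i> * of_real (c k)) powr (of_real u - 1) * of_real (pi / sin (pi * u))) sums (LINT t:{0<..}|lborel. (\<Sum>k. pole_term u (c k) t))"
    using C(2) unfolding pole_term_integral(2)[OF u nz(1)] .
  hence c: "(LINT t:{0<..}|lborel. (\<Sum>k. pole_term u (c k) t)) = of_real (2 * pi) powr (of_real u - 1) * exp (- (\<i> * of_real pi * (of_real u - 1) / 2)) * hurwitz_zeta (1 - of_real u) (of_real a) * of_real (pi / sin (pi * u))"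
    using sums_mult2[OF imaginary_lattice_powr_sums(2)[OF a(1) u(2)]] unfolding c_def by (rule sums_unique2)
  have "(\<lambda>k. (\<i> * of_real (d k)) powr (of_real u - 1) * of_real (pi / sin (pi * u))) sums (LINT t:{0<..}|lborel. (\<Sum>k. pole_term u (d k) t))"
    using D(2) unfolding pole_term_integral(2)[OF u nz(2)] .
  hence d: "(LINT t:{0<..}|lborel. (\<Sum>k. pole_term u (d k) t)) = of_real (2 * pi) powr (of_real u - 1) * exp (\<i> * of_real pi * (of_real u - 1) / 2) * hurwitz_zeta (1 - of_real u) (of_real (1 - a)) * of_real (pi / sin (pi * u))"
    using sums_mult2[OF imaginary_lattice_powr_sums(1)[OF a1 u(2)]] unfolding d_def by (rule sums_unique2)
  have "(LINT t:{0<..}|lborel. of_real (t powr (u - 1)) * (twisted_kernel a t - twisted_kernel a 0)) =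
     (LINT t:{0<..}|lborel. (\<Sum>k. pole_term u (c k) t) + (\<Sum>k. pole_term u (d k) t))"
    by (rule set_lebesgue_integral_cong) (use eq in auto)
  also have "\<dots> = (LINT t:{0<..}|lborel. (\<Sum>k. pole_term u (c k) t)) + (LINT t:{0<..}|lborel. (\<Sum>k. pole_term u (d k) t))"
    by (rule set_integral_add(2)[OF C(1) D(1)])
  finally show "(LINT t:{0<..}|lborel. of_real (t powr (u - 1)) * (twisted_kernel a t - twisted_kernel a 0)) =
      of_real (pi / sin (pi * u)) * of_real (2 * pi) powr (of_real u - 1) *
      (exp (- (\<i> * of_real pi * (of_real u - 1) / 2)) * hurwitz_zeta (1 - of_real u) (of_real a)
       + exp (\<i> * of_real pi * (of_real u - 1) / 2) * hurwitz_zeta (1 - of_real u) (of_real (1 - a)))"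
    unfolding c d by (simp only: ring_distribs mult_ac)
qed

section \<open>The kernel with its constant cut off at t = 1\<close>

lemma set_lebesgue_integral_has_integral_nonneg:
  fixes f :: "real \<Rightarrow> real"
  assumes "(f has_integral I) S" "continuous_on S f" "S \<in> sets borel" "\<And>x. x \<in> S \<Longrightarrow> 0 \<le> f x"
  shows "set_integrable lborel S f" "(LINT t:S|lborel. f t) = I"
proof -
  have "f absolutely_integrable_on S"
    by (rule nonnegative_absolutely_integrable_1) (use assms in \<open>auto intro: has_integral_integrable\<close>)
  thus 1: "set_integrable lborel S f"
    by (subst set_integrable_lborel_iff_absolutely_integrable_on) (use assms in auto)
  show "(LINT t:S|lborel. f t) = I"
    using set_borel_integral_eq_integral(2)[OF 1] integral_unique[OF assms(1)] by simp
qed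

lemma set_integral_restrict_subset:
  fixes f :: "real \<Rightarrow> complex"
  assumes "B \<subseteq> A"
  shows "set_integrable lborel A (\<lambda>t. f t * (if t \<in> B then 1 else 0)) \<longleftrightarrow> set_integrable lborel B f"
    and "(LINT t:A|lborel. f t * (if t \<in> B then 1 else 0)) = (LINT t:B|lborel. f t)"
proof -
  have eq: "(\<lambda>t. indicator A t *\<^sub>R (f t * (if t \<in> B then 1 else 0))) = (\<lambda>t. indicator B t *\<^sub>R f t)"
    using assms by (auto simp: indicator_def fun_eq_iff)
  show "set_integrable lborel A (\<lambda>t. f t * (if t \<in> B then 1 else 0)) \<longleftrightarrow> set_integrable lborel B f"
    unfolding set_integrable_def eq ..
  show "(LINT t:A|lborel. f t * (if t \<in> B then 1 else 0)) = (LINT t:B|lborel. f t)"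
    unfolding set_lebesgue_integral_def eq ..
qed

lemma set_integrable_complex_of_real:
  fixes f :: "real \<Rightarrow> real"
  assumes "set_integrable M A f"
  shows "set_integrable M A (\<lambda>t. complex_of_real (f t))"
proof -
  have "integrable M (\<lambda>t. complex_of_real (indicator A t *\<^sub>R f t))"
    by (rule integrable_bounded_linear[OF bounded_linear_of_real assms[unfolded set_integrable_def]])
  thus ?thesis by (simp add: set_integrable_def scaleR_conv_of_real)
qed

lemma powr_integral_unit_interval:
  assumes "u > (0::real)"
  shows "set_integrable lborel {0<..} (\<lambda>t. complex_of_real (t powr (u - 1)) * (if t \<in> {0<..<1} then 1 else 0))"
    and "(LINT t:{0<..}|lborel. complex_of_real (t powr (u - 1)) * (if t \<in> {0<..<1} then 1 else 0)) = of_real (1 / u)"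
proof -
  have h: "((\<lambda>x. x powr (u - 1)) has_integral 1 / u) {0<..<1::real}"
    using has_integral_powr_from_0[of "u - 1" 1] assms by (simp add: has_integral_Icc_iff_Ioo)
  have c: "continuous_on {0<..<1::real} (\<lambda>x. x powr (u - 1))" by (auto intro!: continuous_intros)
  note * = set_lebesgue_integral_has_integral_nonneg[OF h c]
  have sub: "{0<..<1::real} \<subseteq> {0<..}" by auto
  show "set_integrable lborel {0<..} (\<lambda>t. complex_of_real (t powr (u - 1)) * (if t \<in> {0<..<1} then 1 else 0))"
    unfolding set_integral_restrict_subset[OF sub] using set_integrable_complex_of_real[OF *(1)] by simp
  show "(LINT t:{0<..}|lborel. complex_of_real (t powr (u - 1)) * (if t \<in> {0<..<1} then 1 else 0)) = of_real (1 / u)"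
    unfolding set_integral_restrict_subset[OF sub] set_integral_complex_of_real using *(2) by simp
qed

lemma powr_integral_ge_1:
  assumes "u < (0::real)"
  shows "set_integrable lborel {0<..} (\<lambda>t. complex_of_real (t powr (u - 1)) * (if t \<in> {1..} then 1 else 0))"
    and "(LINT t:{0<..}|lborel. complex_of_real (t powr (u - 1)) * (if t \<in> {1..} then 1 else 0)) = - of_real (1 / u)"
proof -
  have h: "((\<lambda>x. x powr (u - 1)) has_integral - (1 / u)) {1::real..}"
    using has_integral_powr_to_inf[of "u - 1" 1] assms by simp
  have c: "continuous_on {1::real..} (\<lambda>x. x powr (u - 1))" by (auto intro!: continuous_intros)
  note * = set_lebesgue_integral_has_integral_nonneg[OF h c]
  have sub: "{1::real..} \<subseteq> {0<..}" by auto
  show "set_integrable lborel {0<..} (\<lambda>t. complex_of_real (t powr (u - 1)) * (if t \<in> {1..} then 1 else 0))"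
    unfolding set_integral_restrict_subset[OF sub] using set_integrable_complex_of_real[OF *(1)] by simp
  show "(LINT t:{0<..}|lborel. complex_of_real (t powr (u - 1)) * (if t \<in> {1..} then 1 else 0)) = - of_real (1 / u)"
    unfolding set_integral_restrict_subset[OF sub] set_integral_complex_of_real using *(2) by simp
qed

text \<open>Cutting the constant off at \<open>t = 1\<close> makes the Mellin integral converge for \<open>Re u > -1\<close>. The part
  that is cut off contributes \<open>twisted_kernel a 0 / u\<close> both for \<open>u > 0\<close> and for \<open>u < 0\<close>, which is why
  the two half planes can be compared.\<close>

definition twisted_kernel_reg :: "real \<Rightarrow> real \<Rightarrow> complex" where
  "twisted_kernel_reg a t = twisted_kernel a t - twisted_kernel a 0 * (if t \<in> {0<..<1} then 1 else 0)"

text \<open>With x = exp t >= 1 and \<omega> = exp (2 pi i a) the left norm is |x - \<omega>|. Among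
  the points of the ray from 1 to infinity, 1 is nearest to any point of the unit circle.\<close>

lemma norm_exp_minus_ge:
  assumes "t \<ge> (0::real)"
  shows "norm (exp (of_real t - 2 * of_real pi * \<i> * of_real a) - 1) \<ge> norm (1 - exp (2 * of_real pi * \<i> * of_real a))"
proof -
  define \<omega> where "\<omega> = exp (2 * of_real pi * \<i> * complex_of_real a)"
  define x where "x = exp t"
  have x: "x \<ge> 1" using assms by (simp add: x_def)
  have n1: "norm \<omega> = 1" by (simp add: \<omega>_def norm_exp_eq_Re)
  have "exp (of_real t - 2 * of_real pi * \<i> * of_real a) - 1 = (of_real x - \<omega>) / \<omega>"
    by (simp add: \<omega>_def x_def exp_diff exp_of_real diff_divide_distrib)
  hence "norm (exp (of_real t - 2 * of_real pi * \<i> * of_real a) - 1) = norm (of_real x - \<omega>)"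
    using n1 by (simp add: norm_divide)
  also have "norm (1 - \<omega>) \<le> norm (of_real x - \<omega>)"
  proof (rule power2_le_imp_le)
    have s: "(Re \<omega>)\<^sup>2 + (Im \<omega>)\<^sup>2 = 1" using n1 by (simp add: cmod_def real_sqrt_eq_1_iff)
    have "Re \<omega> \<le> 1" using complex_Re_le_cmod[of \<omega>] n1 by simp
    hence "0 \<le> (x - 1) * (x - 1) + 2 * (x - 1) * (1 - Re \<omega>)" using x by (intro add_nonneg_nonneg mult_nonneg_nonneg) auto
    thus "(norm (1 - \<omega>))\<^sup>2 \<le> (norm (of_real x - \<omega>))\<^sup>2"
      using s by (simp add: cmod_power2) (simp add: power2_eq_square algebra_simps)
  qed auto
  finally show ?thesis by (simp add: \<omega>_def)
qed

lemma exp_2pi_i_neq_1: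
  assumes "0 < a" "a < 1"
  shows "exp (2 * of_real pi * \<i> * of_real a) \<noteq> 1"
proof
  assume "exp (2 * of_real pi * \<i> * of_real a) = 1"
  then obtain n :: int where "2 * pi * a = of_int (2 * n) * pi" by (auto simp: exp_eq_1)
  hence "a = of_int n" by simp
  thus False using assms by simp
qed

text \<open>On (0,1) the difference of the kernel and its value at 0 vanishes to first order; beyond
  1 the kernel decays like exp(-t). The single factor t is what opens the half plane Re u >
  -1.\<close>

lemma twisted_kernel_reg_bound:
  assumes a: "0 < a" "a < 1"
  shows "\<exists>C. \<forall>t>0. norm (twisted_kernel_reg a t) \<le> C * t powr 1 * exp (- 1 * t)"
proof -
  define E where "E = (\<lambda>t. exp (of_real t - 2 * of_real pi * \<i> * of_real a) - 1 :: complex)"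
  define \<delta> where "\<delta> = norm (1 - exp (2 * of_real pi * \<i> * of_real a))"
  have \<delta>: "\<delta> > 0" using exp_2pi_i_neq_1[OF a] by (simp add: \<delta>_def)
  have E: "norm (E t) \<ge> \<delta>" if "t \<ge> 0" for t using norm_exp_minus_ge[OF that] by (simp add: E_def \<delta>_def)
  have tk: "twisted_kernel a t = 1 / E t" for t by (simp add: twisted_kernel_def E_def)
  \<comment> \<open>The factor exp 1 compensates exp(-t), which is at least exp(-1) on this
    interval.\<close>
  have small: "norm (twisted_kernel_reg a t) \<le> 2 * exp 1 / \<delta>\<^sup>2 * t * exp (- t)" if "0 < t" "t < 1" for t
  proof -
    have nz: "E t \<noteq> 0" "E 0 \<noteq> 0" using E[of t] E[of 0] \<delta> that by auto
    have "twisted_kernel_reg a t = (E 0 - E t) / (E t * E 0)"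
      using that nz by (simp add: twisted_kernel_reg_def tk field_simps)
    moreover have "norm (E 0 - E t) = exp t - 1"
    proof -
      have "E 0 - E t = of_real (1 - exp t) * exp (- (2 * of_real pi * \<i> * of_real a))"
        by (simp add: E_def exp_diff exp_minus exp_of_real field_simps)
      thus ?thesis using that by (simp add: norm_mult norm_exp_eq_Re del: of_real_diff)
    qed
    ultimately have "norm (twisted_kernel_reg a t) = (exp t - 1) / (norm (E t) * norm (E 0))"
      by (simp add: norm_divide norm_mult)
    also have "\<dots> \<le> (exp t - 1) / (\<delta> * \<delta>)"
    proof -
      have "norm (E t) > 0" "norm (E 0) > 0" using nz by auto
      thus ?thesis using E[of t] E[of 0] \<delta> that by (intro divide_left_mono mult_mono mult_pos_pos) auto
    qed
    also have "exp t - 1 \<le> 2 * t" using exp_bound[of t] that by (simp add: power2_eq_square mult_left_le algebra_simps) (smt (verit) mult_left_le)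
    also have "2 * t \<le> 2 * t * (exp 1 * exp (- t))"
      using that by (simp add: exp_add[symmetric])
    finally show ?thesis using \<delta> by (simp add: divide_right_mono power2_eq_square mult_ac)
  qed
  have large: "norm (twisted_kernel_reg a t) \<le> 2 * t * exp (- t)" if "t \<ge> 1" for t
  proof -
    have "norm (E t) \<ge> exp t - 1"
      using norm_triangle_ineq2[of "exp (of_real t - 2 * of_real pi * \<i> * of_real a)" 1] by (simp add: E_def norm_exp_eq_Re)
    moreover have "exp t \<ge> 2" using exp_ge_add_one_self[of t] that by linarith
    ultimately have "norm (E t) \<ge> exp t / 2" by simp
    hence "1 / norm (E t) \<le> 1 / (exp t / 2)" by (intro divide_left_mono) (auto intro!: mult_pos_pos elim: less_le_trans[rotated])
    also have "\<dots> = 2 * 1 * exp (- t)" by (simp add: exp_minus field_simps)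
    also have "\<dots> \<le> 2 * t * exp (- t)" using that by (intro mult_right_mono) auto
    finally show ?thesis using that by (simp add: twisted_kernel_reg_def tk norm_divide)
  qed
  define C where "C = 2 * exp 1 / \<delta>\<^sup>2 + 2"
  have "norm (twisted_kernel_reg a t) \<le> C * t powr 1 * exp (- 1 * t)" if "t > 0" for t
  proof (cases "t < 1")
    case True
    have "2 * exp 1 / \<delta>\<^sup>2 * t * exp (- t) \<le> C * t * exp (- t)" unfolding C_def using that by (intro mult_right_mono) auto
    with small[OF that True] that show ?thesis by simp
  next
    case False
    have "2 * t * exp (- t) \<le> C * t * exp (- t)" unfolding C_def using that \<delta> by (intro mult_right_mono) auto
    from order.trans[OF large this] False that show ?thesis by simp
  qed
  thus ?thesis by blast
qed

lemma continuous_on_twisted_kernel: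
  assumes a: "0 < a" "a < 1"
  shows "continuous_on {0<..} (twisted_kernel a)"
proof -
  have "exp (of_real t - 2 * of_real pi * \<i> * of_real a) - 1 \<noteq> 0" if "t > 0" for t
    using norm_exp_minus_ge[of t a] exp_2pi_i_neq_1[OF a] that by (metis less_imp_le norm_le_zero_iff norm_zero right_minus_eq)
  thus ?thesis unfolding twisted_kernel_def[abs_def] by (auto intro!: continuous_intros)
qed

lemma twisted_kernel_reg_measurable:
  assumes a: "0 < a" "a < 1"
  shows "set_borel_measurable lborel {0<..} (twisted_kernel_reg a)"
proof -
  have "(\<lambda>t. indicator {0<..} t *\<^sub>R twisted_kernel a t) \<in> borel_measurable borel"
    by (rule borel_measurable_continuous_on_indicator[OF _ continuous_on_twisted_kernel[OF a]]) auto
  hence "(\<lambda>t. indicator {0<..} t *\<^sub>R twisted_kernel a t - twisted_kernel a 0 * indicator {0<..<1} t) \<in> borel_measurable borel"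
    by measurable
  also have "(\<lambda>t. indicator {0<..} t *\<^sub>R twisted_kernel a t - twisted_kernel a 0 * indicator {0<..<1} t) =
    (\<lambda>t. indicator {0<..} t *\<^sub>R twisted_kernel_reg a t)"
    by (auto simp: twisted_kernel_reg_def indicator_def fun_eq_iff)
  finally show ?thesis by (simp add: set_borel_measurable_def)
qed

section \<open>The functional equation at rational parameters\<close>

definition unity_root_angle :: "nat \<Rightarrow> nat \<Rightarrow> nat \<Rightarrow> real" where
  "unity_root_angle m r l = 2 * pi * real r * real l / real m"

abbreviation (input) "cosr m r l \<equiv> cos (unity_root_angle m r l)"
abbreviation (input) "sinr m r l \<equiv> sin (unity_root_angle m r l)"
abbreviation (input) "lnGamma_frac m l \<equiv> ln (Gamma (real l / real m))"
abbreviation (input) "lnsin_frac m l \<equiv> ln (sin (pi * real l / real m))"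
abbreviation (input) "zeta2_frac m l \<equiv> hurwitz_zeta_deriv2_0 (of_nat l / of_nat m)"

text \<open>For Re u > 1 this is the series over n >= 1 of exp (2 pi i r n / m) n powr (- u),
  grouped by residue classes modulo m. The class of 0 is represented by l = m so that all parameters
  l / m are positive.\<close>

definition twisted_zeta :: "nat \<Rightarrow> nat \<Rightarrow> complex \<Rightarrow> complex" where
  "twisted_zeta m r u = of_nat m powr (-u) *
     (\<Sum>l=1..m. exp (\<i> * of_real (unity_root_angle m r l)) * hurwitz_zeta u (of_nat l / of_nat m))"

lemma hurwitz_rational_Mellin:
  assumes u: "Re u > 1" and m: "m > (0::nat)" and l: "l > (0::nat)"
  shows "(LINT t:{0<..}|lborel. of_real t powr (u - 1) * (exp (- of_nat l * of_real t) * of_real (1 / (1 - exp (- real m * t)))))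
     = Gamma u * of_nat m powr (-u) * hurwitz_zeta u (of_nat l / of_nat m)"
proof -
  have h: "(of_nat l + of_real (real m) * of_nat n) powr (-u) = of_nat m powr (-u) * (of_nat n + of_nat l / of_nat m) powr (-u)" for n
  proof -
    have "(of_nat l + of_real (real m) * of_nat n) = complex_of_real (real m) * (of_nat n + of_nat l / of_nat m)"
      using m by (simp add: field_simps)
    also have "\<dots> powr (-u) = complex_of_real (real m) powr (-u) * (of_nat n + of_nat l / of_nat m) powr (-u)"
      by (rule powr_times_real_left) auto
    finally show ?thesis by simp
  qed
  have "(of_nat l / of_nat m :: complex) \<notin> \<int>\<^sub>\<le>\<^sub>0" using m l by (intro Re_pos_not_nonpos_Ints) simp
  hence "(\<lambda>n. Gamma u * of_nat m powr (-u) * (of_nat n + of_nat l / of_nat m) powr (-u)) sums (Gamma u * of_nat m powr (-u) * hurwitz_zeta u (of_nat l / of_nat m))"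
    by (intro sums_mult hurwitz_zeta_sums u)
  moreover have "(\<lambda>n. Gamma u * (of_nat l + of_real (real m) * of_nat n) powr (-u)) sums
     (LINT t:{0<..}|lborel. of_real t powr (u - 1) * (exp (- of_nat l * of_real t) * of_real (1 / (1 - exp (- real m * t)))))"
    by (rule exp_lattice_sum_sums_Mellin) (use u m l in auto)
  ultimately show ?thesis unfolding h mult.assoc[of "Gamma u"] by (rule sums_unique2[rotated])
qed

text \<open>A geometric sum in x = exp (2 pi i r / m - t). As r is an integer, x ^ m is exp (- m *
  t), and the factor 1 - x ^ m of the sum cancels the denominator.\<close>

lemma twisted_kernel_rational:
  assumes m: "m > 0" and t: "t > (0::real)"
  shows "(\<Sum>l=1..m. exp (\<i> * of_real (unity_root_angle m r l)) * (exp (- of_nat l * of_real t) * of_real (1 / (1 - exp (- real m * t))))) =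
     twisted_kernel (real r / real m) t"
proof -
  define x where "x = exp (2 * of_real pi * \<i> * of_real (real r / real m) - complex_of_real t)"
  have nx: "norm x < 1" using t by (simp add: x_def norm_exp_eq_Re)
  have x1: "x \<noteq> 1" using nx by auto
  have x0: "x \<noteq> 0" by (simp add: x_def)
  have pw: "exp (\<i> * of_real (unity_root_angle m r l)) * exp (- of_nat l * of_real t) = x ^ l" for l
    unfolding x_def unity_root_angle_def exp_of_nat_mult[symmetric] exp_add[symmetric]
    by (rule arg_cong[of _ _ exp]) (simp add: algebra_simps)
  have "x ^ m = exp (of_int (2 * int r) * (of_real pi * \<i>) - of_nat m * complex_of_real t)"
    unfolding x_def exp_of_nat_mult[symmetric] using m by (intro arg_cong[of _ _ exp]) (simp add: field_simps)
  also have "\<dots> = exp (of_int (2 * int r) * (of_real pi * \<i>)) * exp (- of_nat m * complex_of_real t)" by (simp add: exp_diff exp_minus divide_inverse)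
  also have "exp (of_int (2 * int r) * (of_real pi * \<i>)) = 1" by (subst exp_eq_1) (auto intro: exI[of _ "int r"])
  finally have xm: "x ^ m = of_real (exp (- real m * t))" by (simp add: exp_of_real[symmetric])
  have "complex_of_real (exp (- real m * t)) \<noteq> 1" using m t by (simp del: of_real_exp add: of_real_eq_1_iff)
  hence w: "1 - complex_of_real (exp (- real m * t)) \<noteq> 0" by simp
  have "(\<Sum>l=1..m. x ^ l) = x * (1 - x ^ m) / (1 - x)"
    using x1 by (subst sum_gp) (use m in \<open>auto simp: field_simps\<close>)
  hence "(\<Sum>l=1..m. x ^ l) * of_real (1 / (1 - exp (- real m * t))) = x / (1 - x)"
    using w x1 unfolding xm by simp
  also have "x / (1 - x) = 1 / (1 / x - 1)" using x0 x1 by (simp add: field_simps)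
  also have "1 / x = exp (of_real t - 2 * of_real pi * \<i> * of_real (real r / real m))"
    unfolding x_def by (simp add: exp_diff)
  finally show ?thesis unfolding twisted_kernel_def pw[symmetric] by (simp only: sum_distrib_right mult.assoc)
qed

context
  fixes m r :: nat and a :: real
  assumes mr: "r \<in> {1..m - 1}" "m \<ge> 2"
  defines "a \<equiv> real r / real m"
begin

lemma rational_in_unit_interval: "0 < a" "a < 1"
  using mr by (auto simp: a_def)

lemma twisted_zeta_Mellin:
  assumes u: "Re u > 1"
  shows "set_integrable lborel {0<..} (\<lambda>t. of_real t powr (u - 1) * twisted_kernel a t)"
    and "(LINT t:{0<..}|lborel. of_real t powr (u - 1) * twisted_kernel a t) = Gamma u * twisted_zeta m r u"
proof -
  define g where "g = (\<lambda>l::nat. \<lambda>t::real. of_real t powr (u - 1) * (exp (- of_nat l * of_real t) * of_real (1 / (1 - exp (- real m * t)))))"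
  define \<omega> where "\<omega> = (\<lambda>l. exp (\<i> * of_real (unity_root_angle m r l)))"
  have m: "m > 0" using mr by auto
  have i: "set_integrable lborel {0<..} (\<lambda>t. \<omega> l * g l t)" if "l \<in> {1..m}" for l
    unfolding g_def using u m that by (intro set_integrable_mult_right set_integrable_exp_lattice) auto
  have eq: "of_real t powr (u - 1) * twisted_kernel a t = (\<Sum>l=1..m. \<omega> l * g l t)" if "t \<in> {0<..}" for t
    using twisted_kernel_rational[OF m, of t r, symmetric] that
    by (simp add: a_def \<omega>_def g_def sum_distrib_left mult_ac)
  have "set_integrable lborel {0<..} (\<lambda>t. \<Sum>l=1..m. \<omega> l * g l t)"
    unfolding set_integrable_def scaleR_sum_right
    by (intro Bochner_Integration.integrable_sum i[unfolded set_integrable_def])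
  thus "set_integrable lborel {0<..} (\<lambda>t. of_real t powr (u - 1) * twisted_kernel a t)"
    by (subst set_integrable_cong[OF refl refl eq])
  have "(LINT t:{0<..}|lborel. of_real t powr (u - 1) * twisted_kernel a t) = (LINT t:{0<..}|lborel. (\<Sum>l=1..m. \<omega> l * g l t))"
    by (rule set_lebesgue_integral_cong) (use eq in auto)
  also have "\<dots> = (\<Sum>l=1..m. LINT t:{0<..}|lborel. \<omega> l * g l t)"
    unfolding set_lebesgue_integral_def scaleR_sum_right
    by (intro Bochner_Integration.integral_sum i[unfolded set_integrable_def])
  also have "\<dots> = (\<Sum>l=1..m. \<omega> l * (Gamma u * of_nat m powr (-u) * hurwitz_zeta u (of_nat l / of_nat m)))"
    unfolding g_def by (intro sum.cong refl, subst set_integral_mult_right, subst hurwitz_rational_Mellin[OF u m]) auto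
  finally show "(LINT t:{0<..}|lborel. of_real t powr (u - 1) * twisted_kernel a t) = Gamma u * twisted_zeta m r u"
    by (simp add: twisted_zeta_def \<omega>_def sum_distrib_left mult_ac)
qed

lemma holomorphic_on_twisted_zeta: "1 \<notin> A \<Longrightarrow> twisted_zeta m r holomorphic_on A"
  unfolding twisted_zeta_def[abs_def]
  by (intro holomorphic_intros holomorphic_on_hurwitz_zeta Re_pos_not_nonpos_Ints) (use mr in auto)

definition twisted_Mellin_reg :: "complex \<Rightarrow> complex" where
  "twisted_Mellin_reg u = (LINT t:{0<..}|lborel. of_real t powr (u - 1) * twisted_kernel_reg a t)"

lemma set_integrable_twisted_Mellin_reg:
  assumes "Re u > -1"
  shows "set_integrable lborel {0<..} (\<lambda>t. of_real t powr (u - 1) * twisted_kernel_reg a t)"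
proof -
  obtain C where C: "\<And>t. t > 0 \<Longrightarrow> norm (twisted_kernel_reg a t) \<le> C * t powr 1 * exp (- 1 * t)"
    using twisted_kernel_reg_bound[OF rational_in_unit_interval] by blast
  show ?thesis
    by (rule set_integrable_Mellin[OF twisted_kernel_reg_measurable[OF rational_in_unit_interval] _ C]) (use assms in auto)
qed

lemma holomorphic_on_twisted_Mellin_reg: "twisted_Mellin_reg holomorphic_on {u. Re u > -1}"
proof -
  obtain C where C: "\<And>t. t > 0 \<Longrightarrow> norm (twisted_kernel_reg a t) \<le> C * t powr 1 * exp (- 1 * t)"
    using twisted_kernel_reg_bound[OF rational_in_unit_interval] by blast
  have "(\<lambda>u. LINT t:{0<..}|lborel. complex_of_real t powr (u - 1) * twisted_kernel_reg a t) holomorphic_on {u. Re u > -1}"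
    by (rule holomorphic_on_Mellin[OF twisted_kernel_reg_measurable[OF rational_in_unit_interval] _ C]) auto
  thus ?thesis unfolding twisted_Mellin_reg_def[abs_def] .
qed

text \<open>For real u between 1 and 2 the removed constant integrates to a multiple of 1 / u.
  Because rGamma u / u = rGamma (u + 1), the right-hand side stays regular at u = 0 and the identity
  extends to Re u > -1 without the point 1.\<close>

lemma twisted_zeta_eq:
  assumes u: "Re u > -1" "u \<noteq> 1"
  shows "twisted_zeta m r u = rGamma u * twisted_Mellin_reg u + twisted_kernel a 0 * rGamma (u + 1)"
proof (rule holomorphic_eq_of_eq_on_real_segment[where S = "{u. Re u > -1} - {1}" and a = 1 and b = 2 and
     f = "twisted_zeta m r" and g = "\<lambda>u. rGamma u * twisted_Mellin_reg u + twisted_kernel a 0 * rGamma (u + 1)"])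
  show "connected ({u. Re u > -1} - {1::complex})"
    by (rule connected_open_delete) (auto intro: convex_connected convex_halfspace_Re_gt open_halfspace_Re_gt)
  show "(\<lambda>u. rGamma u * twisted_Mellin_reg u + twisted_kernel a 0 * rGamma (u + 1)) holomorphic_on {u. Re u > -1} - {1}"
    by (intro holomorphic_intros holomorphic_on_subset[OF holomorphic_on_twisted_Mellin_reg]) auto
  fix x :: real assume x: "1 < x" "x < 2"
  define c where "c = twisted_kernel a 0"
  have "(LINT t:{0<..}|lborel. of_real t powr (of_real x - 1) * twisted_kernel a t) =
    (LINT t:{0<..}|lborel. of_real t powr (of_real x - 1) * twisted_kernel_reg a t + c * (complex_of_real (t powr (x - 1)) * (if t \<in> {0<..<1} then 1 else 0)))"
  proof (rule set_lebesgue_integral_cong, simp, intro allI impI)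
    fix t :: real assume "t \<in> {0<..}"
    hence p: "complex_of_real t powr (of_real x - 1) = of_real (t powr (x - 1))" by (simp add: powr_of_real[symmetric])
    show "of_real t powr (of_real x - 1) * twisted_kernel a t =
      of_real t powr (of_real x - 1) * twisted_kernel_reg a t + c * (complex_of_real (t powr (x - 1)) * (if t \<in> {0<..<1} then 1 else 0))"
      unfolding p twisted_kernel_reg_def c_def by (simp add: algebra_simps)
  qed
  also have "\<dots> = twisted_Mellin_reg (of_real x) + c * of_real (1 / x)"
    using x unfolding twisted_Mellin_reg_def
    by (subst set_integral_add(2)) (auto simp: powr_integral_unit_interval intro!: set_integrable_twisted_Mellin_reg set_integrable_mult_right simp del: greaterThanLessThan_iff)
  finally have eq: "Gamma (of_real x) * twisted_zeta m r (of_real x) = twisted_Mellin_reg (of_real x) + c * of_real (1 / x)"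
    using twisted_zeta_Mellin(2)[of "of_real x"] x by simp
  have G: "Gamma (complex_of_real x) \<noteq> 0" using x by (auto simp: Gamma_eq_zero_iff dest!: nonpos_Ints_Re_nonpos)
  have "twisted_zeta m r (of_real x) = rGamma (of_real x) * (Gamma (of_real x) * twisted_zeta m r (of_real x))"
    using G by (simp add: rGamma_inverse_Gamma)
  also have "\<dots> = rGamma (of_real x) * twisted_Mellin_reg (of_real x) + c * (rGamma (of_real x) * of_real (1 / x))"
    unfolding eq by (simp add: algebra_simps)
  also have "rGamma (of_real x) * of_real (1 / x) = rGamma (complex_of_real x + 1)"
    using rGamma_plus1[of "complex_of_real x"] x by (simp add: field_simps)
  finally show "twisted_zeta m r (of_real x) = rGamma (of_real x) * twisted_Mellin_reg (of_real x) + twisted_kernel a 0 * rGamma (complex_of_real x + 1)"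
    by (simp add: c_def)
qed (use u in \<open>auto intro!: holomorphic_on_twisted_zeta open_Diff open_halfspace_Re_gt\<close>)

text \<open>For u < 0 the constant is subtracted on the whole half line. The excess over the cut-off
  version lives on t >= 1 and contributes \<open>twisted_kernel a 0\<close> / u, the same term that
  \<open>twisted_zeta_eq\<close> contains. So the integral of the partial fractions equals the
  continued Mellin transform.\<close>

lemma twisted_zeta_functional_equation:
  assumes u: "-1 < u" "u < (0::real)"
  shows "Gamma (of_real u) * twisted_zeta m r (of_real u) =
    of_real (pi / sin (pi * u)) * of_real (2 * pi) powr (of_real u - 1) *
      (exp (- (\<i> * of_real pi * (of_real u - 1) / 2)) * hurwitz_zeta (1 - of_real u) (of_real a)
       + exp (\<i> * of_real pi * (of_real u - 1) / 2) * hurwitz_zeta (1 - of_real u) (of_real (1 - a)))"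
proof -
  define c where "c = twisted_kernel a 0"
  have "(LINT t:{0<..}|lborel. of_real (t powr (u - 1)) * (twisted_kernel a t - twisted_kernel a 0)) =
    (LINT t:{0<..}|lborel. of_real t powr (of_real u - 1) * twisted_kernel_reg a t + (- c) * (complex_of_real (t powr (u - 1)) * (if t \<in> {1..} then 1 else 0)))"
  proof (rule set_lebesgue_integral_cong, simp, intro allI impI)
    fix t :: real assume "t \<in> {0<..}"
    hence p: "complex_of_real t powr (of_real u - 1) = of_real (t powr (u - 1))" and t: "t > 0" by (simp_all add: powr_of_real[symmetric])
    show "of_real (t powr (u - 1)) * (twisted_kernel a t - twisted_kernel a 0) =
      of_real t powr (of_real u - 1) * twisted_kernel_reg a t + (- c) * (complex_of_real (t powr (u - 1)) * (if t \<in> {1..} then 1 else 0))"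
      using t unfolding p twisted_kernel_reg_def c_def by (simp add: algebra_simps)
  qed
  also have "\<dots> = twisted_Mellin_reg (of_real u) + (- c) * (- of_real (1 / u))"
  proof -
    have i: "set_integrable lborel {0<..} (\<lambda>t. of_real t powr (of_real u - 1) * twisted_kernel_reg a t)"
      by (rule set_integrable_twisted_Mellin_reg) (use u in auto)
    have j: "set_integrable lborel {0<..} (\<lambda>t. (- c) * (complex_of_real (t powr (u - 1)) * (if t \<in> {1..} then 1 else 0)))"
      by (intro set_integrable_mult_right powr_integral_ge_1(1)[OF u(2)])
    show ?thesis
      unfolding set_integral_add(2)[OF i j] set_integral_mult_right powr_integral_ge_1(2)[OF u(2)] twisted_Mellin_reg_def ..
  qed
  finally have eq: "(LINT t:{0<..}|lborel. of_real (t powr (u - 1)) * (twisted_kernel a t - twisted_kernel a 0)) =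
    twisted_Mellin_reg (of_real u) + c * of_real (1 / u)" by simp
  have ni: "complex_of_real u \<notin> \<int>\<^sub>\<le>\<^sub>0"
  proof
    assume "complex_of_real u \<in> \<int>\<^sub>\<le>\<^sub>0"
    then obtain n where "complex_of_real u = of_int n" by (rule nonpos_Ints_cases)
    hence "u = of_int n" by (metis of_real_eq_iff of_real_of_int_eq)
    thus False using u by simp
  qed
  hence G: "Gamma (complex_of_real u) \<noteq> 0" by (simp add: Gamma_eq_zero_iff)
  have "rGamma (complex_of_real u + 1) = rGamma (of_real u) * of_real (1 / u)"
    using rGamma_plus1[of "complex_of_real u"] u by (simp add: field_simps)
  hence "twisted_zeta m r (of_real u) = rGamma (of_real u) * (twisted_Mellin_reg (of_real u) + c * of_real (1 / u))"
    using u by (subst twisted_zeta_eq) (auto simp: c_def algebra_simps)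
  hence "Gamma (of_real u) * twisted_zeta m r (of_real u) = twisted_Mellin_reg (of_real u) + c * of_real (1 / u)"
    using G by (simp add: rGamma_inverse_Gamma)
  thus ?thesis using eq twisted_kernel_integral(2)[OF u rational_in_unit_interval] by simp
qed

end

text \<open>Passing from r to m - r conjugates the roots of unity; this is the second linear
  equation for the two unknown zeta values.\<close>

lemma twisted_zeta_reflect:
  assumes "r \<le> m" "m > 0"
  shows "twisted_zeta m (m - r) u = of_nat m powr (-u) *
     (\<Sum>l=1..m. exp (- (\<i> * of_real (unity_root_angle m r l))) * hurwitz_zeta u (of_nat l / of_nat m))"
proof -
  have "exp (\<i> * of_real (unity_root_angle m (m - r) l)) = exp (- (\<i> * of_real (unity_root_angle m r l)))" for l
  proof -
    have "\<i> * of_real (unity_root_angle m (m - r) l) = of_int (2 * int l) * (of_real pi * \<i>) + - (\<i> * complex_of_real (unity_root_angle m r l))"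
      using assms by (simp add: unity_root_angle_def field_simps of_nat_diff)
    also have "exp \<dots> = exp (of_int (2 * int l) * (of_real pi * \<i>)) * exp (- (\<i> * complex_of_real (unity_root_angle m r l)))"
      by (rule exp_add)
    also have "exp (of_int (2 * int l) * (of_real pi * \<i>)) = 1" by (subst exp_eq_1) (auto intro: exI[of _ "int l"])
    finally show ?thesis by simp
  qed
  thus ?thesis by (simp add: twisted_zeta_def)
qed

text \<open>For real u between -1 and 0 the equations for r and m - r are combined so that
  zeta(1-u,1-r/m) cancels. After multiplication by u both sides are holomorphic on the unit disc, so
  the identity theorem carries the formula to the neighbourhood of 0 where it is expanded.\<close>

theorem hurwitz_functional_equation_rational:
  assumes mr: "r \<in> {1..m - 1}" "m \<ge> 2" and u: "u \<in> ball 0 1"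
  shows "u * hurwitz_reg (of_nat r / of_nat m) (1 - u) - 1 =
    2 * Gamma (1 + u) * of_real (2 * pi * real m) powr (-u) *
    (\<Sum>l=1..m. cos (of_real pi * u / 2 - of_real (unity_root_angle m r l)) * hurwitz_zeta u (of_nat l / of_nat m))"
proof (rule holomorphic_eq_of_eq_on_real_segment[where S = "ball 0 1" and a = "-1" and b = 0 and
   f = "\<lambda>u. u * hurwitz_reg (of_nat r / of_nat m) (1 - u) - 1" and
   g = "\<lambda>u. 2 * Gamma (1 + u) * of_real (2 * pi * real m) powr (-u) *
    (\<Sum>l=1..m. cos (of_real pi * u / 2 - of_real (unity_root_angle m r l)) * hurwitz_zeta u (of_nat l / of_nat m))"])
  have ok: "(of_nat r / of_nat m :: complex) \<notin> \<int>\<^sub>\<le>\<^sub>0" using mr by (intro Re_pos_not_nonpos_Ints) auto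
  have hr: "hurwitz_reg (of_nat r / of_nat m) holomorphic_on UNIV" by (rule holomorphic_on_hurwitz_reg[OF ok])
  have "(hurwitz_reg (of_nat r / of_nat m) \<circ> (\<lambda>u. 1 - u)) holomorphic_on ball 0 1"
    by (rule holomorphic_on_compose_gen[OF _ hr]) (auto intro!: holomorphic_intros)
  thus "(\<lambda>u. u * hurwitz_reg (of_nat r / of_nat m) (1 - u) - 1) holomorphic_on ball 0 1"
    by (auto intro!: holomorphic_intros simp: o_def)
  have "1 + u \<notin> \<int>\<^sub>\<le>\<^sub>0" if "u \<in> ball 0 1" for u :: complex
    using that abs_Re_le_cmod[of u] by (intro Re_pos_not_nonpos_Ints) auto
  moreover have "(of_nat l / of_nat m :: complex) \<notin> \<int>\<^sub>\<le>\<^sub>0" if "l \<in> {1..m}" for l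
    using that mr by (intro Re_pos_not_nonpos_Ints) auto
  ultimately show "(\<lambda>u. 2 * Gamma (1 + u) * of_real (2 * pi * real m) powr (-u) *
    (\<Sum>l=1..m. cos (of_real pi * u / 2 - of_real (unity_root_angle m r l)) * hurwitz_zeta u (of_nat l / of_nat m))) holomorphic_on ball 0 1"
    by (intro holomorphic_intros holomorphic_on_hurwitz_zeta) (use mr in auto)
  fix x :: real assume x: "-1 < x" "x < 0"
  define u where "u = complex_of_real x"
  define a where "a = real r / real m"
  define \<alpha> where "\<alpha> = of_real pi * (u - 1) / 2"
  define A where "A = hurwitz_zeta (1 - u) (of_real a)"
  define B where "B = hurwitz_zeta (1 - u) (of_real (1 - a))"
  define K where "K = of_real (pi / sin (pi * x)) * of_real (2 * pi) powr (u - 1)"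
  define Z where "Z = (\<lambda>l. hurwitz_zeta u (of_nat l / of_nat m))"
  define \<theta> where "\<theta> = (\<lambda>l. complex_of_real (unity_root_angle m r l))"
  have m: "m > 0" "r \<le> m" using mr by auto
  have mr': "m - r \<in> {1..m - 1}" using mr by auto
  have a': "real (m - r) / real m = 1 - a" "1 - (1 - a) = a" using mr by (auto simp: a_def field_simps of_nat_diff)
  have e1: "Gamma u * twisted_zeta m r u = K * (exp (- (\<i> * \<alpha>)) * A + exp (\<i> * \<alpha>) * B)"
    using twisted_zeta_functional_equation[OF mr x]
    by (simp add: u_def \<alpha>_def K_def A_def B_def a_def mult.assoc)
  have e2: "Gamma u * twisted_zeta m (m - r) u = K * (exp (- (\<i> * \<alpha>)) * B + exp (\<i> * \<alpha>) * A)"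
    using twisted_zeta_functional_equation[OF mr' mr(2) x] unfolding a'
    by (simp add: u_def \<alpha>_def K_def A_def B_def mult.assoc)
  have sx: "sin (pi * x) \<noteq> 0"
  proof -
    have "pi * (- x) > 0" using x by (intro mult_pos_pos) auto
    moreover have "pi * (- x) < pi * 1" using x by (intro mult_strict_left_mono) auto
    ultimately have "sin (pi * (- x)) > 0" by (intro sin_gt_zero) auto
    thus ?thesis by simp
  qed
  \<comment> \<open>The multipliers make the coefficient of B vanish. The coefficient of A becomes a
    multiple of sin (2 \<alpha>) = - sin (pi * x), which cancels the sine in the denominator of
    K.\<close>
  have "Gamma u * (exp (- (\<i> * \<alpha>)) * twisted_zeta m r u - exp (\<i> * \<alpha>) * twisted_zeta m (m - r) u) =
     exp (- (\<i> * \<alpha>)) * (Gamma u * twisted_zeta m r u) - exp (\<i> * \<alpha>) * (Gamma u * twisted_zeta m (m - r) u)"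
    by (simp add: algebra_simps)
  also have "\<dots> = K * A * (exp (- (\<i> * (2 * \<alpha>))) - exp (\<i> * (2 * \<alpha>)))"
  proof -
    have "exp (- (\<i> * (2 * \<alpha>))) = exp (- (\<i> * \<alpha>)) * exp (- (\<i> * \<alpha>))" "exp (\<i> * (2 * \<alpha>)) = exp (\<i> * \<alpha>) * exp (\<i> * \<alpha>)"
      by (simp_all add: mult_exp_exp mult_ac)
    thus ?thesis unfolding e1 e2 by (simp add: ring_distribs mult_ac)
  qed
  also have "exp (- (\<i> * (2 * \<alpha>))) - exp (\<i> * (2 * \<alpha>)) = - (2 * \<i>) * sin (2 * \<alpha>)"
    unfolding sin_exp_eq by simp
  also have "2 * \<alpha> = of_real (pi * x - pi)" by (simp add: \<alpha>_def u_def) (simp add: right_diff_distrib)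
  also have "sin (of_real (pi * x - pi)) = complex_of_real (- sin (pi * x))"
    unfolding sin_of_real by (simp add: sin_diff)
  also have "K * A * (- (2 * \<i>) * complex_of_real (- sin (pi * x))) = \<i> * of_real (2 * pi) powr u * A"
    using sx by (simp add: K_def powr_diff field_simps)
  finally have 1: "Gamma u * (exp (- (\<i> * \<alpha>)) * twisted_zeta m r u - exp (\<i> * \<alpha>) * twisted_zeta m (m - r) u) = \<i> * of_real (2 * pi) powr u * A" .
  have "exp (- (\<i> * \<alpha>)) * twisted_zeta m r u - exp (\<i> * \<alpha>) * twisted_zeta m (m - r) u =
    of_nat m powr (-u) * (\<Sum>l=1..m. (exp (- (\<i> * \<alpha>)) * exp (\<i> * \<theta> l) - exp (\<i> * \<alpha>) * exp (- (\<i> * \<theta> l))) * Z l)"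
    unfolding twisted_zeta_reflect[OF m(2,1)] unfolding twisted_zeta_def
    by (simp add: Z_def \<theta>_def sum_distrib_left sum_subtractf[symmetric] algebra_simps)
  also have "(\<lambda>l. exp (- (\<i> * \<alpha>)) * exp (\<i> * \<theta> l) - exp (\<i> * \<alpha>) * exp (- (\<i> * \<theta> l))) = (\<lambda>l. 2 * \<i> * cos (of_real pi * u / 2 - \<theta> l))"
  proof
    fix l
    have "exp (- (\<i> * \<alpha>)) * exp (\<i> * \<theta> l) - exp (\<i> * \<alpha>) * exp (- (\<i> * \<theta> l)) = exp (\<i> * (\<theta> l - \<alpha>)) - exp (- (\<i> * (\<theta> l - \<alpha>)))"
      by (simp add: exp_add[symmetric] algebra_simps)
    also have "\<dots> = 2 * \<i> * sin (\<theta> l - \<alpha>)" unfolding sin_exp_eq by simp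
    \<comment> \<open>The shift by 1 inside \<alpha> is a quarter turn, which turns the sine into
      the cosine of the statement.\<close>
    also have "\<theta> l - \<alpha> = of_real pi / 2 - (of_real pi * u / 2 - \<theta> l)" by (simp add: \<alpha>_def field_simps)
    also have "sin (of_real pi / 2 - (of_real pi * u / 2 - \<theta> l)) = cos (of_real pi * u / 2 - \<theta> l)"
      by (rule cos_sin_eq[symmetric])
    finally show "exp (- (\<i> * \<alpha>)) * exp (\<i> * \<theta> l) - exp (\<i> * \<alpha>) * exp (- (\<i> * \<theta> l)) = 2 * \<i> * cos (of_real pi * u / 2 - \<theta> l)" .
  qed
  finally have 2: "exp (- (\<i> * \<alpha>)) * twisted_zeta m r u - exp (\<i> * \<alpha>) * twisted_zeta m (m - r) u =
    of_nat m powr (-u) * (2 * \<i>) * (\<Sum>l=1..m. cos (of_real pi * u / 2 - \<theta> l) * Z l)"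
    by (simp add: sum_distrib_left mult_ac)
  have "\<i> * (of_real (2 * pi) powr u * A) = \<i> * (2 * Gamma u * of_nat m powr (-u) * (\<Sum>l=1..m. cos (of_real pi * u / 2 - \<theta> l) * Z l))"
    using 1 unfolding 2 by (simp add: mult_ac)
  hence F1: "of_real (2 * pi) powr u * A = 2 * Gamma u * of_nat m powr (-u) * (\<Sum>l=1..m. cos (of_real pi * u / 2 - \<theta> l) * Z l)" by simp
  have F2: "of_real (2 * pi) powr (-u) * of_real (2 * pi) powr u = (1 :: complex)" by (simp add: powr_minus)
  have F3: "of_real (2 * pi * real m) powr (-u) = of_real (2 * pi) powr (-u) * (of_nat m :: complex) powr (-u)"
    using powr_times_real_left[of "of_real (2 * pi)" "of_nat m" "-u"] by simp
  have "A = of_real (2 * pi) powr (-u) * of_real (2 * pi) powr u * A" unfolding F2 by simp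
  also have "\<dots> = of_real (2 * pi) powr (-u) * (of_real (2 * pi) powr u * A)" by (rule mult.assoc)
  also have "\<dots> = 2 * Gamma u * of_real (2 * pi * real m) powr (-u) * (\<Sum>l=1..m. cos (of_real pi * u / 2 - \<theta> l) * Z l)"
    unfolding F1 F3 by (simp only: mult_ac)
  finally have A: "A = 2 * Gamma u * of_real (2 * pi * real m) powr (-u) * (\<Sum>l=1..m. cos (of_real pi * u / 2 - \<theta> l) * Z l)" .
  have u0: "u \<noteq> 0" using x by (simp add: u_def)
  have ni: "u \<notin> \<int>\<^sub>\<le>\<^sub>0"
  proof
    assume "u \<in> \<int>\<^sub>\<le>\<^sub>0"
    then obtain n where "complex_of_real x = of_int n" unfolding u_def by (rule nonpos_Ints_cases)
    hence "x = of_int n" by (metis of_real_eq_iff of_real_of_int_eq)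
    thus False using x by simp
  qed
  have "A = 1 / (1 - u - 1) + hurwitz_reg (of_nat r / of_nat m) (1 - u)"
    using u0 ok by (simp add: A_def a_def hurwitz_zeta_conv_reg)
  hence "u * A = u * hurwitz_reg (of_nat r / of_nat m) (1 - u) - 1" using u0 by (simp add: field_simps)
  moreover have "Gamma (1 + u) = u * Gamma u" using Gamma_plus1[OF ni] by (simp add: add.commute)
  ultimately show "of_real x * hurwitz_reg (of_nat r / of_nat m) (1 - of_real x) - 1 =
     2 * Gamma (1 + of_real x) * of_real (2 * pi * real m) powr (- of_real x) *
    (\<Sum>l=1..m. cos (of_real pi * of_real x / 2 - of_real (unity_root_angle m r l)) * hurwitz_zeta (of_real x) (of_nat l / of_nat m))"
    unfolding u_def[symmetric] using A unfolding \<theta>_def Z_def by (simp add: mult_ac)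
qed (use u in \<open>auto simp: dist_norm\<close>)

section \<open>Taylor coefficients of order at most two\<close>

text \<open>\<open>taylor2 f a b c\<close> says that \<open>f z = a + b z + c z^2 + O(z^3)\<close> with \<open>f\<close> analytic at 0.\<close>

definition taylor2 :: "(complex \<Rightarrow> complex) \<Rightarrow> complex \<Rightarrow> complex \<Rightarrow> complex \<Rightarrow> bool" where
  "taylor2 f a b c \<longleftrightarrow> (\<exists>F. f has_fps_expansion F \<and> fps_nth F 0 = a \<and> fps_nth F 1 = b \<and> fps_nth F 2 = c)"

lemma taylor2_unique:
  assumes "taylor2 f a b c" "taylor2 g a' b' c'" "open S" "0 \<in> S" "\<And>z. z \<in> S \<Longrightarrow> f z = g z"
  shows "a = a'" "b = b'" "c = c'"
proof -
  obtain F G where F: "f has_fps_expansion F" "fps_nth F 0 = a" "fps_nth F 1 = b" "fps_nth F 2 = c"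
    and G: "g has_fps_expansion G" "fps_nth G 0 = a'" "fps_nth G 1 = b'" "fps_nth G 2 = c'"
    using assms(1,2) unfolding taylor2_def by blast
  have "eventually (\<lambda>z. f z = g z) (nhds 0)"
    using eventually_nhds_in_open[OF assms(3,4)] by eventually_elim (rule assms(5))
  hence "g has_fps_expansion F" using F(1) has_fps_expansion_cong[of f g F F] by simp
  hence "fps_nth F n = fps_nth G n" for n
    using fps_nth_fps_expansion G(1) by metis
  with F G show "a = a'" "b = b'" "c = c'" by auto
qed

lemma taylor2_mult:
  assumes "taylor2 f a b c" "taylor2 g a' b' c'"
  shows "taylor2 (\<lambda>z. f z * g z) (a * a') (a * b' + b * a') (a * c' + b * b' + c * a')"
proof -
  obtain F G where F: "f has_fps_expansion F" "fps_nth F 0 = a" "fps_nth F 1 = b" "fps_nth F 2 = c"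
    and G: "g has_fps_expansion G" "fps_nth G 0 = a'" "fps_nth G 1 = b'" "fps_nth G 2 = c'"
    using assms unfolding taylor2_def by blast
  show ?thesis unfolding taylor2_def
    by (rule exI[of _ "F * G"])
       (use has_fps_expansion_mult[OF F(1) G(1)] F G in \<open>auto simp: fps_mult_nth numeral_2_eq_2\<close>)
qed

lemma taylor2_add:
  assumes "taylor2 f a b c" "taylor2 g a' b' c'"
  shows "taylor2 (\<lambda>z. f z + g z) (a + a') (b + b') (c + c')"
proof -
  obtain F G where F: "f has_fps_expansion F" "fps_nth F 0 = a" "fps_nth F 1 = b" "fps_nth F 2 = c"
    and G: "g has_fps_expansion G" "fps_nth G 0 = a'" "fps_nth G 1 = b'" "fps_nth G 2 = c'"
    using assms unfolding taylor2_def by blast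
  show ?thesis unfolding taylor2_def
    by (rule exI[of _ "F + G"]) (use has_fps_expansion_add[OF F(1) G(1)] F G in auto)
qed

lemma taylor2_const: "taylor2 (\<lambda>_. a) a 0 0"
  unfolding taylor2_def by (rule exI[of _ "fps_const a"]) (auto simp: fps_nth_fps_const)

lemma taylor2_ident: "taylor2 (\<lambda>z. z) 0 1 0"
  unfolding taylor2_def by (rule exI[of _ fps_X]) (auto intro: has_fps_expansion_fps_X)

lemma taylor2_cmult: "taylor2 f a b c \<Longrightarrow> taylor2 (\<lambda>z. k * f z) (k * a) (k * b) (k * c)"
  using taylor2_mult[OF taylor2_const[of k], of f a b c] by simp

lemma taylor2_sum:
  assumes "finite A" "\<And>i. i \<in> A \<Longrightarrow> taylor2 (f i) (a i) (b i) (c i)"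
  shows "taylor2 (\<lambda>z. \<Sum>i\<in>A. f i z) (\<Sum>i\<in>A. a i) (\<Sum>i\<in>A. b i) (\<Sum>i\<in>A. c i)"
  using assms
proof (induction A rule: finite_induct)
  case empty
  show ?case using taylor2_const[of 0] by simp
next
  case (insert x A)
  thus ?case by (simp add: taylor2_add)
qed

lemma taylor2_holomorphic:
  assumes "f holomorphic_on S" "open S" "0 \<in> S"
  shows "taylor2 f (f 0) (deriv f 0) ((deriv ^^ 2) f 0 / 2)"
proof -
  have "f analytic_on {0}" using assms analytic_at by blast
  hence "f has_fps_expansion fps_expansion f 0" by (rule analytic_at_imp_has_fps_expansion_0)
  thus ?thesis unfolding taylor2_def
    by (intro exI[of _ "fps_expansion f 0"]) (auto simp: fps_expansion_def numeral_2_eq_2)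
qed

lemma taylor2_exp: "taylor2 (\<lambda>z. exp (k * z)) 1 k (k ^ 2 / 2)"
  unfolding taylor2_def by (rule exI[of _ "fps_exp k"]) (auto simp: numeral_2_eq_2 has_fps_expansion_exp)

lemma taylor2_cos_diff: "taylor2 (\<lambda>z. cos (k * z - \<theta>)) (cos \<theta>) (k * sin \<theta>) (- (k ^ 2 / 2) * cos \<theta>)"
proof -
  have c: "taylor2 (\<lambda>z. cos (k * z)) 1 0 (- (k ^ 2 / 2))" "taylor2 (\<lambda>z. sin (k * z)) 0 k 0"
  proof -
    show "taylor2 (\<lambda>z. cos (k * z)) 1 0 (- (k ^ 2 / 2))"
      unfolding taylor2_def
      by (rule exI[of _ "fps_cos k"], intro conjI has_fps_expansion_cos) (auto simp: fps_cos_def)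
    show "taylor2 (\<lambda>z. sin (k * z)) 0 k 0"
      unfolding taylor2_def
      by (rule exI[of _ "fps_sin k"], intro conjI has_fps_expansion_sin) (auto simp: fps_sin_def)
  qed
  show ?thesis
    using taylor2_add[OF taylor2_cmult[OF c(1), of "cos \<theta>"] taylor2_cmult[OF c(2), of "sin \<theta>"]]
    by (simp add: cos_diff mult_ac)
qed

lemma taylor2_powr_minus:
  assumes "x > 0"
  shows "taylor2 (\<lambda>z. of_real x powr (- z)) 1 (- of_real (ln x)) (of_real (ln x) ^ 2 / 2)"
  using taylor2_exp[of "- of_real (ln x)"] assms by (simp add: powr_def Ln_of_real mult_ac)

text \<open>The second coefficient stays symbolic: it only enters the constant that the instance m =
  2 eliminates.\<close>

lemma taylor2_Gamma: "taylor2 (\<lambda>z. Gamma (1 + z)) 1 (- euler_mascheroni) ((deriv ^^ 2) (\<lambda>z. Gamma (1 + z)) 0 / 2)"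
proof -
  have ni: "1 + u \<notin> \<int>\<^sub>\<le>\<^sub>0" if "u \<in> ball 0 1" for u :: complex
    using that abs_Re_le_cmod[of u] by (intro Re_pos_not_nonpos_Ints) auto
  have "(\<lambda>z::complex. Gamma (1 + z)) holomorphic_on ball 0 1"
    by (intro holomorphic_intros) (use ni in auto)
  from taylor2_holomorphic[OF this] have "taylor2 (\<lambda>z. Gamma (1 + z)) 1 (deriv (\<lambda>z. Gamma (1 + z)) 0) ((deriv ^^ 2) (\<lambda>z. Gamma (1 + z)) 0 / 2)"
    by simp
  moreover have "((\<lambda>z::complex. Gamma (1 + z)) has_field_derivative Gamma (1 + 0) * Digamma (1 + 0) * (0 + 1)) (at 0)"
    by (rule DERIV_chain2[OF has_field_derivative_Gamma]) (auto intro!: derivative_eq_intros)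
  hence "deriv (\<lambda>z::complex. Gamma (1 + z)) 0 = - euler_mascheroni" by (intro DERIV_imp_deriv) simp
  ultimately show ?thesis by simp
qed

lemma taylor2_hurwitz_zeta_0:
  assumes "x > 0"
  shows "taylor2 (\<lambda>u. hurwitz_zeta u (of_real x)) (1 / 2 - of_real x) (of_real (ln (Gamma x) - ln (2 * pi) / 2))
           (hurwitz_zeta_deriv2_0 (of_real x) / 2)"
proof -
  have "(\<lambda>u. hurwitz_zeta u (of_real x)) holomorphic_on -{1}"
    by (intro holomorphic_on_hurwitz_zeta Re_pos_not_nonpos_Ints) (use assms in auto)
  from taylor2_holomorphic[OF this] show ?thesis
    using assms hurwitz_deriv_0_eq_ln_Gamma[OF assms]
    by (simp add: hurwitz_zeta_0 hurwitz_deriv_0_def hurwitz_zeta_deriv2_0_def ln_Gamma_real_pos open_Compl)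
qed

text \<open>The factor u shifts the coefficients by one place, so gamma_1 sits at order 2. The sign
  in 1 - u matches the sign in gamma_1 = - R'(1).\<close>

lemma taylor2_hurwitz_reg:
  assumes "x > 0"
  shows "taylor2 (\<lambda>u. u * hurwitz_reg (of_real x) (1 - u) - 1) (- 1) (- of_real (Digamma x)) (gen_stieltjes 1 (of_real x))"
proof -
  define R where "R = hurwitz_reg (of_real x)"
  have ok: "complex_of_real x \<notin> \<int>\<^sub>\<le>\<^sub>0" using assms by (intro Re_pos_not_nonpos_Ints) auto
  have hol: "R holomorphic_on UNIV" unfolding R_def by (rule holomorphic_on_hurwitz_reg[OF ok])
  have "(R \<circ> (\<lambda>u. 1 - u)) holomorphic_on UNIV"
    by (rule holomorphic_on_compose_gen[OF _ hol]) (auto intro!: holomorphic_intros)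
  hence t: "taylor2 (\<lambda>u. R (1 - u)) (R (1 - 0)) (deriv (\<lambda>u. R (1 - u)) 0) ((deriv ^^ 2) (\<lambda>u. R (1 - u)) 0 / 2)"
    by (intro taylor2_holomorphic[of _ UNIV]) (auto simp: o_def)
  have d: "((\<lambda>u. 1 - u) has_field_derivative - 1) (at (0::complex))" by (auto intro!: derivative_eq_intros)
  have "(R has_field_derivative deriv R (1 - 0)) (at (1 - 0))"
    by (rule holomorphic_derivI[OF hol]) auto
  from DERIV_chain2[OF this d] have "deriv (\<lambda>u. R (1 - u)) 0 = - deriv R 1" by (intro DERIV_imp_deriv) simp
  hence "deriv (\<lambda>u. R (1 - u)) 0 = gen_stieltjes 1 (of_real x)" using gen_stieltjes_eq_deriv[OF ok, of 1] by (simp add: R_def)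
  with t have "taylor2 (\<lambda>u. R (1 - u)) (- of_real (Digamma x)) (gen_stieltjes 1 (of_real x)) ((deriv ^^ 2) (\<lambda>u. R (1 - u)) 0 / 2)"
    using hurwitz_reg_1_Digamma[OF assms] by (simp add: R_def)
  from taylor2_add[OF taylor2_mult[OF taylor2_ident this] taylor2_const[of "-1"]] show ?thesis
    by (simp add: R_def)
qed

text \<open>The relation zeta(s,1/2) = (2 powr s - 1) zeta(s) at s = 1 - u, multiplied by u and
  compared at order 2.\<close>

lemma gen_stieltjes_half: "gen_stieltjes 1 (1 / 2) = gen_stieltjes 1 1 - 2 * of_real (ln 2) * euler_mascheroni - of_real (ln 2) ^ 2"
proof -
  have ok: "(1 / 2 :: complex) \<notin> \<int>\<^sub>\<le>\<^sub>0" "(1 :: complex) \<notin> \<int>\<^sub>\<le>\<^sub>0" by (auto intro!: Re_pos_not_nonpos_Ints)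
  \<comment> \<open>The relation between the zeta values excludes the pole, so u = 0 is checked
    directly.\<close>
  have eq: "u * hurwitz_reg (1 / 2) (1 - u) - 1 = (2 * 2 powr (-u) + - 1) * (u * hurwitz_reg 1 (1 - u) - 1)" for u
  proof (cases "u = 0")
    case False
    hence "- 1 / u + hurwitz_reg (1 / 2) (1 - u) = (2 powr (1 - u) - 1) * (- 1 / u + hurwitz_reg 1 (1 - u))"
      using hurwitz_zeta_half[of "1 - u"] by (simp add: hurwitz_zeta_conv_reg ok)
    hence "u * (- 1 / u + hurwitz_reg (1 / 2) (1 - u)) = (2 powr (1 - u) - 1) * (u * (- 1 / u + hurwitz_reg 1 (1 - u)))"
      by (simp only: mult.left_commute)
    moreover have "u * (- 1 / u + z) = u * z - 1" for z using False by (simp add: algebra_simps)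
    moreover have "(2::complex) powr (1 - u) = 2 * 2 powr (-u)" by (simp add: powr_diff powr_minus divide_inverse)
    ultimately show ?thesis by (simp only: diff_conv_add_uminus)
  qed auto
  have "taylor2 (\<lambda>u. (2 * of_real 2 powr (-u) + - 1) * (u * hurwitz_reg (of_real 1) (1 - u) - 1))
     ((2 * 1 + - 1) * (- 1)) ((2 * 1 + - 1) * - of_real (Digamma 1) + (2 * - of_real (ln 2) + 0) * (- 1))
     ((2 * 1 + - 1) * gen_stieltjes 1 (of_real 1) + (2 * - of_real (ln 2) + 0) * - of_real (Digamma 1) + (2 * (of_real (ln 2) ^ 2 / 2) + 0) * (- 1))"
    by (intro taylor2_mult taylor2_add taylor2_cmult taylor2_const taylor2_powr_minus taylor2_hurwitz_reg) auto
  from taylor2_unique(3)[OF taylor2_hurwitz_reg[of "1 / 2"] this, of UNIV] show ?thesis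
    by (simp add: eq)
qed

text \<open>The factor 2 powr s - 1 vanishes at 0, so the unknown zeta''(0,1) drops out and the
  value at 1/2 is elementary.\<close>

lemma hurwitz_zeta_deriv2_0_half:
  "hurwitz_zeta_deriv2_0 (1 / 2) = - of_real (ln 2 * ln (2 * pi)) - of_real (ln 2) ^ 2 / 2"
proof -
  have "taylor2 (\<lambda>u. (exp (of_real (ln 2) * u) + - 1) * hurwitz_zeta u (of_real 1))
     ((1 + - 1) * (1 / 2 - of_real 1)) ((1 + - 1) * of_real (ln (Gamma 1) - ln (2 * pi) / 2) + (of_real (ln 2) + 0) * (1 / 2 - of_real 1))
     ((1 + - 1) * (hurwitz_zeta_deriv2_0 (of_real 1) / 2) + (of_real (ln 2) + 0) * of_real (ln (Gamma 1) - ln (2 * pi) / 2) + (of_real (ln 2) ^ 2 / 2 + 0) * (1 / 2 - of_real 1))"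
    by (intro taylor2_mult taylor2_add taylor2_const taylor2_exp taylor2_hurwitz_zeta_0) auto
  from taylor2_unique(3)[OF taylor2_hurwitz_zeta_0[of "1 / 2"] this, of "-{1}"]
  have "hurwitz_zeta_deriv2_0 (1 / 2) / 2 = of_real (ln 2) * of_real (ln (Gamma 1) - ln (2 * pi) / 2) + (of_real (ln 2) ^ 2 / 2) * (- (1 / 2))"
    by (simp add: hurwitz_zeta_half powr_def Ln_of_real[of 2, simplified] mult_ac open_Compl)
  note Z = this
  have "hurwitz_zeta_deriv2_0 (1 / 2) = 2 * (hurwitz_zeta_deriv2_0 (1 / 2) / 2)" by simp
  also have "\<dots> = - of_real (ln 2 * ln (2 * pi)) - of_real (ln 2) ^ 2 / 2" unfolding Z by (simp add: algebra_simps)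
  finally show ?thesis .
qed

section \<open>Trigonometric sums over the m-th roots of unity\<close>

lemma unity_root_sums:
  assumes mr: "r \<in> {1..m - 1}" "m \<ge> 2"
  shows "(\<Sum>l=1..m. cosr m r l) = 0"
    and "(\<Sum>l=1..m. sinr m r l) = 0"
    and "(\<Sum>l=1..m-1. real l * sinr m r l) = - (real m / 2) * cot (pi * real r / real m)"
proof -
  define a where "a = real r / real m"
  have a: "0 < a" "a < 1" using mr by (auto simp: a_def)
  define \<omega> where "\<omega> = exp (2 * of_real pi * \<i> * complex_of_real a)"
  have w1: "\<omega> \<noteq> 1" using exp_2pi_i_neq_1[OF a] by (simp add: \<omega>_def)
  have pw: "\<omega> ^ l = cis (unity_root_angle m r l)" for l
    unfolding \<omega>_def exp_of_nat_mult[symmetric] cis_conv_exp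
    by (rule arg_cong[of _ _ exp]) (simp add: unity_root_angle_def a_def)
  have wm: "\<omega> ^ m = 1"
  proof -
    have "unity_root_angle m r m = 2 * pi * real r" using mr by (simp add: unity_root_angle_def)
    thus ?thesis unfolding pw by (simp add: cis_multiple_2pi)
  qed
  have "(1 - \<omega>) * (\<Sum>l=1..m. \<omega> ^ l) = 0"
    using sum_gp_multiplied[of 1 m \<omega>] mr wm by simp
  hence s: "(\<Sum>l=1..m. \<omega> ^ l) = 0" using w1 by simp
  show "(\<Sum>l=1..m. cosr m r l) = 0"
    using arg_cong[OF s, of Re] by (simp add: pw)
  show "(\<Sum>l=1..m. sinr m r l) = 0"
    using arg_cong[OF s, of Im] by (simp add: pw)
  \<comment> \<open>Telescoping by multiplication with \<omega> - 1. For n = m this gives m /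
    (\<omega> - 1), whose imaginary part is - m/2 times the cotangent.\<close>
  have tel: "(\<omega> - 1) * (\<Sum>l<n. of_nat l * \<omega> ^ l) = of_nat n * \<omega> ^ n - (\<Sum>l=1..n. \<omega> ^ l)" for n
    by (induction n) (auto simp: algebra_simps)
  have "(\<omega> - 1) * (\<Sum>l<m. of_nat l * \<omega> ^ l) = of_nat m" unfolding tel s wm by simp
  hence "(\<Sum>l<m. of_nat l * \<omega> ^ l) = of_nat m * (1 / (\<omega> - 1))" using w1 by (simp add: field_simps)
  also have "1 / (\<omega> - 1) = - 1 / 2 + \<i> / 2 * cot (of_real pi * (- of_real a))"
  proof -
    have "sin (pi * a) > 0" using a by (intro sin_gt_zero) auto
    hence "sin (complex_of_real pi * - of_real a) \<noteq> 0" by (simp add: sin_of_real flip: of_real_mult)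
    from inverse_exp_minus_1_conv_cot[OF this] show ?thesis by (simp add: \<omega>_def)
  qed
  also have "cot (of_real pi * (- of_real a)) = - complex_of_real (cot (pi * a))"
    by (simp add: cot_def sin_of_real cos_of_real flip: of_real_mult)
  finally have "Im (\<Sum>l<m. of_nat l * \<omega> ^ l) = - (real m / 2) * cot (pi * a)" by simp
  moreover have "Im (\<Sum>l<m. of_nat l * \<omega> ^ l) = (\<Sum>l<m. real l * sinr m r l)" by (simp add: pw)
  moreover have "(\<Sum>l<m. real l * sinr m r l) = (\<Sum>l=1..m-1. real l * sinr m r l)"
    by (rule sum.mono_neutral_right) auto
  ultimately show "(\<Sum>l=1..m-1. real l * sinr m r l) = - (real m / 2) * cot (pi * real r / real m)"
    by (simp add: a_def)
qed

lemma sum_atLeast1_atMost_pred: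
  assumes "m \<ge> (1::nat)"
  shows "(\<Sum>l=1..m. f l) = (\<Sum>l=1..m-1. f l) + f m"
  using assms by (cases m) auto

lemma unity_root_angle_m: "m > 0 \<Longrightarrow> cosr m r m = 1" "m > 0 \<Longrightarrow> sinr m r m = 0"
proof -
  assume "m > 0"
  hence *: "unity_root_angle m r m = 2 * real r * pi" by (simp add: unity_root_angle_def)
  show "cosr m r m = 1" unfolding * by (rule cos_2npi)
  show "sinr m r m = 0" unfolding * using sin_npi[of "2 * r"] by simp
qed

section \<open>Closed forms for the first generalized Stieltjes constant\<close>

lemma ln_Gamma_reflection_real:
  assumes "0 < x" "x < (1::real)"
  shows "ln (Gamma x) + ln (Gamma (1 - x)) = ln pi - ln (sin (pi * x))"
proof -
  have s: "sin (pi * x) > 0" using assms by (intro sin_gt_zero) auto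
  have "complex_of_real (Gamma x * Gamma (1 - x)) = of_real pi / sin (of_real pi * of_real x)"
    using Gamma_reflection_complex[of "of_real x"] by (simp flip: Gamma_complex_of_real)
  also have "\<dots> = of_real (pi / sin (pi * x))" by (simp add: sin_of_real[symmetric])
  finally have "Gamma x * Gamma (1 - x) = pi / sin (pi * x)" by (simp only: of_real_eq_iff)
  hence "ln (Gamma x * Gamma (1 - x)) = ln (pi / sin (pi * x))" by simp
  moreover have "Gamma x > 0" "Gamma (1 - x) > 0" using assms by (auto intro: Gamma_real_pos)
  ultimately show ?thesis using s by (simp add: ln_mult ln_div)
qed

text \<open>Origin of the half-range sums of the first form; the fixed point l = m/2 of the
  reflection produces its (-1)^r term.\<close>

lemma sum_fold_reflect:
  fixes f :: "nat \<Rightarrow> 'a :: comm_monoid_add"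
  assumes "m \<ge> 2"
  shows "(\<Sum>l=1..m-1. f l) = (\<Sum>l=1..(m-1) div 2. f l + f (m - l)) + (if even m then f (m div 2) else 0)"
proof -
  define h where "h = (m - 1) div 2"
  define M where "M = (if even m then {m div 2} else {})"
  have "{1..m-1} = {1..h} \<union> (M \<union> {m-h..m-1})" using assms by (auto simp: h_def M_def elim!: evenE oddE)
  hence "(\<Sum>l=1..m-1. f l) = (\<Sum>l\<in>{1..h} \<union> (M \<union> {m-h..m-1}). f l)" by simp
  also have "\<dots> = (\<Sum>l=1..h. f l) + (\<Sum>l\<in>M \<union> {m-h..m-1}. f l)"
    using assms by (intro sum.union_disjoint) (auto simp: h_def M_def elim!: evenE oddE)
  also have "(\<Sum>l\<in>M \<union> {m-h..m-1}. f l) = (\<Sum>l\<in>M. f l) + (\<Sum>l=m-h..m-1. f l)"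
    using assms by (intro sum.union_disjoint) (auto simp: h_def M_def elim!: evenE oddE)
  also have "(\<Sum>l=m-h..m-1. f l) = (\<Sum>l=1..h. f (m - l))"
    by (rule sum.reindex_bij_witness[of _ "\<lambda>l. m - l" "\<lambda>l. m - l"]) (use assms in \<open>auto simp: h_def\<close>)
  finally show ?thesis by (simp add: h_def M_def sum.distrib ac_simps)
qed

text \<open>The induction step is the identity sin N sin (N - y) + sin y sin (2 N) = sin (N + y) sin
  N.\<close>

lemma sum_sin_multiples:
  "sin y * (\<Sum>l=1..n. sin (2 * y * real l)) = sin (y * real (n + 1)) * sin (y * real n)"
proof (induction n)
  case (Suc n)
  define N where "N = y * real (n + 1)"
  have e: "y * real n = N - y" "y * real (Suc n + 1) = N + y" "2 * y * real (Suc n) = 2 * N" "y * real (Suc n) = N"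
    by (simp_all add: N_def algebra_simps)
  have "sin y * (\<Sum>l=1..Suc n. sin (2 * y * real l)) = sin N * sin (N - y) + sin y * sin (2 * N)"
    using Suc unfolding e(1) N_def[symmetric] by (simp add: ring_distribs e del: of_nat_Suc)
  also have "\<dots> = sin (N + y) * sin N"
    unfolding sin_diff sin_add sin_double by (simp add: algebra_simps)
  finally show ?case unfolding e .
qed auto

context
  fixes m r :: nat
  assumes mr: "r \<in> {1..m - 1}" "m \<ge> 2"
begin

lemma unity_root_angle_reflect:
  assumes "l \<le> m"
  shows "cosr m r (m - l) = cosr m r l"
    and "sinr m r (m - l) = - sinr m r l"
proof -
  have e: "unity_root_angle m r (m - l) = 2 * real r * pi - unity_root_angle m r l"
    using mr assms by (simp add: unity_root_angle_def of_nat_diff field_simps)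
  have "sin (2 * real r * pi) = 0" using sin_npi[of "2 * r"] by simp
  thus "cosr m r (m - l) = cosr m r l"
    "sinr m r (m - l) = - sinr m r l"
    unfolding e by (simp_all add: cos_diff sin_diff cos_2npi)
qed

lemma unity_root_angle_half:
  assumes "even m"
  shows "cosr m r (m div 2) = (-1) ^ r" "sinr m r (m div 2) = 0"
proof -
  have e: "unity_root_angle m r (m div 2) = real r * pi"
    using mr assms by (auto simp: unity_root_angle_def elim!: evenE)
  show "cosr m r (m div 2) = (-1) ^ r" "sinr m r (m div 2) = 0"
    unfolding e by (simp_all add: cos_npi sin_npi)
qed

lemma sum_cos_pred: "(\<Sum>l=1..m-1. cosr m r l) = - 1"
  using unity_root_sums(1)[OF mr] sum_atLeast1_atMost_pred[of m "\<lambda>l. cosr m r l"]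
    unity_root_angle_m[of m r] mr by auto

text \<open>The cosine is invariant under l -> m - l, so twice the sum contains ln Gamma(x) + ln
  Gamma(1 - x), which the reflection formula turns into ln pi - ln sin.\<close>

lemma sum_cos_ln_Gamma:
  "(\<Sum>l=1..m-1. cosr m r l * lnGamma_frac m l) =
     - ln pi / 2 - (\<Sum>l=1..m-1. cosr m r l * lnsin_frac m l) / 2"
proof -
  define X where "X = (\<Sum>l=1..m-1. cosr m r l * lnGamma_frac m l)"
  have "X = (\<Sum>l=1..m-1. cosr m r (m - l) * lnGamma_frac m (m - l))"
    unfolding X_def by (rule sum.reindex_bij_witness[of _ "\<lambda>l. m - l" "\<lambda>l. m - l"]) (use mr in auto)
  also have "\<dots> = (\<Sum>l=1..m-1. cosr m r l * ln (Gamma (1 - real l / real m)))"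
  proof (intro sum.cong refl)
    fix l assume l: "l \<in> {1..m-1}"
    hence lm: "l \<le> m" by auto
    hence e: "real (m - l) / real m = 1 - real l / real m" using mr by (simp add: of_nat_diff field_simps)
    show "cosr m r (m - l) * lnGamma_frac m (m - l) = cosr m r l * ln (Gamma (1 - real l / real m))"
      unfolding e unity_root_angle_reflect(1)[OF lm] ..
  qed
  finally have "2 * X = (\<Sum>l=1..m-1. cosr m r l * (lnGamma_frac m l + ln (Gamma (1 - real l / real m))))"
    by (simp add: X_def ring_distribs sum.distrib)
  also have "\<dots> = (\<Sum>l=1..m-1. cosr m r l * (ln pi - lnsin_frac m l))"
    by (intro sum.cong refl, subst ln_Gamma_reflection_real) auto
  also have "\<dots> = ln pi * (\<Sum>l=1..m-1. cosr m r l) - (\<Sum>l=1..m-1. cosr m r l * lnsin_frac m l)"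
    by (simp add: ring_distribs sum_subtractf sum_distrib_left mult_ac)
  finally show ?thesis unfolding sum_cos_pred by (simp add: X_def)
qed

text \<open>Coefficients of orders 1 and 2 of the functional equation. \<open>W\<close> collects
  what is independent of m and r: zeta''(0,1) from the term l = m, pi^2/8 from the quadratic term of
  the cosine, and half of Gamma''(1).\<close>

lemma gen_stieltjes_rational_expansion:
  defines "L \<equiv> ln (2 * pi * real m)"
    and "W \<equiv> hurwitz_zeta_deriv2_0 1 + of_real (pi ^ 2 / 8) - (deriv ^^ 2) (\<lambda>z. Gamma (1 + z)) 0 / 2"
  shows "(\<Sum>l=1..m-1. cosr m r l * lnGamma_frac m l)
           - pi / (2 * real m) * (\<Sum>l=1..m-1. real l * sinr m r l) =
         - (Digamma (real r / real m) + L + euler_mascheroni) / 2" (is ?A)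
    and "gen_stieltjes 1 (of_nat r / of_nat m) = W +
       (\<Sum>l=1..m-1. of_real (cosr m r l) * zeta2_frac m l) +
       of_real (pi * (\<Sum>l=1..m-1. sinr m r l * lnGamma_frac m l)
         + (L + euler_mascheroni) * (Digamma (real r / real m) + L + euler_mascheroni) - (L ^ 2 / 2 + euler_mascheroni * L))" (is ?B)
proof -
  define c where "c = (\<lambda>l. cosr m r l)"
  define s where "s = (\<lambda>l. sinr m r l)"
  define G where "G = (\<lambda>l. lnGamma_frac m l)"
  define g where "g = (\<lambda>l. G l - ln (2 * pi) / 2)"
  define Z where "Z = (\<lambda>l. zeta2_frac m l)"
  define k where "k = complex_of_real (pi / 2)"
  define x where "x = (\<lambda>l. real l / real m)"
  define G2 where "G2 = (deriv ^^ 2) (\<lambda>z. Gamma (1 + z)) (0::complex) / 2"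
  define S0 where "S0 = (\<Sum>l=1..m. of_real (c l) * (1 / 2 - of_real (x l)) :: complex)"
  define S1 where "S1 = (\<Sum>l=1..m. of_real (c l) * of_real (g l) + k * of_real (s l) * (1 / 2 - of_real (x l)) :: complex)"
  define S2 where "S2 = (\<Sum>l=1..m. of_real (c l) * (Z l / 2) + k * of_real (s l) * of_real (g l) + (- (k ^ 2 / 2) * of_real (c l)) * (1 / 2 - of_real (x l)))"
  have m0: "m > 0" and m1: "m \<ge> 1" using mr by simp_all
  have trm: "taylor2 (\<lambda>u. cos (k * u - of_real (unity_root_angle m r l)) * hurwitz_zeta u (of_nat l / of_nat m))
     (of_real (c l) * (1 / 2 - of_real (x l))) (of_real (c l) * of_real (g l) + k * of_real (s l) * (1 / 2 - of_real (x l)))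
     (of_real (c l) * (Z l / 2) + k * of_real (s l) * of_real (g l) + (- (k ^ 2 / 2) * of_real (c l)) * (1 / 2 - of_real (x l)))"
    if "l \<in> {1..m}" for l
    using taylor2_mult[OF taylor2_cos_diff[of k "of_real (unity_root_angle m r l)"] taylor2_hurwitz_zeta_0[of "x l"]] that m0
    by (simp add: c_def s_def x_def Z_def g_def G_def cos_of_real sin_of_real)
  have S: "taylor2 (\<lambda>u. \<Sum>l=1..m. cos (k * u - of_real (unity_root_angle m r l)) * hurwitz_zeta u (of_nat l / of_nat m)) S0 S1 S2"
    unfolding S0_def S1_def S2_def by (rule taylor2_sum[OF _ trm]) auto
  have "2 * pi * real m > 0" using m0 by simp
  note R = taylor2_mult[OF taylor2_mult[OF taylor2_cmult[OF taylor2_Gamma, of 2] taylor2_powr_minus[OF this]] S]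
  have Lf: "taylor2 (\<lambda>u. u * hurwitz_reg (of_real (real r / real m)) (1 - u) - 1) (- 1) (- of_real (Digamma (real r / real m))) (gen_stieltjes 1 (of_real (real r / real m)))"
    by (rule taylor2_hurwitz_reg) (use mr in auto)
  have eq: "u * hurwitz_reg (of_real (real r / real m)) (1 - u) - 1 = 2 * Gamma (1 + u) * of_real (2 * pi * real m) powr (-u) *
    (\<Sum>l=1..m. cos (k * u - of_real (unity_root_angle m r l)) * hurwitz_zeta u (of_nat l / of_nat m))" if "u \<in> ball 0 1" for u
    using hurwitz_functional_equation_rational[OF mr that] by (simp add: k_def)
  note T = taylor2_unique[OF Lf R open_ball, of 0 1, OF _ eq, folded G2_def L_def]
  \<comment> \<open>The order 0 coefficient fixes S0, which multiplies the quadratic coefficients of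
    the Gamma factor, the power and the cosine.\<close>
  have S0: "S0 = - 1 / 2" using T(1) by simp
  have e1: "- complex_of_real (Digamma (real r / real m)) = 2 * S1 + of_real L + euler_mascheroni"
    using T(2) unfolding S0 by (simp add: algebra_simps)
  \<comment> \<open>Order 1 expresses S1 through the Digamma value; with it S1 is eliminated from
    order 2.\<close>
  hence S1': "2 * S1 = - of_real (Digamma (real r / real m) + L + euler_mascheroni)"
    by (simp add: algebra_simps)
  have e2: "gen_stieltjes 1 (of_nat r / of_nat m) = 2 * S2 - (of_real L + euler_mascheroni) * (2 * S1) - (of_real (L ^ 2 / 2 + euler_mascheroni * L) + G2)"
    using T(3) unfolding S0 by (simp add: algebra_simps power2_eq_square)
  \<comment> \<open>In the term l = m both ln Gamma(1) and the sine vanish while the cosine is 1.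
    Only zeta''(0,1) survives from it, so the remaining sums end at m - 1.\<close>
  have Gm: "G m = 0" using m0 by (simp add: G_def)
  have cm: "c m = 1" "s m = 0" using unity_root_angle_m[OF m0] by (simp_all add: c_def s_def)
  have sc: "(\<Sum>l=1..m. c l) = 0" and ss: "(\<Sum>l=1..m. s l) = 0"
    using unity_root_sums(1,2)[OF mr] by (simp_all add: c_def s_def)
  have "S1 = of_real (\<Sum>l=1..m. c l * g l + pi / 2 * s l * (1 / 2 - x l))" by (simp add: S1_def k_def)
  also have "(\<Sum>l=1..m. c l * g l + pi / 2 * s l * (1 / 2 - x l)) =
     (\<Sum>l=1..m. c l * G l) - ln (2 * pi) / 2 * (\<Sum>l=1..m. c l) + pi / 4 * (\<Sum>l=1..m. s l) - pi / (2 * real m) * (\<Sum>l=1..m. real l * s l)"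
  proof -
    have "(\<Sum>l=1..m. c l * g l + pi / 2 * s l * (1 / 2 - x l)) =
      (\<Sum>l=1..m. c l * G l - ln (2 * pi) / 2 * c l + pi / 4 * s l - pi / (2 * real m) * (real l * s l))"
      by (intro sum.cong refl) (simp add: g_def x_def algebra_simps)
    thus ?thesis by (simp only: sum.distrib sum_subtractf sum_distrib_left)
  qed
  also have "\<dots> = (\<Sum>l=1..m-1. c l * G l) - pi / (2 * real m) * (\<Sum>l=1..m-1. real l * s l)"
    unfolding sc ss unfolding sum_atLeast1_atMost_pred[OF m1] by (simp add: Gm cm)
  finally have "2 * S1 = of_real (2 * ((\<Sum>l=1..m-1. c l * G l) - pi / (2 * real m) * (\<Sum>l=1..m-1. real l * s l)))"
    by simp
  hence "of_real (2 * ((\<Sum>l=1..m-1. c l * G l) - pi / (2 * real m) * (\<Sum>l=1..m-1. real l * s l))) =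
     complex_of_real (- (Digamma (real r / real m) + L + euler_mascheroni))" using S1' by simp
  hence "2 * ((\<Sum>l=1..m-1. c l * G l) - pi / (2 * real m) * (\<Sum>l=1..m-1. real l * s l)) = - (Digamma (real r / real m) + L + euler_mascheroni)"
    by (simp only: of_real_eq_iff)
  thus ?A by (simp add: c_def s_def G_def)
  have "2 * S2 = (\<Sum>l=1..m. of_real (c l) * Z l) + of_real (pi * (\<Sum>l=1..m. s l * g l)) - k ^ 2 * S0"
  proof -
    have "2 * S2 = (\<Sum>l=1..m. of_real (c l) * Z l + 2 * k * (of_real (s l) * of_real (g l)) - k ^ 2 * (of_real (c l) * (1 / 2 - of_real (x l))))"
      unfolding S2_def sum_distrib_left by (intro sum.cong refl) (simp add: field_simps)
    also have "\<dots> = (\<Sum>l=1..m. of_real (c l) * Z l) + 2 * k * (\<Sum>l=1..m. of_real (s l) * of_real (g l)) - k ^ 2 * S0"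
      by (simp only: S0_def sum.distrib sum_subtractf sum_distrib_left)
    also have "2 * k * (\<Sum>l=1..m. of_real (s l) * of_real (g l)) = of_real (pi * (\<Sum>l=1..m. s l * g l))"
      by (simp add: k_def)
    finally show ?thesis .
  qed
  also have "(\<Sum>l=1..m. s l * g l) = (\<Sum>l=1..m. s l * G l) - ln (2 * pi) / 2 * (\<Sum>l=1..m. s l)"
  proof -
    have "(\<Sum>l=1..m. s l * g l) = (\<Sum>l=1..m. s l * G l - ln (2 * pi) / 2 * s l)"
      by (intro sum.cong refl) (simp add: g_def algebra_simps)
    thus ?thesis by (simp only: sum_subtractf sum_distrib_left)
  qed
  also have "\<dots> = (\<Sum>l=1..m-1. s l * G l)" unfolding ss unfolding sum_atLeast1_atMost_pred[OF m1] by (simp add: Gm)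
  also have "(\<Sum>l=1..m. of_real (c l) * Z l) = (\<Sum>l=1..m-1. of_real (c l) * Z l) + hurwitz_zeta_deriv2_0 1"
    unfolding sum_atLeast1_atMost_pred[OF m1] using m0 by (simp add: cm Z_def)
  finally have S2: "2 * S2 = (\<Sum>l=1..m-1. of_real (c l) * Z l) + hurwitz_zeta_deriv2_0 1 + of_real (pi * (\<Sum>l=1..m-1. s l * G l)) + of_real (pi ^ 2 / 8)"
    unfolding S0 by (simp add: k_def power2_eq_square)
  show ?B unfolding e2 S1' S2 W_def G2_def[symmetric]
    by (simp add: c_def s_def G_def Z_def algebra_simps)
qed

end

text \<open>The instance m = 2, r = 1 of the expansion: the only term has l = 1 with cosine -1 and
  sine 0, and gamma_1(1/2), zeta''(0,1/2) and Psi(1/2) are known, which leaves the constant as the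
  only unknown.\<close>

lemma hurwitz_deriv2_0_1_constant:
  "hurwitz_zeta_deriv2_0 1 + of_real (pi ^ 2 / 8) - (deriv ^^ 2) (\<lambda>z. Gamma (1 + z)) 0 / 2 =
     stieltjes 1 - of_real (ln (2 * pi) ^ 2 / 2)" (is "?W = _")
proof -
  have mr: "1 \<in> {1..2 - 1::nat}" "2 \<ge> (2::nat)" by auto
  define W where "W = ?W"
  have L: "ln (4 * pi) = 2 * ln 2 + ln pi"
    using ln_realpow[of 2 2] by (simp add: ln_mult)
  have D: "Digamma (1 / 2) + (2 * ln 2 + ln pi) + euler_mascheroni = ln pi" by (simp add: Digamma_one_half)
  have "gen_stieltjes 1 (1 / 2) = W + of_real (- 1) * hurwitz_zeta_deriv2_0 (1 / 2) +
    of_real ((ln (4 * pi) + euler_mascheroni) * (Digamma (1 / 2) + ln (4 * pi) + euler_mascheroni) - (ln (4 * pi) ^ 2 / 2 + euler_mascheroni * ln (4 * pi)))"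
    using gen_stieltjes_rational_expansion(2)[OF mr] unfolding W_def by (simp add: unity_root_angle_def mult_ac)
  hence "W = gen_stieltjes 1 (1 / 2) + hurwitz_zeta_deriv2_0 (1 / 2) -
    of_real ((ln (4 * pi) + euler_mascheroni) * (Digamma (1 / 2) + ln (4 * pi) + euler_mascheroni) - (ln (4 * pi) ^ 2 / 2 + euler_mascheroni * ln (4 * pi)))"
    by simp
  also have "\<dots> = gen_stieltjes 1 1 - of_real (2 * ln 2 * euler_mascheroni + ln 2 ^ 2 + ln 2 * ln (2 * pi) + ln 2 ^ 2 / 2
     + (2 * ln 2 + ln pi + euler_mascheroni) * ln pi - ((2 * ln 2 + ln pi) ^ 2 / 2 + euler_mascheroni * (2 * ln 2 + ln pi)))"
    unfolding L D gen_stieltjes_half hurwitz_zeta_deriv2_0_half by simp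
  also have "2 * ln 2 * euler_mascheroni + ln 2 ^ 2 + ln 2 * ln (2 * pi) + ln 2 ^ 2 / 2
     + (2 * ln 2 + ln pi + euler_mascheroni) * ln pi - ((2 * ln 2 + ln pi) ^ 2 / 2 + euler_mascheroni * (2 * ln 2 + ln pi)) = ln (2 * pi) ^ 2 / 2"
    by (simp add: ln_mult power2_eq_square field_simps)
  finally show ?thesis unfolding W_def by (simp only: stieltjes_eq_gen_stieltjes)
qed

section \<open>The four closed forms\<close>

context
  fixes m r :: nat
  assumes mr: "r \<in> {1..m - 1}" "m \<ge> 2"
begin

lemma ln_of_products_with_m:
  shows "ln (2 * pi * real m) = ln 2 + ln pi + ln (real m)" "ln (2 * real m) = ln 2 + ln (real m)"
    "ln (pi * real m) = ln pi + ln (real m)" "ln (2 * pi) = ln 2 + ln pi"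
  using mr by (simp_all add: ln_mult)

text \<open>Gauss' digamma theorem: the order 1 coefficient with its ln Gamma sum replaced by
  \<open>sum_cos_ln_Gamma\<close>.\<close>

lemma Digamma_rational:
  "Digamma (real r / real m) = - euler_mascheroni - ln (2 * real m)
     + (\<Sum>l=1..m-1. cosr m r l * lnsin_frac m l)
     + pi / real m * (\<Sum>l=1..m-1. real l * sinr m r l)"
proof -
  define X where "X = (\<Sum>l=1..m-1. cosr m r l * lnsin_frac m l)"
  define Y where "Y = (\<Sum>l=1..m-1. real l * sinr m r l)"
  have "- ln pi / 2 - X / 2 - pi / (2 * real m) * Y = - (Digamma (real r / real m) + (ln 2 + ln pi + ln (real m)) + euler_mascheroni) / 2"
    using gen_stieltjes_rational_expansion(1)[OF mr] unfolding sum_cos_ln_Gamma[OF mr] ln_of_products_with_m X_def Y_def .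
  moreover define T where "T = pi / real m * Y"
  moreover have "pi / (2 * real m) * Y = T / 2" by (simp add: T_def)
  ultimately have "- ln pi / 2 - X / 2 - T / 2 = - (Digamma (real r / real m) + (ln 2 + ln pi + ln (real m)) + euler_mascheroni) / 2"
    by (simp only:)
  hence "Digamma (real r / real m) = - euler_mascheroni - (ln 2 + ln (real m)) + X + T" by (simp add: field_simps)
  thus ?thesis unfolding ln_of_products_with_m X_def[symmetric] Y_def[symmetric] T_def .
qed

lemma gen_stieltjes_1_rational_Digamma:
  "gen_stieltjes 1 (of_nat r / of_nat m) = stieltjes 1
     + of_real (euler_mascheroni ^ 2 + euler_mascheroni * ln (2 * pi * real m)
               + ln (2 * pi) * ln (real m) + 1 / 2 * (ln (real m)) ^ 2
               + (euler_mascheroni + ln (2 * pi * real m)) * Digamma (real r / real m)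
               + pi * (\<Sum>l=1..m-1. sinr m r l * lnGamma_frac m l))
     + (\<Sum>l=1..m-1. of_real (cosr m r l) * zeta2_frac m l)"
proof -
  define C where "C = (\<Sum>l=1..m-1. of_real (cosr m r l) * zeta2_frac m l)"
  define S where "S = (\<Sum>l=1..m-1. sinr m r l * lnGamma_frac m l)"
  define L where "L = ln (2 * pi * real m)"
  define D where "D = Digamma (real r / real m)"
  have "gen_stieltjes 1 (of_nat r / of_nat m) = stieltjes 1 - of_real (ln (2 * pi) ^ 2 / 2) + C +
     of_real (pi * S + (L + euler_mascheroni) * (D + L + euler_mascheroni) - (L ^ 2 / 2 + euler_mascheroni * L))"
    using gen_stieltjes_rational_expansion(2)[OF mr] unfolding hurwitz_deriv2_0_1_constant C_def S_def L_def D_def .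
  also have "\<dots> = stieltjes 1 + of_real (pi * S + (L + euler_mascheroni) * (D + L + euler_mascheroni) - (L ^ 2 / 2 + euler_mascheroni * L) - ln (2 * pi) ^ 2 / 2) + C"
    by (simp only: of_real_diff) simp
  also have "pi * S + (L + euler_mascheroni) * (D + L + euler_mascheroni) - (L ^ 2 / 2 + euler_mascheroni * L) - ln (2 * pi) ^ 2 / 2 =
    euler_mascheroni ^ 2 + euler_mascheroni * L + ln (2 * pi) * ln (real m) + 1 / 2 * (ln (real m)) ^ 2 + (euler_mascheroni + L) * D + pi * S"
    unfolding L_def ln_of_products_with_m by (simp add: power2_eq_square field_simps)
  finally show ?thesis unfolding C_def S_def L_def D_def .
qed

text \<open>Gauss' formula inserted into the Digamma form. The other three forms of the result are
  rearrangements of this one.\<close>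

lemma gen_stieltjes_1_rational_ln_sin:
  "gen_stieltjes 1 (of_nat r / of_nat m) = stieltjes 1
     + of_real (- euler_mascheroni * ln (2 * real m) - (ln 2) ^ 2 - ln 2 * ln (pi * real m) - 1 / 2 * (ln (real m)) ^ 2
       + pi * (\<Sum>l=1..m-1. sinr m r l * lnGamma_frac m l)
       + (euler_mascheroni + ln (2 * pi * real m)) *
         ((\<Sum>l=1..m-1. cosr m r l * lnsin_frac m l)
           + pi / real m * (\<Sum>l=1..m-1. real l * sinr m r l)))
     + (\<Sum>l=1..m-1. of_real (cosr m r l) * zeta2_frac m l)"
proof -
  define S where "S = (\<Sum>l=1..m-1. sinr m r l * lnGamma_frac m l)"
  define X where "X = (\<Sum>l=1..m-1. cosr m r l * lnsin_frac m l)"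
  define Y where "Y = pi / real m * (\<Sum>l=1..m-1. real l * sinr m r l)"
  have "euler_mascheroni ^ 2 + euler_mascheroni * ln (2 * pi * real m) + ln (2 * pi) * ln (real m) + 1 / 2 * (ln (real m)) ^ 2
      + (euler_mascheroni + ln (2 * pi * real m)) * (- euler_mascheroni - ln (2 * real m) + X + Y) + pi * S =
     - euler_mascheroni * ln (2 * real m) - (ln 2) ^ 2 - ln 2 * ln (pi * real m) - 1 / 2 * (ln (real m)) ^ 2
       + pi * S + (euler_mascheroni + ln (2 * pi * real m)) * (X + Y)"
    unfolding ln_of_products_with_m by (simp add: power2_eq_square field_simps)
  thus ?thesis using gen_stieltjes_1_rational_Digamma unfolding Digamma_rational S_def X_def Y_def by (simp only:)
qed

lemma sum_l_sin: "pi / real m * (\<Sum>l=1..m-1. real l * sinr m r l) = - pi / 2 * cot (pi * real r / real m)"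
  unfolding unity_root_sums(3)[OF mr] using mr by simp

lemma sum_sin_half:
  "(\<Sum>l=1..(m-1) div 2. sinr m r l) =
     1 / sin (pi * real r / real m) * sin (pi * real r / real m * real ((m + 1) div 2)) * sin (pi * real r / real m * real ((m - 1) div 2))"
proof -
  define y where "y = pi * real r / real m"
  have "0 < y" "y < pi" using mr by (auto simp: y_def field_simps)
  hence s: "sin y \<noteq> 0" using sin_gt_zero[of y] by simp
  \<comment> \<open>This index shift explains the two different floors in the closed form.\<close>
  have h: "(m - 1) div 2 + 1 = (m + 1) div 2" using mr by (cases m) auto
  have "unity_root_angle m r l = 2 * y * real l" for l by (simp add: unity_root_angle_def y_def)
  hence "sin y * (\<Sum>l=1..(m-1) div 2. sinr m r l) = sin (y * real ((m + 1) div 2)) * sin (y * real ((m - 1) div 2))"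
    using sum_sin_multiples[of y "(m - 1) div 2"] unfolding h by simp
  thus ?thesis using s by (simp add: y_def field_simps)
qed

text \<open>The sine is odd under l -> m - l, so a pair contributes ln Gamma(x) - ln Gamma(1 - x).
  By the reflection formula this is 2 ln Gamma(x) + ln sin (pi x) - ln pi.\<close>

lemma sum_sin_ln_Gamma_fold:
  "(\<Sum>l=1..m-1. sinr m r l * lnGamma_frac m l) =
     2 * (\<Sum>l=1..(m-1) div 2. sinr m r l * lnGamma_frac m l)
     + (\<Sum>l=1..(m-1) div 2. sinr m r l * lnsin_frac m l)
     - ln pi * (\<Sum>l=1..(m-1) div 2. sinr m r l)"
proof -
  have "(\<Sum>l=1..m-1. sinr m r l * lnGamma_frac m l) =
    (\<Sum>l=1..(m-1) div 2. sinr m r l * lnGamma_frac m l + sinr m r (m - l) * lnGamma_frac m (m - l))"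
    using unity_root_angle_half(2)[OF mr] by (subst sum_fold_reflect[OF mr(2)]) simp
  also have "\<dots> = (\<Sum>l=1..(m-1) div 2. sinr m r l * (2 * lnGamma_frac m l + lnsin_frac m l - ln pi))"
  proof (intro sum.cong refl)
    fix l assume "l \<in> {1..(m-1) div 2}"
    hence l: "1 \<le> l" "l < m" using mr by auto
    have e: "real (m - l) / real m = 1 - real l / real m" using l by (simp add: of_nat_diff field_simps)
    have e': "ln (Gamma (1 - real l / real m)) = ln pi - lnsin_frac m l - lnGamma_frac m l"
      using ln_Gamma_reflection_real[of "real l / real m"] l by simp
    show "sinr m r l * lnGamma_frac m l + sinr m r (m - l) * lnGamma_frac m (m - l) =
      sinr m r l * (2 * lnGamma_frac m l + lnsin_frac m l - ln pi)"
      unfolding e e' unity_root_angle_reflect(2)[OF mr less_imp_le[OF l(2)]] by (simp add: algebra_simps)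
  qed
  finally show ?thesis by (simp add: sum.distrib sum_subtractf sum_distrib_left algebra_simps)
qed

text \<open>Both factors are even under the reflection, and the midpoint contributes ln sin (pi/2) =
  0.\<close>

lemma sum_cos_ln_sin_fold:
  "(\<Sum>l=1..m-1. cosr m r l * lnsin_frac m l) =
     2 * (\<Sum>l=1..(m-1) div 2. cosr m r l * lnsin_frac m l)"
proof -
  have z: "lnsin_frac m (m div 2) = 0" if "even m"
  proof -
    have "pi * real (m div 2) / real m = pi / 2" using mr that by (auto elim!: evenE)
    thus ?thesis by (simp only: sin_pi_half ln_one)
  qed
  have "(\<Sum>l=1..m-1. cosr m r l * lnsin_frac m l) =
    (\<Sum>l=1..(m-1) div 2. cosr m r l * lnsin_frac m l + cosr m r (m - l) * lnsin_frac m (m - l))"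
    by (subst sum_fold_reflect[OF mr(2)]) (simp add: z)
  also have "\<dots> = (\<Sum>l=1..(m-1) div 2. 2 * (cosr m r l * lnsin_frac m l))"
  proof (intro sum.cong refl)
    fix l assume "l \<in> {1..(m-1) div 2}"
    hence l: "1 \<le> l" "l < m" using mr by auto
    have e: "pi * real (m - l) / real m = pi - pi * real l / real m" using l by (simp add: of_nat_diff field_simps)
    show "cosr m r l * lnsin_frac m l + cosr m r (m - l) * lnsin_frac m (m - l)
      = 2 * (cosr m r l * lnsin_frac m l)"
      unfolding e sin_pi_minus using unity_root_angle_reflect(1)[OF mr, of l] l by simp
  qed
  finally show ?thesis by (simp add: sum_distrib_left)
qed

text \<open>The midpoint term (-1)^r zeta''(0,1/2) exists only for even m; the factor 1 - (-1)^(m+1)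
  is 2 for even m and 0 for odd m.\<close>

lemma sum_cos_deriv2_fold:
  "(\<Sum>l=1..m-1. of_real (cosr m r l) * zeta2_frac m l) =
     (\<Sum>l=1..(m-1) div 2. of_real (cosr m r l) *
        (zeta2_frac m l + hurwitz_zeta_deriv2_0 (1 - of_nat l / of_nat m)))
     + of_real (- ((-1) ^ r) / 4 * (1 - (-1) ^ (m + 1)) * (3 * ln 2 + 2 * ln pi) * ln 2)"
proof -
  define f where "f = (\<lambda>l. of_real (cosr m r l) * zeta2_frac m l)"
  have half: "(if even m then f (m div 2) else 0) = of_real (- ((-1) ^ r) / 4 * (1 - (-1) ^ (m + 1)) * (3 * ln 2 + 2 * ln pi) * ln 2)"
  proof (cases "even m")
    case True
    hence "of_nat (m div 2) / of_nat m = (1 / 2 :: complex)" using mr by (auto elim!: evenE)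
    hence "f (m div 2) = of_real ((-1) ^ r) * (- of_real (ln 2 * ln (2 * pi)) - of_real (ln 2) ^ 2 / 2)"
      by (simp only: f_def unity_root_angle_half(1)[OF mr True] hurwitz_zeta_deriv2_0_half)
    also have "\<dots> = of_real ((-1) ^ r * (- (ln 2 * ln (2 * pi)) - (ln 2) ^ 2 / 2))" by simp
    also have "(-1) ^ r * (- (ln 2 * ln (2 * pi)) - (ln 2) ^ 2 / 2) = - ((-1) ^ r) / 4 * (1 - (-1) ^ (m + 1)) * (3 * ln 2 + 2 * ln pi) * ln 2"
      using True by (simp add: ln_mult power2_eq_square field_simps)
    finally show ?thesis using True by simp
  qed auto
  have "(\<Sum>l=1..(m-1) div 2. f l + f (m - l)) = (\<Sum>l=1..(m-1) div 2. of_real (cosr m r l) *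
        (zeta2_frac m l + hurwitz_zeta_deriv2_0 (1 - of_nat l / of_nat m)))"
  proof (intro sum.cong refl)
    fix l assume "l \<in> {1..(m-1) div 2}"
    hence l: "1 \<le> l" "l < m" using mr by auto
    have e: "of_nat (m - l) / of_nat m = (1 - of_nat l / of_nat m :: complex)" using l by (simp add: of_nat_diff field_simps)
    show "f l + f (m - l) = of_real (cosr m r l) *
        (zeta2_frac m l + hurwitz_zeta_deriv2_0 (1 - of_nat l / of_nat m))"
      unfolding f_def e using unity_root_angle_reflect(1)[OF mr, of l] l by (simp add: ring_distribs)
  qed
  thus ?thesis using sum_fold_reflect[OF mr(2), of f] unfolding half by (simp only: f_def)
qed

lemma add_of_real_add_cong: "x = y \<Longrightarrow> a + complex_of_real x + b = a + of_real y + b"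
  by simp

lemma gen_stieltjes_1_rational_half_sums:
  "gen_stieltjes 1 (of_nat r / of_nat m) =
           stieltjes 1
           + complex_of_real
              (- euler_mascheroni * ln (2 * real m) - (ln 2)^2 - ln 2 * ln (pi * real m)
               - 1 / 2 * (ln (real m))^2
               - pi / 2 * (euler_mascheroni + ln (2 * pi * real m)) * cot (pi * real r / real m)
               - (-1) ^ r / 4 * (1 - (-1) ^ (m + 1)) * (3 * ln 2 + 2 * ln pi) * ln 2
               - pi * ln pi * (1 / sin (pi * real r / real m))
                 * sin (pi * real r / real m * real ((m + 1) div 2))
                 * sin (pi * real r / real m * real ((m - 1) div 2))
               + 2 * (euler_mascheroni + ln (2 * pi * real m))
                 * (\<Sum>l = 1..(m - 1) div 2. cosr m r l * lnsin_frac m l)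
               + pi * (\<Sum>l = 1..(m - 1) div 2. sinr m r l * lnsin_frac m l)
               + 2 * pi * (\<Sum>l = 1..(m - 1) div 2. sinr m r l * lnGamma_frac m l))
           + (\<Sum>l = 1..(m - 1) div 2. complex_of_real (cosr m r l)
                * (zeta2_frac m l
                   + hurwitz_zeta_deriv2_0 (1 - of_nat l / of_nat m)))"
proof -
  define C where "C = (\<Sum>l = 1..(m - 1) div 2. complex_of_real (cosr m r l)
                * (zeta2_frac m l + hurwitz_zeta_deriv2_0 (1 - of_nat l / of_nat m)))"
  define H where "H = - ((-1) ^ r) / 4 * (1 - (-1) ^ (m + 1)) * (3 * ln 2 + 2 * ln pi) * ln (2::real)"
  define P where "P = 1 / sin (pi * real r / real m) * sin (pi * real r / real m * real ((m + 1) div 2)) * sin (pi * real r / real m * real ((m - 1) div 2))"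
  have "stieltjes 1 + of_real q + (C + of_real H) = stieltjes 1 + of_real (q + H) + C" for q by simp
  note eq = gen_stieltjes_1_rational_ln_sin[unfolded sum_cos_deriv2_fold, folded C_def H_def, unfolded this,
      unfolded sum_sin_ln_Gamma_fold sum_cos_ln_sin_fold sum_l_sin sum_sin_half, folded P_def]
  show ?thesis unfolding C_def[symmetric] eq
    by (rule add_of_real_add_cong) (simp add: H_def P_def algebra_simps)
qed

lemma gen_stieltjes_1_rational_cot:
  "gen_stieltjes 1 (of_nat r / of_nat m) =
           stieltjes 1
           - complex_of_real (euler_mascheroni * ln (2 * real m))
           + (\<Sum>l = 1..m - 1. complex_of_real (cosr m r l)
                * zeta2_frac m l)
           + complex_of_real
              (pi * (\<Sum>l = 1..m - 1. sinr m r l * lnGamma_frac m l)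
               - (ln 2)^2
               - pi / 2 * (euler_mascheroni + ln (2 * pi * real m)) * cot (pi * real r / real m)
               + (euler_mascheroni + ln (2 * pi * real m))
                 * (\<Sum>l = 1..m - 1. cosr m r l * lnsin_frac m l)
               - ln 2 * ln (pi * real m) - 1 / 2 * (ln (real m))^2)"
proof -
  have rearr: "a - of_real x + C + of_real y = a + of_real (y - x) + C" for a C :: complex and x y :: real by simp
  show ?thesis unfolding rearr gen_stieltjes_1_rational_ln_sin sum_l_sin
    by (rule add_of_real_add_cong) (simp add: algebra_simps)
qed

lemma gen_stieltjes_1_rational_merged_sums:
  "gen_stieltjes 1 (of_nat r / of_nat m) =
           stieltjes 1
           + complex_of_real
              (- euler_mascheroni * ln (2 * real m) - (ln 2)^2 - ln 2 * ln (pi * real m)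
               - 1 / 2 * (ln (real m))^2
               + pi * (\<Sum>l = 1..m - 1. sinr m r l
                   * (lnGamma_frac m l + real l * (euler_mascheroni + ln (2 * pi * real m)) / real m)))
           + (\<Sum>l = 1..m - 1. complex_of_real (cosr m r l)
                * (zeta2_frac m l
                   + complex_of_real ((euler_mascheroni + ln (2 * pi * real m)) * lnsin_frac m l)))"
proof -
  define E where "E = euler_mascheroni + ln (2 * pi * real m)"
  define C where "C = (\<Sum>l=1..m-1. of_real (cosr m r l) * zeta2_frac m l)"
  define X where "X = (\<Sum>l=1..m-1. cosr m r l * lnsin_frac m l)"
  have 1: "(\<Sum>l = 1..m - 1. complex_of_real (cosr m r l)
                * (zeta2_frac m l + complex_of_real (E * lnsin_frac m l))) =
     C + of_real (E * X)"
    by (simp add: C_def X_def ring_distribs sum.distrib sum_distrib_left mult_ac)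
  have 2: "(\<Sum>l = 1..m - 1. sinr m r l * (lnGamma_frac m l + real l * E / real m)) =
     (\<Sum>l=1..m-1. sinr m r l * lnGamma_frac m l) + E / real m * (\<Sum>l=1..m-1. real l * sinr m r l)"
    by (simp add: ring_distribs sum.distrib sum_distrib_left mult_ac)
  have rearr: "a + of_real x + (C + of_real y) = a + of_real (x + y) + C" for a :: complex and x y :: real by simp
  show ?thesis unfolding E_def[symmetric] 1 2 rearr gen_stieltjes_1_rational_ln_sin C_def[symmetric] X_def[symmetric]
    by (rule add_of_real_add_cong) (simp add: algebra_simps)
qed

end

theorem theorem1:
  shows "(\<forall>m r :: nat. m \<ge> 2 \<longrightarrow> r \<in> {1..m - 1} \<longrightarrow>
         gen_stieltjes 1 (of_nat r / of_nat m) =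
           stieltjes 1
           + complex_of_real
              (- euler_mascheroni * ln (2 * real m) - (ln 2)^2 - ln 2 * ln (pi * real m)
               - 1 / 2 * (ln (real m))^2
               - pi / 2 * (euler_mascheroni + ln (2 * pi * real m)) * cot (pi * real r / real m)
               - (-1) ^ r / 4 * (1 - (-1) ^ (m + 1)) * (3 * ln 2 + 2 * ln pi) * ln 2
               - pi * ln pi * (1 / sin (pi * real r / real m))
                 * sin (pi * real r / real m * real ((m + 1) div 2))
                 * sin (pi * real r / real m * real ((m - 1) div 2))
               + 2 * (euler_mascheroni + ln (2 * pi * real m))
                 * (\<Sum>l = 1..(m - 1) div 2. cos (2 * pi * real r * real l / real m) * ln (sin (pi * real l / real m)))
               + pi * (\<Sum>l = 1..(m - 1) div 2. sin (2 * pi * real r * real l / real m) * ln (sin (pi * real l / real m)))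
               + 2 * pi * (\<Sum>l = 1..(m - 1) div 2. sin (2 * pi * real r * real l / real m) * ln (Gamma (real l / real m))))
           + (\<Sum>l = 1..(m - 1) div 2. complex_of_real (cos (2 * pi * real r * real l / real m))
                * (hurwitz_zeta_deriv2_0 (of_nat l / of_nat m)
                   + hurwitz_zeta_deriv2_0 (1 - of_nat l / of_nat m))) \<and>
         gen_stieltjes 1 (of_nat r / of_nat m) =
           stieltjes 1
           - complex_of_real (euler_mascheroni * ln (2 * real m))
           + (\<Sum>l = 1..m - 1. complex_of_real (cos (2 * pi * real r * real l / real m))
                * hurwitz_zeta_deriv2_0 (of_nat l / of_nat m))
           + complex_of_real
              (pi * (\<Sum>l = 1..m - 1. sin (2 * pi * real r * real l / real m) * ln (Gamma (real l / real m)))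
               - (ln 2)^2
               - pi / 2 * (euler_mascheroni + ln (2 * pi * real m)) * cot (pi * real r / real m)
               + (euler_mascheroni + ln (2 * pi * real m))
                 * (\<Sum>l = 1..m - 1. cos (2 * pi * real r * real l / real m) * ln (sin (pi * real l / real m)))
               - ln 2 * ln (pi * real m) - 1 / 2 * (ln (real m))^2) \<and>
         gen_stieltjes 1 (of_nat r / of_nat m) =
           stieltjes 1
           + complex_of_real
              (euler_mascheroni^2 + euler_mascheroni * ln (2 * pi * real m)
               + ln (2 * pi) * ln (real m) + 1 / 2 * (ln (real m))^2
               + (euler_mascheroni + ln (2 * pi * real m)) * Digamma (real r / real m)
               + pi * (\<Sum>l = 1..m - 1. sin (2 * pi * real r * real l / real m) * ln (Gamma (real l / real m))))
           + (\<Sum>l = 1..m - 1. complex_of_real (cos (2 * pi * real r * real l / real m))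
                * hurwitz_zeta_deriv2_0 (of_nat l / of_nat m)) \<and>
         gen_stieltjes 1 (of_nat r / of_nat m) =
           stieltjes 1
           + complex_of_real
              (- euler_mascheroni * ln (2 * real m) - (ln 2)^2 - ln 2 * ln (pi * real m)
               - 1 / 2 * (ln (real m))^2
               + pi * (\<Sum>l = 1..m - 1. sin (2 * pi * real r * real l / real m)
                   * (ln (Gamma (real l / real m)) + real l * (euler_mascheroni + ln (2 * pi * real m)) / real m)))
           + (\<Sum>l = 1..m - 1. complex_of_real (cos (2 * pi * real r * real l / real m))
                * (hurwitz_zeta_deriv2_0 (of_nat l / of_nat m)
                   + complex_of_real ((euler_mascheroni + ln (2 * pi * real m)) * ln (sin (pi * real l / real m)))))) \<and>
     (\<forall>v :: complex. v \<notin> \<int>\<^sub>\<le>\<^sub>0 \<longrightarrow>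
         gen_stieltjes 1 (v + 1) = gen_stieltjes 1 v - ln v / v)"
proof (intro conjI allI impI)
  fix v :: complex
  assume "v \<notin> \<int>\<^sub>\<le>\<^sub>0"
  thus "gen_stieltjes 1 (v + 1) = gen_stieltjes 1 v - ln v / v" by (rule gen_stieltjes_1_plus_1)
qed (rule gen_stieltjes_1_rational_half_sums[unfolded unity_root_angle_def]
       gen_stieltjes_1_rational_cot[unfolded unity_root_angle_def]
       gen_stieltjes_1_rational_Digamma[unfolded unity_root_angle_def]
       gen_stieltjes_1_rational_merged_sums[unfolded unity_root_angle_def]; assumption)+

end
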